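(* Let $\gamma<0$ and $1<p<3$. Then for any $\tilde m>0$ there exists $L^*=L^*(\tilde m)>0$ such that for any $0<L<L^*$, every real-valued and positive minimizer of $$e_{m,\gamma}=\inf\{E_\gamma(u): u\in H^1(\mathbb S_L),\ M(u)=m\}\qquad\text{with } m=\tilde m L$$ does not depend on the transverse variable $y$.
   Context: For $L>0$, $\mathbb S_L=\mathbb R\times[0,L]$ with variables $(x,y)$, and $H^1(\mathbb S_L)$ is the usual Sobolev space of complex-valued functions; $u(0,y)$ denotes the trace of $u$ on $\{x=0\}$, which belongs to $L^2(0,L)$. The energy and mass are $$E_\gamma(u)=\tfrac12\|\nabla u\|_{L^2(\mathbb S_L)}^2+\tfrac{\gamma}{2}\int_0^L|u(0,y)|^2dy-\tfrac1{p+1}\|u\|_{L^{p+1}(\mathbb S_L)}^{p+1},\qquad M(u)=\|u\|_{L^2(\mathbb S_L)}^2.$$ (For $\gamma<0$, $1<p<3$ and every $m>0$, the paper shows that such a real-valued positive minimizer exists.) *)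

theory Defs
  imports "HOL-Analysis.Analysis"
begin

definition strip :: "real \<Rightarrow> (real \<times> real) set" where
  "strip L = UNIV \<times> {0..L}"

definition L2_fun :: "'a measure \<Rightarrow> ('a \<Rightarrow> complex) \<Rightarrow> bool" where
  "L2_fun M f \<longleftrightarrow> f \<in> borel_measurable M \<and> integrable M (\<lambda>z. (cmod (f z))\<^sup>2)"

abbreviation dirD :: "'a \<Rightarrow> ('a::euclidean_space \<Rightarrow> real) \<Rightarrow> 'a \<Rightarrow> real" where
  "dirD e f \<equiv> (\<lambda>z. frechet_derivative f (at z) e)"

primrec Ck_fun :: "nat \<Rightarrow> ('a::euclidean_space \<Rightarrow> real) \<Rightarrow> bool" where
  "Ck_fun 0 f \<longleftrightarrow> continuous_on UNIV f"
| "Ck_fun (Suc k) f \<longleftrightarrow> (\<forall>z. f differentiable (at z)) \<and> (\<forall>e. Ck_fun k (dirD e f))"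

text \<open>Test functions are \<open>C\<^sup>\<infinity>\<close> with compact support in the open strip.\<close>
definition test_fun :: "real \<Rightarrow> (real \<times> real \<Rightarrow> real) \<Rightarrow> bool" where
  "test_fun L \<phi> \<longleftrightarrow> (\<forall>k. Ck_fun k \<phi>) \<and>
     (\<exists>K. compact K \<and> K \<subseteq> UNIV \<times> {0<..<L} \<and> (\<forall>z. z \<notin> K \<longrightarrow> \<phi> z = 0))"

definition has_weak_deriv ::
    "real \<Rightarrow> real \<times> real \<Rightarrow> (real \<times> real \<Rightarrow> complex) \<Rightarrow> (real \<times> real \<Rightarrow> complex) \<Rightarrow> bool" where
  "has_weak_deriv L e u v \<longleftrightarrow> L2_fun (lebesgue_on (strip L)) v \<and>
     (\<forall>\<phi>. test_fun L \<phi> \<longrightarrow>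
        (LINT z|lebesgue_on (strip L). dirD e \<phi> z *\<^sub>R u z)
          = - (LINT z|lebesgue_on (strip L). \<phi> z *\<^sub>R v z))"

text \<open>Elements of \<open>L\<^sup>2\<close> and \<open>H\<^sup>1\<close> are represented by functions; weak derivatives and traces are
  determined only up to null sets, so that the choices below do not affect any integral.\<close>
definition weak_deriv ::
    "real \<Rightarrow> real \<times> real \<Rightarrow> (real \<times> real \<Rightarrow> complex) \<Rightarrow> real \<times> real \<Rightarrow> complex" where
  "weak_deriv L e u = (SOME v. has_weak_deriv L e u v)"

definition H1 :: "real \<Rightarrow> (real \<times> real \<Rightarrow> complex) set" where
  "H1 L = {u. L2_fun (lebesgue_on (strip L)) u \<and>
              (\<exists>v. has_weak_deriv L (1, 0) u v) \<and> (\<exists>v. has_weak_deriv L (0, 1) u v)}"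

definition mass :: "real \<Rightarrow> (real \<times> real \<Rightarrow> complex) \<Rightarrow> real" where
  "mass L u = (LINT z|lebesgue_on (strip L). (cmod (u z))\<^sup>2)"

definition grad_norm_sq :: "real \<Rightarrow> (real \<times> real \<Rightarrow> complex) \<Rightarrow> real" where
  "grad_norm_sq L u = (LINT z|lebesgue_on (strip L).
     (cmod (weak_deriv L (1, 0) u z))\<^sup>2 + (cmod (weak_deriv L (0, 1) u z))\<^sup>2)"

text \<open>The trace on \<open>{x = 0}\<close> is the continuous extension to \<open>H\<^sup>1\<close>, with values in \<open>L\<^sup>2(0,L)\<close>,
  of the restriction map on the \<open>H\<^sup>1\<close> functions that are continuous on the closed strip.\<close>
definition has_trace :: "real \<Rightarrow> (real \<times> real \<Rightarrow> complex) \<Rightarrow> (real \<Rightarrow> complex) \<Rightarrow> bool" where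
  "has_trace L u g \<longleftrightarrow> L2_fun (lebesgue_on {0..L}) g \<and>
     (\<exists>v :: nat \<Rightarrow> real \<times> real \<Rightarrow> complex.
        (\<forall>n. v n \<in> H1 L \<and> continuous_on (strip L) (v n)) \<and>
        (\<lambda>n. mass L (\<lambda>z. v n z - u z) + grad_norm_sq L (\<lambda>z. v n z - u z)) \<longlonglongrightarrow> 0 \<and>
        (\<lambda>n. LINT y|lebesgue_on {0..L}. (cmod (v n (0, y) - g y))\<^sup>2) \<longlonglongrightarrow> 0)"

definition trace0 :: "real \<Rightarrow> (real \<times> real \<Rightarrow> complex) \<Rightarrow> real \<Rightarrow> complex" where
  "trace0 L u = (SOME g. has_trace L u g)"

definition energy :: "real \<Rightarrow> real \<Rightarrow> real \<Rightarrow> (real \<times> real \<Rightarrow> complex) \<Rightarrow> real" where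
  "energy \<gamma> p L u =
     1 / 2 * grad_norm_sq L u
     + \<gamma> / 2 * (LINT y|lebesgue_on {0..L}. (cmod (trace0 L u y))\<^sup>2)
     - 1 / (p + 1) * (LINT z|lebesgue_on (strip L). cmod (u z) powr (p + 1))"

text \<open>The infimum is taken in the extended reals, so that its value is meaningful even without
  knowing that the energy is bounded below.\<close>
definition ground_energy :: "real \<Rightarrow> real \<Rightarrow> real \<Rightarrow> real \<Rightarrow> ereal" where
  "ground_energy \<gamma> p L m = Inf {ereal (energy \<gamma> p L u) | u. u \<in> H1 L \<and> mass L u = m}"

definition is_minimizer ::
    "real \<Rightarrow> real \<Rightarrow> real \<Rightarrow> real \<Rightarrow> (real \<times> real \<Rightarrow> complex) \<Rightarrow> bool" where
  "is_minimizer \<gamma> p L m u \<longleftrightarrow>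
     u \<in> H1 L \<and> mass L u = m \<and> ereal (energy \<gamma> p L u) = ground_energy \<gamma> p L m"

definition real_positive :: "real \<Rightarrow> (real \<times> real \<Rightarrow> complex) \<Rightarrow> bool" where
  "real_positive L u \<longleftrightarrow> (AE z in lebesgue_on (strip L). Im (u z) = 0 \<and> Re (u z) > 0)"

definition indep_of_y :: "real \<Rightarrow> (real \<times> real \<Rightarrow> complex) \<Rightarrow> bool" where
  "indep_of_y L u \<longleftrightarrow>
     (\<exists>f :: real \<Rightarrow> complex. AE z in lebesgue_on (strip L). u z = f (fst z))"

end

theory Submission
  imports Defs
begin

text \<open>On a line put \<open>\<theta> = sup \<bar>v\<bar>\<^sup>2\<close> and let \<open>\<omega> = \<gamma>\<^sup>2 / 4 + 2 / (p + 1) \<theta> powr ((p - 1) / 2)\<close> be the frequency of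
  the ground state with maximum \<open>sqrt \<theta>\<close>. The Modica-Mortola inequality for this frequency bounds
  the one-dimensional energy of \<open>v\<close> from below by a function of \<open>\<theta>\<close> and of the mass \<open>\<mu>\<close> only. It is
  here that \<open>\<gamma> < 0\<close> is used: the delta term is at least \<open>\<gamma> \<theta> / 2\<close>, wherever the maximum is
  attained. Minimizing over \<open>\<theta>\<close> gives
  \<open>e(\<mu>) \<ge> e(m) - \<omega> / 2 (\<mu> - m) - C (\<mu> - m)\<^sup>2 (2 m + \<mu>)\<close>, where \<open>e(m)\<close> is the energy of the explicit ground state
  of mass \<open>m\<close> and \<open>\<omega>\<close> is now its frequency.

  On the strip let \<open>\<mu> y\<close> be the mass of the slice at height \<open>y\<close>, let \<open>m\<close> be its mean and \<open>D\<close> the square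
  norm of the derivative of \<open>u\<close> in \<open>y\<close>. Then \<open>(\<mu> y - m)\<^sup>2 \<le> 4 m L D\<close>, and integration over the slices
  yields \<open>E(u) \<ge> L e(m) + (1 / 2 - C' L\<^sup>2) D\<close>. The ground state on the line, extended constantly in \<open>y\<close>,
  has energy \<open>L e(m)\<close>; hence \<open>D = 0\<close> for a minimizer if \<open>L\<close> is small. The lower bound is proved for
  mollified functions, which are smooth up to the boundary, and passes to the limit by Fatou's lemma for
  the power term.\<close>

section \<open>Test functions\<close>

text \<open>The one-dimensional bound is sharp only if its frequency fits the slice. With
  \<open>freq\<close> taken at the maximum \<theta> of the slice, the square root of
  \<open>freq - k * s powr q\<close> is real for all values s that occur, and its integral is that
  of a true ground state. The price is a parameter \<theta> that varies with the slice and is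
  unrelated to its mass \<mu>. Two facts remove it. The derivative of \<open>act\<close> is that of
  \<open>freq\<close> times \<open>gmass / 2\<close>, so \<open>act - freq * \<mu> / 2\<close> is
  stationary in \<theta> where the ground state has mass \<mu>; and \<open>gmass\<close> grows at
  least like \<theta> to the power q/2, which makes this point a minimum and bounds the defect by a
  polynomial.

  The defect is quadratic at \<mu> = m. The linear term integrates to zero over the slices, and the
  square of \<mu> - m is just what D controls.

  The other obstacle is that functions are known only almost everywhere, while derivatives and
  traces are fixed by choice. Hence the detour through Borel representatives with explicit weak
  derivatives and an explicit trace.\<close>

definition flat :: "nat \<Rightarrow> real \<Rightarrow> real" where
  "flat k t = (if t > 0 then exp (- (1 / t)) / t ^ k else 0)"

lemma flat_tendsto_0: "(flat k \<longlongrightarrow> 0) (at 0)"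
proof (rule filterlim_split_at)
  have "((\<lambda>x::real. x ^ k / exp x) \<longlongrightarrow> 0) at_top"
    by (rule tendsto_power_div_exp_0)
  then have "((\<lambda>t::real. inverse t ^ k / exp (inverse t)) \<longlongrightarrow> 0) (at_right 0)"
    by (rule filterlim_compose) (rule filterlim_inverse_at_top_right)
  then show "(flat k \<longlongrightarrow> 0) (at_right 0)"
    by (rule Lim_transform_eventually)
       (auto simp: eventually_at_right_field flat_def exp_minus field_simps intro!: exI[of _ 1])
  show "(flat k \<longlongrightarrow> 0) (at_left 0)"
    by (rule tendsto_eventually)
       (auto simp: eventually_at_left_field flat_def intro!: exI[of _ "-1"])
qed

lemma flat_has_derivative:
  "(flat k has_real_derivative flat (k + 2) t - real k * flat (k + 1) t) (at t)"
proof -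
  consider "t > 0" | "t < 0" | "t = 0" by linarith
  then show ?thesis
  proof cases
    case 1
    have pw: "real k * t ^ (k - Suc 0) = real k * t ^ k / t"
      using 1 by (cases k) auto
    have "((\<lambda>t. exp (- (1 / t)) / t ^ k) has_real_derivative
        flat (k + 2) t - real k * flat (k + 1) t) (at t)"
      using 1 pw
      by (auto intro!: derivative_eq_intros simp: flat_def field_simps power2_eq_square)
    then show ?thesis
      by (rule has_field_derivative_transform_within_open[where S = "{0<..}"])
         (use 1 in \<open>auto simp: flat_def\<close>)
  next
    case 2
    have "((\<lambda>t. 0) has_real_derivative flat (k + 2) t - real k * flat (k + 1) t) (at t)"
      using 2 by (simp add: flat_def)
    then show ?thesis
      by (rule has_field_derivative_transform_within_open[where S = "{..<0}"])
         (use 2 in \<open>auto simp: flat_def\<close>)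
  next
    case 3
    \<comment> \<open>At 0 the difference quotient of \<open>flat k\<close> is
      \<open>flat (k + 1)\<close> itself, including the value 0 at \<open>h = 0\<close> by division
      by zero.\<close>
    have "(\<lambda>h. (flat k (0 + h) - flat k 0) / h) = flat (k + 1)"
      by (auto simp: flat_def fun_eq_iff)
    then show ?thesis
      using flat_tendsto_0[of "k + 1"] 3 unfolding DERIV_def by (simp add: flat_def)
  qed
qed

text \<open>A syntactic class that is closed under partial derivatives, so that
  \<open>Ck_fun k\<close> follows for all \<open>k\<close> by induction. The division by
  \<open>t ^ k\<close> in \<open>flat\<close> is what closes it: differentiation leads to the
  members \<open>k + 1\<close> and \<open>k + 2\<close> of the same family.\<close>

inductive smooth_fun :: "('a::euclidean_space \<Rightarrow> real) \<Rightarrow> bool" where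
  smooth_const: "smooth_fun (\<lambda>_. c)"
| smooth_flat: "smooth_fun (\<lambda>z. flat k (c + z \<bullet> d))"
| smooth_add: "smooth_fun f \<Longrightarrow> smooth_fun g \<Longrightarrow> smooth_fun (\<lambda>z. f z + g z)"
| smooth_mult: "smooth_fun f \<Longrightarrow> smooth_fun g \<Longrightarrow> smooth_fun (\<lambda>z. f z * g z)"

lemma smooth_fun_derivative:
  assumes "smooth_fun f"
  shows "\<exists>f'. (\<forall>z. (f has_derivative f' z) (at z)) \<and> (\<forall>e. smooth_fun (\<lambda>z. f' z e))"
  using assms
proof induction
  case (smooth_const c)
  show ?case
    by (rule exI[of _ "\<lambda>_ _. 0"]) (auto intro: smooth_fun.smooth_const)
next
  case (smooth_flat k c d)
  let ?f' = "\<lambda>z e. (flat (k + 2) (c + z \<bullet> d) + - real k * flat (k + 1) (c + z \<bullet> d)) * (e \<bullet> d)"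
  have "((\<lambda>z. flat k (c + z \<bullet> d)) has_derivative ?f' z) (at z)" for z
    by (rule has_derivative_eq_rhs, rule DERIV_compose_FDERIV[OF flat_has_derivative])
       (auto intro!: derivative_eq_intros simp: algebra_simps)
  moreover have "smooth_fun (\<lambda>z. ?f' z e)" for e
    by (intro smooth_fun.intros)
  ultimately show ?case by (intro exI[of _ ?f']) blast
next
  case (smooth_add f g)
  then obtain f' g' where
    "\<And>z. (f has_derivative f' z) (at z)" "\<And>e. smooth_fun (\<lambda>z. f' z e)"
    "\<And>z. (g has_derivative g' z) (at z)" "\<And>e. smooth_fun (\<lambda>z. g' z e)" by blast
  then show ?case
    by (intro exI[of _ "\<lambda>z e. f' z e + g' z e"])
       (auto intro!: smooth_fun.intros derivative_intros)
next
  case (smooth_mult f g)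
  then obtain f' g' where
    "\<And>z. (f has_derivative f' z) (at z)" "\<And>e. smooth_fun (\<lambda>z. f' z e)"
    "\<And>z. (g has_derivative g' z) (at z)" "\<And>e. smooth_fun (\<lambda>z. g' z e)" by blast
  then show ?case using smooth_mult.hyps
    by (intro exI[of _ "\<lambda>z e. f z * g' z e + f' z e * g z"])
       (auto intro!: smooth_fun.intros has_derivative_mult)
qed

lemma smooth_fun_differentiable: "smooth_fun f \<Longrightarrow> f differentiable at z"
  using smooth_fun_derivative by (metis differentiable_def)

lemma smooth_fun_Ck: "smooth_fun f \<Longrightarrow> Ck_fun k f"
proof (induction k arbitrary: f)
  case 0
  then show ?case
    by (auto intro!: continuous_at_imp_continuous_on differentiable_imp_continuous_within
        smooth_fun_differentiable)
next
  case (Suc k)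
  obtain f' where f': "\<And>z. (f has_derivative f' z) (at z)" "\<And>e. smooth_fun (\<lambda>z. f' z e)"
    using smooth_fun_derivative[OF Suc.prems] by blast
  have "frechet_derivative f (at z) = f' z" for z
    using frechet_derivative_at[OF f'(1)] by simp
  then show ?case
    using Suc f' smooth_fun_differentiable by auto
qed

text \<open>Smoothness is asked of the translated products in the plane, since these are the test
  functions to which the definition of the weak derivative is applied. The derivative is an explicit
  argument because it serves as a kernel too.\<close>

definition mollifier :: "real \<Rightarrow> (real \<Rightarrow> real) \<Rightarrow> (real \<Rightarrow> real) \<Rightarrow> bool" where
  "mollifier \<epsilon> \<rho> \<rho>' \<longleftrightarrow> (\<forall>s. (\<rho> has_real_derivative \<rho>' s) (at s)) \<and> continuous_on UNIV \<rho>' \<and>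
     (\<forall>s. \<rho> s \<ge> 0) \<and> (\<forall>s. \<bar>s\<bar> \<ge> \<epsilon> \<longrightarrow> \<rho> s = 0 \<and> \<rho>' s = 0) \<and>
     integrable lborel \<rho> \<and> (LINT s|lborel. \<rho> s) = 1 \<and>
     (\<forall>x y. smooth_fun (\<lambda>w::real\<times>real. \<rho> (fst w - x) * \<rho> (snd w - y)))"

lemma mollifier_exists:
  assumes "\<epsilon> > 0"
  shows "\<exists>\<rho> \<rho>'. mollifier \<epsilon> \<rho> \<rho>'"
proof -
  \<comment> \<open>One factor vanishes for \<open>s \<le> - \<epsilon>\<close>, the other for
    \<open>s \<ge> \<epsilon>\<close>; in between both are positive.\<close>
  define b where "b s = flat 0 (1 + s / \<epsilon>) * flat 0 (1 + - s / \<epsilon>)" for s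
  define b' where "b' s = flat 0 (1 + s / \<epsilon>) * (- flat 2 (1 + - s / \<epsilon>) / \<epsilon>)
      + flat 2 (1 + s / \<epsilon>) / \<epsilon> * flat 0 (1 + - s / \<epsilon>)" for s
  have cont_flat: "continuous_on S (\<lambda>s::real. flat k (f s))" if "continuous_on S f" for k S f
    using DERIV_isCont[OF flat_has_derivative[of k]] that
    by (intro continuous_on_compose2[of UNIV "flat k" S f]) (auto intro: continuous_at_imp_continuous_on)
  have d0: "(flat 0 has_real_derivative flat 2 t) (at t)" for t
    using flat_has_derivative[of 0 t] by (simp add: numeral_2_eq_2)
  have "((\<lambda>s. flat 0 (1 + s / \<epsilon>)) has_real_derivative flat 2 (1 + s / \<epsilon>) * (1 / \<epsilon>)) (at s)" for s
    by (rule DERIV_chain2[OF d0]) (use assms in \<open>auto intro!: derivative_eq_intros\<close>)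
  moreover have "((\<lambda>s. flat 0 (1 + - s / \<epsilon>)) has_real_derivative
      flat 2 (1 + - s / \<epsilon>) * (- 1 / \<epsilon>)) (at s)" for s
    by (rule DERIV_chain2[OF d0]) (use assms in \<open>auto intro!: derivative_eq_intros\<close>)
  ultimately have db: "(b has_real_derivative b' s) (at s)" for s
    unfolding b_def b'_def by (rule DERIV_mult'[THEN DERIV_cong]) simp
  have cb: "continuous_on UNIV b" 
    unfolding b_def by (intro continuous_intros cont_flat) (use assms in auto)
  have cb': "continuous_on UNIV b'"
    unfolding b'_def by (intro continuous_intros cont_flat) (use assms in auto)
  have b_nonneg: "b s \<ge> 0" for s by (auto simp: b_def flat_def)
  have supp: "b s = 0 \<and> b' s = 0" if "\<bar>s\<bar> \<ge> \<epsilon>" for s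
    using that assms by (cases "s \<ge> 0") (auto simp: b_def b'_def flat_def field_simps)
  have bpos: "b s > 0" if "\<bar>s\<bar> < \<epsilon>" for s
    using that assms by (auto simp: b_def flat_def field_simps)
  have bint: "integrable lborel b"
  proof -
    have "set_integrable lborel {-\<epsilon>..\<epsilon>} b"
      using borel_integrable_compact[of "{-\<epsilon>..\<epsilon>}" b] cb continuous_on_subset
      by (auto simp: set_integrable_def indicator_def if_distrib cong: if_cong)
    moreover have "(\<lambda>x. indicator {-\<epsilon>..\<epsilon>} x *\<^sub>R b x) = b"
      using supp by (force simp: fun_eq_iff indicator_def)
    ultimately show ?thesis by (simp add: set_integrable_def)
  qed
  define c where "c = (LINT s|lborel. b s)"
  have "c \<noteq> 0"
  proof
    assume "c = 0"
    then have "AE s in lborel. b s = 0"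
      using integral_nonneg_eq_0_iff_AE[OF bint] b_nonneg by (simp add: c_def)
    then have "AE s in lborel. s \<notin> {-\<epsilon><..<\<epsilon>}"
      by eventually_elim (use bpos in \<open>force simp: abs_less_iff\<close>)
    then have "{-\<epsilon><..<\<epsilon>} \<in> null_sets lborel"
      by (subst AE_iff_null_sets) auto
    then show False using assms by (auto simp: null_sets_def)
  qed
  moreover have "c \<ge> 0"
    unfolding c_def by (rule Bochner_Integration.integral_nonneg) (rule b_nonneg)
  ultimately have c: "c > 0" by simp
  have "mollifier \<epsilon> (\<lambda>s. inverse c * b s) (\<lambda>s. inverse c * b' s)"
    unfolding mollifier_def
  proof (intro conjI allI impI)
    fix x y :: real
    have "smooth_fun (\<lambda>w::real\<times>real. inverse c * (flat 0 ((1 - x / \<epsilon>) + w \<bullet> (1 / \<epsilon>, 0))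
        * flat 0 ((1 + x / \<epsilon>) + w \<bullet> (- 1 / \<epsilon>, 0))) * (inverse c * (flat 0 ((1 - y / \<epsilon>) + w \<bullet> (0, 1 / \<epsilon>))
        * flat 0 ((1 + y / \<epsilon>) + w \<bullet> (0, - 1 / \<epsilon>)))))"
      by (intro smooth_fun.intros)
    then show "smooth_fun (\<lambda>w::real\<times>real. inverse c * b (fst w - x) * (inverse c * b (snd w - y)))"
      by (simp add: b_def inner_prod_def algebra_simps diff_divide_distrib)
  next
    show "((\<lambda>s. inverse c * b s) has_real_derivative inverse c * b' s) (at s)" for s
      by (rule DERIV_cmult[OF db])
    show "continuous_on UNIV (\<lambda>s. inverse c * b' s)" by (intro continuous_intros cb')
    show "(LINT s|lborel. inverse c * b s) = 1" using c by (simp add: c_def[symmetric])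
  qed (use c b_nonneg supp bint in auto)
  then show ?thesis by blast
qed

section \<open>Density of continuous functions\<close>

lemma cmod_diff_sq: "(cmod (a - b))\<^sup>2 \<le> 2 * (cmod a)\<^sup>2 + 2 * (cmod b)\<^sup>2"
proof -
  have "(cmod (a - b))\<^sup>2 \<le> (cmod a + cmod b)\<^sup>2"
    by (intro power_mono norm_triangle_ineq4) auto
  also have "\<dots> \<le> 2 * (cmod a)\<^sup>2 + 2 * (cmod b)\<^sup>2"
    using zero_le_power2[of "cmod a - cmod b"] by (simp add: power2_eq_square algebra_simps)
  finally show ?thesis .
qed

lemma L2_fun_measurable: "L2_fun M f \<Longrightarrow> f \<in> borel_measurable M"
  by (simp add: L2_fun_def)

lemma L2_fun_integrable: "L2_fun M f \<Longrightarrow> integrable M (\<lambda>z. (cmod (f z))\<^sup>2)"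
  by (simp add: L2_fun_def)

lemma L2_fun_diff:
  assumes "L2_fun M f" "L2_fun M g"
  shows "L2_fun M (\<lambda>z. f z - g z)"
proof -
  note [measurable] = assms[THEN L2_fun_measurable]
  have "integrable M (\<lambda>z. (cmod (f z - g z))\<^sup>2)"
    by (rule Bochner_Integration.integrable_bound[where f = "\<lambda>z. 2 * (cmod (f z))\<^sup>2 + 2 * (cmod (g z))\<^sup>2"])
       (use assms[THEN L2_fun_integrable] cmod_diff_sq in \<open>auto\<close>)
  then show ?thesis by (simp add: L2_fun_def)
qed

lemma integral_diff_sq_le:
  assumes "L2_fun M f" "L2_fun M g" "L2_fun M h"
  shows "(LINT z|M. (cmod (f z - h z))\<^sup>2) \<le> 2 * (LINT z|M. (cmod (f z - g z))\<^sup>2) + 2 * (LINT z|M. (cmod (g z - h z))\<^sup>2)"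
proof -
  note * = L2_fun_integrable[OF L2_fun_diff]
  have "(LINT z|M. (cmod (f z - h z))\<^sup>2) \<le> (LINT z|M. 2 * (cmod (f z - g z))\<^sup>2 + 2 * (cmod (g z - h z))\<^sup>2)"
  proof (rule integral_mono)
    show "(cmod (f z - h z))\<^sup>2 \<le> 2 * (cmod (f z - g z))\<^sup>2 + 2 * (cmod (g z - h z))\<^sup>2" for z
      using cmod_diff_sq[of "f z - g z" "h z - g z"] by (simp add: norm_minus_commute)
  qed (use assms in \<open>auto intro!: *\<close>)
  then show ?thesis using assms by (simp add: *)
qed

text \<open>A bounded function with bounded support is the limit almost everywhere of continuous ones, which
  are made uniformly bounded by projecting their values to a ball.\<close>
lemma L2_dense_bounded:
  fixes f :: "real \<times> real \<Rightarrow> complex"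
  assumes f: "f \<in> borel_measurable lborel" and B: "\<And>z. cmod (f z) \<le> B" and R: "\<And>z. R < norm z \<Longrightarrow> f z = 0"
    and e: "e > 0"
  shows "\<exists>g. continuous_on UNIV g \<and> (\<forall>z. R + 1 < norm z \<longrightarrow> g z = 0) \<and> L2_fun lborel g \<and>
     (LINT z|lborel. (cmod (f z - g z))\<^sup>2) < e"
proof -
  note [measurable] = f
  have "f \<in> borel_measurable (lebesgue_on UNIV)" using measurable_completion[OF f] by simp
  then have "f measurable_on UNIV"
    by (subst measurable_on_iff_borel_measurable) auto
  then obtain N g where N: "negligible N" and g: "\<And>n. continuous_on UNIV (g n)"
    and lim: "\<And>z. z \<notin> N \<Longrightarrow> (\<lambda>n. g n z) \<longlonglongrightarrow> f z"
    unfolding measurable_on_def by auto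
  have B0: "B \<ge> 0" using B[of 0] norm_ge_zero order_trans by blast
  define P where "P = closest_point (cball (0::complex) B)"
  have contP: "continuous_on S P" for S
    unfolding P_def using B0 by (intro continuous_on_closest_point) auto
  have P: "P w = w" if "cmod w \<le> B" for w
    unfolding P_def using that by (intro closest_point_self) auto
  have Pn: "cmod (P w) \<le> B" for w
    using closest_point_in_set[of "cball (0::complex) B" w] B0 by (auto simp: P_def)
  define cut where "cut z = max 0 (min 1 (R + 1 - norm z))" for z :: "real \<times> real"
  define h where "h n z = cut z *\<^sub>R P (g n z)" for n z
  have conth: "continuous_on UNIV (h n)" for n
    unfolding h_def cut_def
    by (intro continuous_intros continuous_on_compose2[OF contP g]) auto
  have cut: "0 \<le> cut z" "cut z \<le> 1" for z by (auto simp: cut_def)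
  have supp: "h n z = 0" if "R + 1 < norm z" for n z
    using that by (auto simp: h_def cut_def)
  have hB: "cmod (h n z) \<le> B" for n z
    unfolding h_def using cut[of z] Pn[of "g n z"] B0 by (simp add: order_trans[OF mult_left_le_one_le])
  have bnd: "(cmod (f z - h n z))\<^sup>2 \<le> indicator (cball 0 (R + 1)) z * (2 * B)\<^sup>2" for z n
  proof (cases "norm z \<le> R + 1")
    case True
    have "cmod (f z - h n z) \<le> 2 * B"
      using norm_triangle_ineq4[of "f z" "h n z"] B[of z] hB[of n z] by linarith
    then have "(cmod (f z - h n z))\<^sup>2 \<le> (2 * B)\<^sup>2" by (intro power_mono) auto
    then show ?thesis using True by simp
  next
    case False
    then show ?thesis using supp R[of z] by auto
  qed
  have dom: "integrable lborel (\<lambda>z::real\<times>real. indicator (cball 0 (R + 1)) z * (2 * B)\<^sup>2 :: real)"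
    using emeasure_bounded_finite[of "cball (0::real\<times>real) (R + 1)"] by (intro integrable_mult_left) (auto simp: integrable_indicator_iff)
  have [measurable]: "h n \<in> borel_measurable borel" for n
    using conth borel_measurable_continuous_onI by blast
  have "(\<lambda>n. LINT z|lborel. (cmod (f z - h n z))\<^sup>2) \<longlonglongrightarrow> (LINT z|(lborel :: (real\<times>real) measure). 0 :: real)"
  proof (rule integral_dominated_convergence[where w = "\<lambda>z. indicator (cball 0 (R + 1)) z * (2 * B)\<^sup>2"])
    have "AE z in lebesgue. z \<notin> N" using N negligible_iff_null_sets AE_not_in by blast
    then have "AE z in lborel. z \<notin> N" by (simp add: AE_completion_iff)
    then show "AE z in lborel. (\<lambda>n. (cmod (f z - h n z))\<^sup>2) \<longlonglongrightarrow> 0"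
    proof eventually_elim
      case (elim z)
      have "(\<lambda>n. P (g n z)) \<longlonglongrightarrow> P (f z)"
        by (rule continuous_on_tendsto_compose[OF contP[of UNIV] lim[OF elim]]) auto
      then have "(\<lambda>n. h n z) \<longlonglongrightarrow> cut z *\<^sub>R P (f z)" unfolding h_def by (intro tendsto_intros)
      also have "cut z *\<^sub>R P (f z) = f z"
        using P[OF B] P[of 0] B0 R[of z] by (cases "norm z \<le> R") (auto simp: cut_def)
      finally have "(\<lambda>n. (cmod (f z - h n z))\<^sup>2) \<longlonglongrightarrow> (cmod (f z - f z))\<^sup>2"
        by (intro tendsto_intros)
      then show ?case by simp
    qed
  qed (use bnd dom in auto)
  then have "\<forall>\<^sub>F n in sequentially. (LINT z|lborel. (cmod (f z - h n z))\<^sup>2) < e"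
    using e by (intro order_tendstoD) auto
  then obtain n where n: "(LINT z|lborel. (cmod (f z - h n z))\<^sup>2) < e"
    by (auto simp: eventually_sequentially)
  have "L2_fun lborel (h n)"
    unfolding L2_fun_def
  proof
    show "integrable lborel (\<lambda>z. (cmod (h n z))\<^sup>2)"
    proof (rule Bochner_Integration.integrable_bound[OF dom])
      show "AE z in lborel. norm ((cmod (h n z))\<^sup>2) \<le> norm (indicator (cball 0 (R + 1)) z * (2 * B)\<^sup>2 :: real)"
      proof (rule AE_I2)
        fix z :: "real \<times> real"
        show "norm ((cmod (h n z))\<^sup>2) \<le> norm (indicator (cball 0 (R + 1)) z * (2 * B)\<^sup>2 :: real)"
        proof (cases "norm z \<le> R + 1")
          case True
          have "(cmod (h n z))\<^sup>2 \<le> (2 * B)\<^sup>2" using hB[of n z] B0 by (intro power_mono norm_ge_zero) linarith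
          then show ?thesis using True by simp
        qed (use supp in simp)
      qed
    qed auto
  qed simp
  then show ?thesis using n conth supp by blast
qed

text \<open>Truncation in value and in position converges by dominated convergence and leads to
  \<open>L2_dense_bounded\<close>. The factors 2 in \<open>integral_diff_sq_le\<close> turn two
  errors of \<open>e / 4\<close> into \<open>e\<close>.\<close>

lemma L2_dense:
  fixes f :: "real \<times> real \<Rightarrow> complex"
  assumes f: "L2_fun lborel f" and e: "e > 0"
  shows "\<exists>g R. continuous_on UNIV g \<and> (\<forall>z. R < norm z \<longrightarrow> g z = 0) \<and> L2_fun lborel g \<and>
     (LINT z|lborel. (cmod (f z - g z))\<^sup>2) < e"
proof -
  note [measurable] = L2_fun_measurable[OF f]
  define F where "F n z = (if norm z \<le> real n \<and> cmod (f z) \<le> real n then f z else 0)" for n z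
  have Fm [measurable]: "F n \<in> borel_measurable lborel" for n
    unfolding F_def by measurable
  have le: "cmod (f z - F n z) \<le> cmod (f z)" "cmod (F n z) \<le> cmod (f z)" for n z by (auto simp: F_def)
  have FL2: "L2_fun lborel (F n)" for n
    unfolding L2_fun_def
  proof
    show "integrable lborel (\<lambda>z. (cmod (F n z))\<^sup>2)"
      by (rule Bochner_Integration.integrable_bound[OF L2_fun_integrable[OF f]])
         (use le in \<open>auto intro!: power_mono\<close>)
  qed measurable
  have "(\<lambda>n. LINT z|lborel. (cmod (f z - F n z))\<^sup>2) \<longlonglongrightarrow> (LINT z|(lborel :: (real\<times>real) measure). 0 :: real)"
  proof (rule integral_dominated_convergence[where w = "\<lambda>z. (cmod (f z))\<^sup>2"])
    show "AE z in lborel. (\<lambda>n. (cmod (f z - F n z))\<^sup>2) \<longlonglongrightarrow> 0"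
    proof (rule AE_I2, rule tendsto_eventually)
      fix z
      obtain n0 where "max (norm z) (cmod (f z)) \<le> real n0"
        using real_arch_simple by blast
      then show "\<forall>\<^sub>F n in sequentially. (cmod (f z - F n z))\<^sup>2 = 0"
        by (intro eventually_sequentiallyI[of n0]) (auto simp: F_def)
    qed
    show "AE z in lborel. norm ((cmod (f z - F n z))\<^sup>2) \<le> (cmod (f z))\<^sup>2" for n
      using le by (auto intro!: power_mono)
  qed (use L2_fun_integrable[OF f] in auto)
  then have "\<forall>\<^sub>F n in sequentially. (LINT z|lborel. (cmod (f z - F n z))\<^sup>2) < e / 4"
    using e by (intro order_tendstoD) auto
  then obtain n where n: "(LINT z|lborel. (cmod (f z - F n z))\<^sup>2) < e / 4"
    by (auto simp: eventually_sequentially)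
  have "\<exists>g. continuous_on UNIV g \<and> (\<forall>z. real n + 1 < norm z \<longrightarrow> g z = 0) \<and> L2_fun lborel g \<and>
     (LINT z|lborel. (cmod (F n z - g z))\<^sup>2) < e / 4"
    by (rule L2_dense_bounded[OF Fm, where B = "real n"]) (use e in \<open>auto simp: F_def\<close>)
  then obtain g where g: "continuous_on UNIV g" "\<forall>z. real n + 1 < norm z \<longrightarrow> g z = 0" "L2_fun lborel g"
     "(LINT z|lborel. (cmod (F n z - g z))\<^sup>2) < e / 4" by blast
  have "(LINT z|lborel. (cmod (f z - g z))\<^sup>2) < e"
    using integral_diff_sq_le[OF f FL2[of n] g(3)] n g(4) by linarith
  then show ?thesis using g by blast
qed

section \<open>Differentiation under the integral sign\<close>

lemma has_vector_derivative_iff_quotient: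
  fixes f :: "real \<Rightarrow> 'b::real_normed_vector"
  shows "(f has_vector_derivative D) (at x) \<longleftrightarrow> ((\<lambda>t. (f t - f x) /\<^sub>R (t - x)) \<longlongrightarrow> D) (at x)"
proof -
  have "norm ((f t - f x) /\<^sub>R (t - x) - D) = norm (f t - f x - (t - x) *\<^sub>R D) / norm (t - x)" if "t \<noteq> x" for t
  proof -
    have "(f t - f x) /\<^sub>R (t - x) - D = (f t - f x - (t - x) *\<^sub>R D) /\<^sub>R (t - x)"
      using that by (simp add: scaleR_diff_right)
    then show ?thesis by (simp add: divide_inverse mult.commute)
  qed
  then have "((\<lambda>t. norm ((f t - f x) /\<^sub>R (t - x) - D)) \<longlongrightarrow> 0) (at x) \<longleftrightarrow>
      ((\<lambda>t. norm (f t - f x - (t - x) *\<^sub>R D) / norm (t - x)) \<longlongrightarrow> 0) (at x)"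
    by (intro filterlim_cong) (auto simp: eventually_at_filter)
  then show ?thesis
    unfolding has_vector_derivative_def has_derivative_iff_norm
    by (simp add: bounded_linear_scaleR_left tendsto_norm_zero_iff LIM_zero_iff)
qed

text \<open>By the mean value inequality \<open>G\<close> dominates the difference quotients at
  points within distance 1 of \<open>t0\<close>, and dominated convergence applies along every
  sequence tending to \<open>t0\<close>. A bound near \<open>t0\<close> suits kernels whose support
  moves with \<open>t\<close>.\<close>

lemma has_vector_derivative_lebesgue_integral:
  fixes F :: "real \<Rightarrow> 'a \<Rightarrow> complex"
  assumes int: "\<And>t. integrable M (F t)"
    and der: "\<And>t w. ((\<lambda>t. F t w) has_vector_derivative F' t w) (at t)"
    and meas: "F' t0 \<in> borel_measurable M"
    and bound: "\<And>t w. \<bar>t - t0\<bar> \<le> 1 \<Longrightarrow> cmod (F' t w) \<le> G w" and G: "integrable M G"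
  shows "((\<lambda>t. LINT w|M. F t w) has_vector_derivative (LINT w|M. F' t0 w)) (at t0)"
proof -
  have Lip: "cmod ((F t w - F t0 w) /\<^sub>R (t - t0)) \<le> G w" if t: "\<bar>t - t0\<bar> \<le> 1" "t \<noteq> t0" for t w
  proof -
    have "cmod (F t w - F t0 w) \<le> G w * norm (t - t0)"
    proof (rule differentiable_bound[of "cball t0 1" "\<lambda>t. F t w" "\<lambda>t h. h *\<^sub>R F' t w"])
      show "((\<lambda>t. F t w) has_derivative (\<lambda>h. h *\<^sub>R F' x w)) (at x within cball t0 1)" for x
        using der[of w x] by (auto simp: has_vector_derivative_def intro: has_derivative_at_withinI)
      show "onorm (\<lambda>h. h *\<^sub>R F' x w) \<le> G w" if "x \<in> cball t0 1" for x
        using bound[of x w] that by (intro onorm_le) (auto simp: dist_real_def abs_minus_commute mult.commute[of _ "cmod _"] intro!: mult_right_mono)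
    qed (use t in \<open>auto simp: dist_real_def\<close>)
    then show ?thesis using t unfolding norm_scaleR by (simp add: field_simps)
  qed
  have "((\<lambda>t. ((LINT w|M. F t w) - (LINT w|M. F t0 w)) /\<^sub>R (t - t0)) \<longlongrightarrow> (LINT w|M. F' t0 w)) (at t0)"
    unfolding tendsto_at_iff_sequentially comp_def
  proof (intro allI impI)
    fix X :: "nat \<Rightarrow> real" assume X: "\<forall>i. X i \<in> UNIV - {t0}" "X \<longlonglongrightarrow> t0"
    have "\<forall>\<^sub>F i in sequentially. dist (X i) t0 < 1" using X(2) by (rule tendstoD) simp
    then obtain K where K: "\<And>i. i \<ge> K \<Longrightarrow> \<bar>X i - t0\<bar> \<le> 1"
      by (force simp: eventually_sequentially dist_real_def)
    have "(\<lambda>i. LINT w|M. (F (X (i + K)) w - F t0 w) /\<^sub>R (X (i + K) - t0)) \<longlonglongrightarrow> (LINT w|M. F' t0 w)"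
    proof (rule integral_dominated_convergence[OF meas _ G])
      show "(\<lambda>w. (F (X (i + K)) w - F t0 w) /\<^sub>R (X (i + K) - t0)) \<in> borel_measurable M" for i
        using int[THEN borel_measurable_integrable] by measurable
      show "AE w in M. cmod ((F (X (i + K)) w - F t0 w) /\<^sub>R (X (i + K) - t0)) \<le> G w" for i
        using X Lip[OF K[of "i + K"]] by (intro AE_I2) auto
      show "AE w in M. (\<lambda>i. (F (X (i + K)) w - F t0 w) /\<^sub>R (X (i + K) - t0)) \<longlonglongrightarrow> F' t0 w"
      proof (rule AE_I2)
        fix w
        have "((\<lambda>t. (F t w - F t0 w) /\<^sub>R (t - t0)) \<longlongrightarrow> F' t0 w) (at t0)"
          using der[of w t0] by (simp only: has_vector_derivative_iff_quotient)
        then have "(\<lambda>i. (F (X i) w - F t0 w) /\<^sub>R (X i - t0)) \<longlonglongrightarrow> F' t0 w"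
          using X unfolding tendsto_at_iff_sequentially comp_def by blast
        then show "(\<lambda>i. (F (X (i + K)) w - F t0 w) /\<^sub>R (X (i + K) - t0)) \<longlonglongrightarrow> F' t0 w"
          by (rule LIMSEQ_ignore_initial_segment)
      qed
    qed
    then have "(\<lambda>i. ((LINT w|M. F (X (i + K)) w) - (LINT w|M. F t0 w)) /\<^sub>R (X (i + K) - t0)) \<longlonglongrightarrow> (LINT w|M. F' t0 w)"
      by (simp add: int)
    then show "(\<lambda>i. ((LINT w|M. F (X i) w) - (LINT w|M. F t0 w)) /\<^sub>R (X i - t0)) \<longlonglongrightarrow> (LINT w|M. F' t0 w)"
      by (rule LIMSEQ_offset)
  qed
  then show ?thesis
    by (simp only: has_vector_derivative_iff_quotient)
qed

section \<open>Mollification on the strip\<close>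

text \<open>Covers a mollifier and its derivative alike: differentiating a convolution gives a
  convolution with the differentiated kernel.\<close>

definition kern :: "real \<Rightarrow> (real \<Rightarrow> real) \<Rightarrow> bool" where
  "kern r \<alpha> \<longleftrightarrow> continuous_on UNIV \<alpha> \<and> (\<forall>s. \<bar>s\<bar> \<ge> r \<longrightarrow> \<alpha> s = 0)"

text \<open>The kernel is evaluated at \<open>w - z\<close>, so that as a function of
  \<open>w\<close> it is a translate of the mollifier. Differentiation in \<open>z\<close> then
  produces a minus sign, which cancels the one in the definition of the weak derivative.\<close>

definition conv :: "(real \<Rightarrow> real) \<Rightarrow> (real \<Rightarrow> real) \<Rightarrow> (real \<times> real \<Rightarrow> complex) \<Rightarrow> real \<times> real \<Rightarrow> complex" where
  "conv \<alpha> \<beta> f z = (LINT w|lborel. (\<alpha> (fst w - fst z) * \<beta> (snd w - snd z)) *\<^sub>R f w)"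

lemma kern_measurable: "kern r \<alpha> \<Longrightarrow> \<alpha> \<in> borel_measurable borel"
  by (simp add: kern_def borel_measurable_continuous_onI)

lemma kern_bounded: "kern r \<alpha> \<Longrightarrow> \<exists>B\<ge>0. \<forall>s. \<bar>\<alpha> s\<bar> \<le> B"
proof -
  assume k: "kern r \<alpha>"
  have "compact (\<alpha> ` {-r..r})"
    using k by (intro compact_continuous_image) (auto simp: kern_def intro: continuous_on_subset)
  then obtain B where B: "\<And>s. s \<in> {-r..r} \<Longrightarrow> \<bar>\<alpha> s\<bar> \<le> B"
    using compact_imp_bounded bounded_iff by (metis image_eqI real_norm_def)
  have "\<bar>\<alpha> s\<bar> \<le> max 0 B" for s
  proof (cases "\<bar>s\<bar> \<ge> r")
    case True then show ?thesis using k by (simp add: kern_def)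
  next
    case False then show ?thesis using B[of s] by (fastforce simp: abs_le_iff)
  qed
  then show ?thesis by (intro exI[of _ "max 0 B"]) auto
qed

lemma L2_fun_integrable_box:
  assumes "L2_fun lborel f"
  shows "integrable lborel (\<lambda>w. indicator (cbox a b) w * cmod (f w))"
proof (rule Bochner_Integration.integrable_bound)
  note [measurable] = L2_fun_measurable[OF assms]
  show "integrable lborel (\<lambda>w. indicator (cbox a b) w + (cmod (f w))\<^sup>2)"
    using L2_fun_integrable[OF assms] emeasure_bounded_finite[of "cbox a b"]
    by (intro Bochner_Integration.integrable_add) (auto simp: integrable_indicator_iff)
  have "t \<le> 1 + t\<^sup>2" for t :: real
    using zero_le_power2[of "t - 1/2"] by (simp add: power2_eq_square algebra_simps)
  then show "AE w in lborel. norm (indicator (cbox a b) w * cmod (f w)) \<le> norm (indicator (cbox a b) w + (cmod (f w))\<^sup>2)"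
    by (intro AE_I2) (auto simp: indicator_def)
qed (use L2_fun_measurable[OF assms] in measurable)

text \<open>The box is enlarged by 1 so that a single integrable majorant serves all centres near
  \<open>(x0, y0)\<close>, as continuity and differentiation of \<open>conv\<close> require.\<close>

lemma kern_scaleR_bound:
  assumes "kern r \<alpha>" "kern r \<beta>" "\<And>s. \<bar>\<alpha> s\<bar> \<le> A" "\<And>s. \<bar>\<beta> s\<bar> \<le> B" "A \<ge> 0" "\<bar>x - x0\<bar> \<le> 1" "\<bar>y - y0\<bar> \<le> 1"
  shows "cmod ((\<alpha> (fst w - x) * \<beta> (snd w - y)) *\<^sub>R c)
     \<le> A * B * (indicator (cbox (x0 - 1 - r, y0 - 1 - r) (x0 + 1 + r, y0 + 1 + r)) w * cmod c)"
proof (cases "\<bar>fst w - x\<bar> \<ge> r \<or> \<bar>snd w - y\<bar> \<ge> r")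
  case True
  have "B \<ge> 0" using assms(4)[of 0] by simp
  then have "0 \<le> A * B * (indicator (cbox (x0 - 1 - r, y0 - 1 - r) (x0 + 1 + r, y0 + 1 + r)) w * cmod c)"
    using assms(5) by (intro mult_nonneg_nonneg) auto
  moreover have "\<alpha> (fst w - x) * \<beta> (snd w - y) = 0" using True assms(1,2) by (auto simp: kern_def)
  ultimately show ?thesis by (simp only: scaleR_zero_left norm_zero)
next
  case False
  then have "w \<in> cbox (x0 - 1 - r, y0 - 1 - r) (x0 + 1 + r, y0 + 1 + r)"
    using assms(6,7) by (cases w) (auto simp: cbox_Pair_eq abs_le_iff)
  moreover have "\<bar>\<alpha> (fst w - x) * \<beta> (snd w - y)\<bar> \<le> A * B"
    unfolding abs_mult using assms(3,4,5) by (intro mult_mono) auto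
  ultimately show ?thesis by (simp add: mult_right_mono)
qed

lemma kern_scaleR_measurable:
  fixes f :: "real \<times> real \<Rightarrow> complex"
  assumes "kern r \<alpha>" "kern r \<beta>" "L2_fun lborel f"
  shows "(\<lambda>w. (\<alpha> (fst w - x) * \<beta> (snd w - y)) *\<^sub>R f w) \<in> borel_measurable lborel"
proof -
  have c: "continuous_on UNIV \<alpha>" "continuous_on UNIV \<beta>" using assms(1,2) by (auto simp: kern_def)
  have "continuous_on UNIV (\<lambda>w::real\<times>real. \<alpha> (fst w - x) * \<beta> (snd w - y))"
    by (intro continuous_on_mult continuous_on_compose2[OF c(1)] continuous_on_compose2[OF c(2)]
        continuous_on_diff continuous_on_fst continuous_on_snd continuous_on_id continuous_on_const) auto
  then have [measurable]: "(\<lambda>w::real\<times>real. \<alpha> (fst w - x) * \<beta> (snd w - y)) \<in> borel_measurable borel"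
    by (rule borel_measurable_continuous_onI)
  note [measurable] = L2_fun_measurable[OF assms(3)]
  show ?thesis by measurable
qed

lemma conv_integrable:
  assumes "kern r \<alpha>" "kern r \<beta>" "L2_fun lborel f"
  shows "integrable lborel (\<lambda>w. (\<alpha> (fst w - x) * \<beta> (snd w - y)) *\<^sub>R f w)"
proof -
  obtain A B where AB: "A \<ge> 0" "\<And>s. \<bar>\<alpha> s\<bar> \<le> A" "\<And>s. \<bar>\<beta> s\<bar> \<le> B"
    using kern_bounded[OF assms(1)] kern_bounded[OF assms(2)] by blast
  note meas = kern_scaleR_measurable[OF assms(1,2,3)]
  note bnd = kern_scaleR_bound[OF assms(1,2) AB(2,3,1), of x x y y]
  show ?thesis
  proof (rule Bochner_Integration.integrable_bound)
    show "integrable lborel (\<lambda>w. A * B * (indicator (cbox (x - 1 - r, y - 1 - r) (x + 1 + r, y + 1 + r)) w * cmod (f w)))"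
      by (intro integrable_mult_right L2_fun_integrable_box assms)
    show "AE w in lborel. norm ((\<alpha> (fst w - x) * \<beta> (snd w - y)) *\<^sub>R f w)
        \<le> norm (A * B * (indicator (cbox (x - 1 - r, y - 1 - r) (x + 1 + r, y + 1 + r)) w * cmod (f w)))"
      by (intro AE_I2 order_trans[OF bnd]) auto
  qed (use meas in auto)
qed

lemma conv_continuous:
  assumes "kern r \<alpha>" "kern r \<beta>" "L2_fun lborel f"
  shows "continuous_on UNIV (conv \<alpha> \<beta> f)"
proof -
  obtain A B where AB: "A \<ge> 0" "\<And>s. \<bar>\<alpha> s\<bar> \<le> A" "\<And>s. \<bar>\<beta> s\<bar> \<le> B"
    using kern_bounded[OF assms(1)] kern_bounded[OF assms(2)] by blast
  note meas = kern_scaleR_measurable[OF assms(1,2,3)]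
  show ?thesis
    unfolding continuous_on_sequentially comp_def
  proof (intro allI ballI impI, elim conjE)
    fix X :: "nat \<Rightarrow> real \<times> real" and z assume X: "X \<longlonglongrightarrow> z"
    have "\<forall>\<^sub>F i in sequentially. dist (X i) z < 1" using X by (rule tendstoD) simp
    then obtain K where K: "\<And>i. i \<ge> K \<Longrightarrow> dist (X i) z < 1" by (auto simp: eventually_sequentially)
    have K1: "\<bar>fst (X (i + K)) - fst z\<bar> \<le> 1" "\<bar>snd (X (i + K)) - snd z\<bar> \<le> 1" for i
      using K[of "i + K"] dist_fst_le[of "X (i + K)" z] dist_snd_le[of "X (i + K)" z]
      by (auto simp: dist_real_def)
    have "(\<lambda>i. conv \<alpha> \<beta> f (X (i + K))) \<longlonglongrightarrow> conv \<alpha> \<beta> f z"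
      unfolding conv_def
    proof (rule integral_dominated_convergence)
      show "integrable lborel (\<lambda>w. A * B * (indicator (cbox (fst z - 1 - r, snd z - 1 - r) (fst z + 1 + r, snd z + 1 + r)) w * cmod (f w)))"
        by (intro integrable_mult_right L2_fun_integrable_box assms)
      show "AE w in lborel. cmod ((\<alpha> (fst w - fst (X (i + K))) * \<beta> (snd w - snd (X (i + K)))) *\<^sub>R f w)
          \<le> A * B * (indicator (cbox (fst z - 1 - r, snd z - 1 - r) (fst z + 1 + r, snd z + 1 + r)) w * cmod (f w))" for i
        by (intro AE_I2 kern_scaleR_bound assms AB K1)
      have X': "(\<lambda>i. X (i + K)) \<longlonglongrightarrow> z" using X by (rule LIMSEQ_ignore_initial_segment)
      have c: "continuous_on UNIV \<alpha>" "continuous_on UNIV \<beta>" using assms by (auto simp: kern_def)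
      show "AE w in lborel. (\<lambda>i. (\<alpha> (fst w - fst (X (i + K))) * \<beta> (snd w - snd (X (i + K)))) *\<^sub>R f w)
          \<longlonglongrightarrow> (\<alpha> (fst w - fst z) * \<beta> (snd w - snd z)) *\<^sub>R f w"
        by (intro AE_I2 tendsto_scaleR tendsto_mult tendsto_const continuous_on_tendsto_compose[OF c(1)]
             continuous_on_tendsto_compose[OF c(2)] tendsto_diff tendsto_fst tendsto_snd X') auto
    qed (use meas in auto)
    then show "(\<lambda>i. conv \<alpha> \<beta> f (X i)) \<longlonglongrightarrow> conv \<alpha> \<beta> f z" by (rule LIMSEQ_offset)
  qed
qed

lemma conv_derivative_fst:
  assumes "kern r \<alpha>" "kern r \<beta>" "kern r \<alpha>'" "\<And>s. (\<alpha> has_real_derivative \<alpha>' s) (at s)" "L2_fun lborel f"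
  shows "((\<lambda>x. conv \<alpha> \<beta> f (x, y)) has_vector_derivative - conv \<alpha>' \<beta> f (x, y)) (at x)"
proof -
  obtain A B where AB: "A \<ge> 0" "\<And>s. \<bar>\<alpha>' s\<bar> \<le> A" "\<And>s. \<bar>\<beta> s\<bar> \<le> B"
    using kern_bounded[OF assms(3)] kern_bounded[OF assms(2)] by blast
  note meas = kern_scaleR_measurable[OF assms(3,2,5)]
  have "((\<lambda>t. LINT w|lborel. (\<alpha> (fst w - t) * \<beta> (snd w - y)) *\<^sub>R f w) has_vector_derivative
      (LINT w|lborel. - ((\<alpha>' (fst w - x) * \<beta> (snd w - y)) *\<^sub>R f w))) (at x)"
  proof (rule has_vector_derivative_lebesgue_integral)
    show "integrable lborel (\<lambda>w. (\<alpha> (fst w - t) * \<beta> (snd w - y)) *\<^sub>R f w)" for t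
      by (intro conv_integrable[OF assms(1,2)] assms)
    show "integrable lborel (\<lambda>w. A * B * (indicator (cbox (x - 1 - r, y - 1 - r) (x + 1 + r, y + 1 + r)) w * cmod (f w)))"
      by (intro integrable_mult_right L2_fun_integrable_box assms)
    show "cmod (- ((\<alpha>' (fst w - t) * \<beta> (snd w - y)) *\<^sub>R f w))
          \<le> A * B * (indicator (cbox (x - 1 - r, y - 1 - r) (x + 1 + r, y + 1 + r)) w * cmod (f w))"
      if "\<bar>t - x\<bar> \<le> 1" for t w
      unfolding norm_minus_cancel using that by (intro kern_scaleR_bound[OF assms(3,2)] AB) auto
    fix t and w :: "real \<times> real"
    have "((\<lambda>t. \<alpha> (fst w - t)) has_real_derivative \<alpha>' (fst w - t) * (0 - 1)) (at t)"
      by (rule DERIV_chain2[OF assms(4) DERIV_diff[OF DERIV_const DERIV_ident]])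
    then have "((\<lambda>t. \<alpha> (fst w - t) * \<beta> (snd w - y)) has_real_derivative - (\<alpha>' (fst w - t) * \<beta> (snd w - y))) (at t)"
      by (auto intro!: derivative_eq_intros)
    then show "((\<lambda>t. (\<alpha> (fst w - t) * \<beta> (snd w - y)) *\<^sub>R f w) has_vector_derivative
        - ((\<alpha>' (fst w - t) * \<beta> (snd w - y)) *\<^sub>R f w)) (at t)"
      using has_vector_derivative_scaleR[OF _ has_vector_derivative_const] by fastforce
  qed (use meas in auto)
  then show ?thesis by (simp add: conv_def)
qed

lemma conv_derivative_snd:
  assumes "kern r \<alpha>" "kern r \<beta>" "kern r \<beta>'" "\<And>s. (\<beta> has_real_derivative \<beta>' s) (at s)" "L2_fun lborel f"
  shows "((\<lambda>y. conv \<alpha> \<beta> f (x, y)) has_vector_derivative - conv \<alpha> \<beta>' f (x, y)) (at y)"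
proof -
  obtain A B where AB: "A \<ge> 0" "\<And>s. \<bar>\<alpha> s\<bar> \<le> A" "\<And>s. \<bar>\<beta>' s\<bar> \<le> B"
    using kern_bounded[OF assms(3)] kern_bounded[OF assms(1)] by blast
  note meas = kern_scaleR_measurable[OF assms(1,3,5)]
  have "((\<lambda>t. LINT w|lborel. (\<alpha> (fst w - x) * \<beta> (snd w - t)) *\<^sub>R f w) has_vector_derivative
      (LINT w|lborel. - ((\<alpha> (fst w - x) * \<beta>' (snd w - y)) *\<^sub>R f w))) (at y)"
  proof (rule has_vector_derivative_lebesgue_integral)
    show "integrable lborel (\<lambda>w. (\<alpha> (fst w - x) * \<beta> (snd w - t)) *\<^sub>R f w)" for t
      by (intro conv_integrable[OF assms(1,2)] assms)
    show "integrable lborel (\<lambda>w. A * B * (indicator (cbox (x - 1 - r, y - 1 - r) (x + 1 + r, y + 1 + r)) w * cmod (f w)))"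
      by (intro integrable_mult_right L2_fun_integrable_box assms)
    show "cmod (- ((\<alpha> (fst w - x) * \<beta>' (snd w - t)) *\<^sub>R f w))
          \<le> A * B * (indicator (cbox (x - 1 - r, y - 1 - r) (x + 1 + r, y + 1 + r)) w * cmod (f w))"
      if "\<bar>t - y\<bar> \<le> 1" for t w
      unfolding norm_minus_cancel using that by (intro kern_scaleR_bound[OF assms(1,3)] AB) auto
    fix t and w :: "real \<times> real"
    have "((\<lambda>t. \<beta> (snd w - t)) has_real_derivative \<beta>' (snd w - t) * (0 - 1)) (at t)"
      by (rule DERIV_chain2[OF assms(4) DERIV_diff[OF DERIV_const DERIV_ident]])
    then have "((\<lambda>t. \<alpha> (fst w - x) * \<beta> (snd w - t)) has_real_derivative - (\<alpha> (fst w - x) * \<beta>' (snd w - t))) (at t)"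
      by (auto intro!: derivative_eq_intros)
    then show "((\<lambda>t. (\<alpha> (fst w - x) * \<beta> (snd w - t)) *\<^sub>R f w) has_vector_derivative
        - ((\<alpha> (fst w - x) * \<beta>' (snd w - t)) *\<^sub>R f w)) (at t)"
      using has_vector_derivative_scaleR[OF _ has_vector_derivative_const] by fastforce
  qed (use meas in auto)
  then show ?thesis by (simp add: conv_def)
qed

lemma mollifier_kern: "mollifier \<epsilon> \<rho> \<rho>' \<Longrightarrow> kern \<epsilon> \<rho>" "mollifier \<epsilon> \<rho> \<rho>' \<Longrightarrow> kern \<epsilon> \<rho>'"
  unfolding mollifier_def kern_def
  by (auto intro!: continuous_at_imp_continuous_on dest: DERIV_isCont)

text \<open>The case \<open>c = 1\<close> is the normalization. Negative \<open>c\<close> occur when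
  the kernel is integrated over the point of evaluation instead, where \<open>shrink\<close>
  contributes its slope.\<close>

lemma mollifier_nn_integral:
  assumes "mollifier \<epsilon> \<rho> \<rho>'" "c \<noteq> 0"
  shows "(\<integral>\<^sup>+s. ennreal (\<rho> (t + c * s)) \<partial>lborel) = ennreal (1 / \<bar>c\<bar>)"
proof -
  have [measurable]: "\<rho> \<in> borel_measurable borel"
    using mollifier_kern(1)[OF assms(1)] by (rule kern_measurable)
  have "1 = (\<integral>\<^sup>+s. ennreal (\<rho> s) \<partial>lborel)"
    using assms(1) by (subst nn_integral_eq_integral) (auto simp: mollifier_def)
  also have "\<dots> = ennreal \<bar>c\<bar> * (\<integral>\<^sup>+s. ennreal (\<rho> (t + c * s)) \<partial>lborel)"
    by (rule nn_integral_real_affine) (use assms in auto)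
  finally have "ennreal (1 / \<bar>c\<bar>) * 1 = ennreal (1 / \<bar>c\<bar>) * (ennreal \<bar>c\<bar> * (\<integral>\<^sup>+s. ennreal (\<rho> (t + c * s)) \<partial>lborel))"
    by simp
  then show ?thesis
    using assms(2) by (simp add: mult.assoc[symmetric] ennreal_mult'[symmetric])
qed

lemma nn_integral_lborel_times:
  fixes f g :: "real \<Rightarrow> ennreal"
  assumes [measurable]: "f \<in> borel_measurable borel" "g \<in> borel_measurable borel"
  shows "(\<integral>\<^sup>+w. f (fst w) * g (snd w) \<partial>lborel) = (\<integral>\<^sup>+s. f s \<partial>lborel) * (\<integral>\<^sup>+s. g s \<partial>lborel)"
proof -
  have "(\<integral>\<^sup>+w. f (fst w) * g (snd w) \<partial>lborel) = (\<integral>\<^sup>+s. \<integral>\<^sup>+t. f s * g t \<partial>lborel \<partial>lborel)"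
    by (subst lborel_prod[symmetric], subst lborel.nn_integral_fst[symmetric]) auto
  then show ?thesis by (simp add: nn_integral_cmult nn_integral_multc)
qed

lemma mollifier_weight:
  assumes "mollifier \<epsilon> \<rho> \<rho>'"
  shows "integrable lborel (\<lambda>w. \<rho> (fst w - x) * \<rho> (snd w - y))" "(LINT w|lborel. \<rho> (fst w - x) * \<rho> (snd w - y)) = 1"
proof -
  have [measurable]: "\<rho> \<in> borel_measurable borel"
    using mollifier_kern(1)[OF assms(1)] by (rule kern_measurable)
  have nn: "\<rho> s \<ge> 0" for s using assms by (auto simp: mollifier_def)
  have "(\<lambda>w::real\<times>real. \<rho> (fst w - x) * \<rho> (snd w - y)) \<in> borel_measurable (lborel \<Otimes>\<^sub>M lborel)" by measurable
  then have m: "(\<lambda>w::real\<times>real. \<rho> (fst w - x) * \<rho> (snd w - y)) \<in> borel_measurable lborel" unfolding lborel_prod .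
  have "(\<integral>\<^sup>+w. ennreal (\<rho> (fst w - x) * \<rho> (snd w - y)) \<partial>lborel)
      = (\<integral>\<^sup>+w. ennreal (\<rho> (fst w - x)) * ennreal (\<rho> (snd w - y)) \<partial>lborel)"
    using nn by (simp add: ennreal_mult)
  also have "\<dots> = (\<integral>\<^sup>+s. ennreal (\<rho> (s - x)) \<partial>lborel) * (\<integral>\<^sup>+s. ennreal (\<rho> (s - y)) \<partial>lborel)"
    by (rule nn_integral_lborel_times) auto
  also have "\<dots> = ennreal 1"
    using mollifier_nn_integral[OF assms, of 1 "- x"] mollifier_nn_integral[OF assms, of 1 "- y"] by simp
  finally have I: "(\<integral>\<^sup>+w. ennreal (\<rho> (fst w - x) * \<rho> (snd w - y)) \<partial>lborel) = ennreal 1" .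
  show "integrable lborel (\<lambda>w. \<rho> (fst w - x) * \<rho> (snd w - y))"
    by (rule integrableI_nn_integral_finite[OF m _ I]) (use nn in auto)
  show "(LINT w|lborel. \<rho> (fst w - x) * \<rho> (snd w - y)) = 1"
    by (rule integral_eq_nn_integral[OF m, THEN trans]) (use nn I in auto)
qed

lemma conv_near:
  assumes m: "mollifier \<epsilon> \<rho> \<rho>'" and f: "L2_fun lborel f"
    and near: "\<And>w. \<bar>fst w - fst z\<bar> < \<epsilon> \<Longrightarrow> \<bar>snd w - snd z\<bar> < \<epsilon> \<Longrightarrow> cmod (f w - c) \<le> \<eta>"
  shows "cmod (conv \<rho> \<rho> f z - c) \<le> \<eta>"
proof -
  let ?k = "\<lambda>w. \<rho> (fst w - fst z) * \<rho> (snd w - snd z)"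
  note k = mollifier_weight[OF m, of "fst z" "snd z"]
  note int = conv_integrable[OF mollifier_kern(1)[OF m] mollifier_kern(1)[OF m] f, of "fst z" "snd z"]
  have intc: "integrable lborel (\<lambda>w. ?k w *\<^sub>R c)" using k(1) by (rule integrable_scaleR_left)
  have "conv \<rho> \<rho> f z - c = (LINT w|lborel. ?k w *\<^sub>R f w) - (LINT w|lborel. ?k w *\<^sub>R c)"
    using k by (simp add: conv_def)
  also have "\<dots> = (LINT w|lborel. ?k w *\<^sub>R f w - ?k w *\<^sub>R c)"
    by (rule Bochner_Integration.integral_diff[symmetric, OF int intc])
  finally have eq: "conv \<rho> \<rho> f z - c = (LINT w|lborel. ?k w *\<^sub>R f w - ?k w *\<^sub>R c)" .
  have "cmod (conv \<rho> \<rho> f z - c) \<le> (LINT w|lborel. cmod (?k w *\<^sub>R f w - ?k w *\<^sub>R c))"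
    unfolding eq by (rule integral_norm_bound)
  also have "\<dots> \<le> (LINT w|lborel. ?k w * \<eta>)"
  proof (rule integral_mono)
    fix w
    have "?k w \<ge> 0" using m by (simp add: mollifier_def)
    moreover have "?k w = 0" if "\<not> (\<bar>fst w - fst z\<bar> < \<epsilon> \<and> \<bar>snd w - snd z\<bar> < \<epsilon>)"
    proof -
      have "\<rho> s = 0" if "\<not> \<bar>s\<bar> < \<epsilon>" for s using m that by (simp add: mollifier_def)
      then show ?thesis using that by auto
    qed
    ultimately have "\<bar>?k w\<bar> * cmod (f w - c) \<le> ?k w * \<eta>"
      using near[of w] by (cases "\<bar>fst w - fst z\<bar> < \<epsilon> \<and> \<bar>snd w - snd z\<bar> < \<epsilon>") (auto intro!: mult_left_mono)
    then show "cmod (?k w *\<^sub>R f w - ?k w *\<^sub>R c) \<le> ?k w * \<eta>"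
      unfolding scaleR_diff_right[symmetric] norm_scaleR .
  next
    show "integrable lborel (\<lambda>w. cmod (?k w *\<^sub>R f w - ?k w *\<^sub>R c))"
      by (intro integrable_norm Bochner_Integration.integrable_diff int intc)
    show "integrable lborel (\<lambda>w. ?k w * \<eta>)" using k(1) by (rule integrable_mult_left)
  qed
  also have "\<dots> = \<eta>" using k by simp
  finally show ?thesis .
qed

text \<open>Jensen's inequality, from the nonnegative variance of \<open>cmod (f w)\<close> under
  the weight \<open>k\<close>. Stated with \<open>nn_integral\<close> it also covers an infinite
  right-hand side, so Tonelli's theorem can be applied before finiteness is known.\<close>

lemma weighted_mean_sq_le:
  fixes f :: "'a \<Rightarrow> complex" and k :: "'a \<Rightarrow> real"
  assumes k: "integrable M k" "(LINT w|M. k w) = 1" "\<And>w. k w \<ge> 0" and f [measurable]: "f \<in> borel_measurable M"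
  shows "ennreal ((cmod (LINT w|M. k w *\<^sub>R f w))\<^sup>2) \<le> (\<integral>\<^sup>+w. ennreal (k w * (cmod (f w))\<^sup>2) \<partial>M)"
proof (cases "integrable M (\<lambda>w. k w * (cmod (f w))\<^sup>2)")
  case False
  note [measurable] = borel_measurable_integrable[OF k(1)]
  have "(\<lambda>w. k w * (cmod (f w))\<^sup>2) \<in> borel_measurable M" by measurable
  then have "(\<integral>\<^sup>+w. ennreal (k w * (cmod (f w))\<^sup>2) \<partial>M) = \<infinity>"
    using False k(3) by (auto simp: integrable_iff_bounded less_top[symmetric] abs_mult)
  then show ?thesis by simp
next
  case int2: True
  note [measurable] = borel_measurable_integrable[OF k(1)]
  have int1: "integrable M (\<lambda>w. k w * cmod (f w))"
  proof (rule Bochner_Integration.integrable_bound)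
    show "integrable M (\<lambda>w. k w + k w * (cmod (f w))\<^sup>2)" using k int2 by simp
    have "t \<le> 1 + t\<^sup>2" for t :: real
      using zero_le_power2[of "t - 1/2"] by (simp add: power2_eq_square algebra_simps)
    then have "k w * cmod (f w) \<le> k w * (1 + (cmod (f w))\<^sup>2)" for w
      using k(3) by (intro mult_left_mono) auto
    then show "AE w in M. norm (k w * cmod (f w)) \<le> norm (k w + k w * (cmod (f w))\<^sup>2)"
      using k(3) by (intro AE_I2) (simp add: distrib_left)
  qed measurable
  define c where "c = (LINT w|M. k w * cmod (f w))"
  have "0 \<le> (LINT w|M. k w * (cmod (f w) - c)\<^sup>2)"
    by (rule Bochner_Integration.integral_nonneg) (use k(3) in auto)
  also have "\<dots> = (LINT w|M. k w * (cmod (f w))\<^sup>2 - 2 * c * (k w * cmod (f w)) + c\<^sup>2 * k w)"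
    by (rule Bochner_Integration.integral_cong) (auto simp: power2_eq_square algebra_simps)
  also have "\<dots> = (LINT w|M. k w * (cmod (f w))\<^sup>2) - 2 * c * c + c\<^sup>2 * 1"
    using int1 int2 k by (simp add: c_def[symmetric])
  finally have le: "c\<^sup>2 \<le> (LINT w|M. k w * (cmod (f w))\<^sup>2)" by (simp add: power2_eq_square)
  have "cmod (LINT w|M. k w *\<^sub>R f w) \<le> (LINT w|M. cmod (k w *\<^sub>R f w))"
    by (rule integral_norm_bound)
  also have "\<dots> = c" using k(3) by (simp add: c_def)
  finally have "(cmod (LINT w|M. k w *\<^sub>R f w))\<^sup>2 \<le> c\<^sup>2" by (intro power_mono) auto
  then have "ennreal ((cmod (LINT w|M. k w *\<^sub>R f w))\<^sup>2) \<le> ennreal (LINT w|M. k w * (cmod (f w))\<^sup>2)"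
    using le by (intro ennreal_leI) linarith
  also have "\<dots> = (\<integral>\<^sup>+w. ennreal (k w * (cmod (f w))\<^sup>2) \<partial>M)"
    using int2 k(3) by (intro nn_integral_eq_integral[symmetric]) auto
  finally show ?thesis .
qed

lemma conv_sq_le:
  assumes m: "mollifier \<epsilon> \<rho> \<rho>'" and f: "L2_fun lborel f"
  shows "ennreal ((cmod (conv \<rho> \<rho> f z))\<^sup>2) \<le> (\<integral>\<^sup>+w. ennreal (\<rho> (fst w - fst z) * \<rho> (snd w - snd z) * (cmod (f w))\<^sup>2) \<partial>lborel)"
  unfolding conv_def
  by (rule weighted_mean_sq_le)
     (use mollifier_weight[OF m] m L2_fun_measurable[OF f] in \<open>auto simp: mollifier_def\<close>)

text \<open>The affine map of \<open>{0..L}\<close> onto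
  \<open>{2 * \<epsilon>..L - 2 * \<epsilon>}\<close>. The margin exceeds the radius \<epsilon> of
  the kernel, so a kernel centred at the image is a test function even if \<open>y\<close> is on the
  boundary; this replaces an extension of the functions beyond the strip.\<close>

definition shrink :: "real \<Rightarrow> real \<Rightarrow> real \<Rightarrow> real" where
  "shrink L \<epsilon> y = 2 * \<epsilon> + (1 - 4 * \<epsilon> / L) * y"

text \<open>The point \<open>z\<close> is first moved inside, so that the average is taken over a subset of the open strip.\<close>
definition moll :: "real \<Rightarrow> real \<Rightarrow> (real \<Rightarrow> real) \<Rightarrow> (real \<times> real \<Rightarrow> complex) \<Rightarrow> real \<times> real \<Rightarrow> complex" where
  "moll L \<epsilon> \<rho> f z = conv \<rho> \<rho> f (fst z, shrink L \<epsilon> (snd z))"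

lemma shrink_bounds:
  assumes "0 < \<epsilon>" "\<epsilon> \<le> L / 8" "0 \<le> y" "y \<le> L"
  shows "2 * \<epsilon> \<le> shrink L \<epsilon> y" "shrink L \<epsilon> y \<le> L - 2 * \<epsilon>" "\<bar>shrink L \<epsilon> y - y\<bar> \<le> 2 * \<epsilon>"
proof -
  have L: "L > 0" using assms by simp
  have y: "0 \<le> y / L" "y / L \<le> 1" using assms L by auto
  have e: "shrink L \<epsilon> y = 2 * \<epsilon> + y - 4 * (\<epsilon> * (y / L))" by (simp add: shrink_def algebra_simps)
  have b: "0 \<le> \<epsilon> * (y / L)" "\<epsilon> * (y / L) \<le> \<epsilon>" using y assms mult_left_mono[of "y / L" 1 \<epsilon>] by auto
  have "4 * \<epsilon> / L \<le> 1" using assms L by (simp add: field_simps)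
  then have "0 \<le> (1 - 4 * \<epsilon> / L) * y" "(1 - 4 * \<epsilon> / L) * y \<le> (1 - 4 * \<epsilon> / L) * L"
    using assms by (auto intro!: mult_left_mono)
  then show "2 * \<epsilon> \<le> shrink L \<epsilon> y" "shrink L \<epsilon> y \<le> L - 2 * \<epsilon>"
    using L by (auto simp: shrink_def algebra_simps)
  show "\<bar>shrink L \<epsilon> y - y\<bar> \<le> 2 * \<epsilon>" unfolding e using b by linarith
qed

lemma moll_continuous:
  assumes "mollifier \<epsilon> \<rho> \<rho>'" "L2_fun lborel f"
  shows "continuous_on S (moll L \<epsilon> \<rho> f)"
  unfolding moll_def shrink_def
  by (rule continuous_on_compose2[OF conv_continuous[OF mollifier_kern(1) mollifier_kern(1)]])
     (use assms in \<open>auto intro!: continuous_intros\<close>)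

text \<open>Jensen's inequality, then Tonelli's theorem: integrating the kernel over
  \<open>z\<close> gives \<open>1 / lam\<close>, where \<open>lam\<close> is the slope of
  \<open>shrink\<close>. The bound \<open>\<epsilon> \<le> L / 8\<close> makes \<open>lam\<close> at
  least 1/2, whence the constant 2, uniform in \<epsilon>.\<close>

lemma moll_sq_nn_integral_le:
  assumes m: "mollifier \<epsilon> \<rho> \<rho>'" and f: "L2_fun lborel f" and \<epsilon>: "0 < \<epsilon>" "\<epsilon> \<le> L / 8"
  shows "(\<integral>\<^sup>+z. ennreal ((cmod (moll L \<epsilon> \<rho> f z))\<^sup>2) \<partial>lborel) \<le> 2 * (\<integral>\<^sup>+w. ennreal ((cmod (f w))\<^sup>2) \<partial>lborel)"
proof -
  define lam where "lam = 1 - 4 * \<epsilon> / L"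
  have lam: "lam \<ge> 1 / 2" using \<epsilon> by (simp add: lam_def field_simps)
  let ?k = "\<lambda>z w. \<rho> (fst w - fst z) * \<rho> (snd w - (2 * \<epsilon> + lam * snd z))"
  have rm [measurable]: "\<rho> \<in> borel_measurable borel"
    using mollifier_kern(1)[OF m] by (rule kern_measurable)
  have fm: "f \<in> borel_measurable (lborel \<Otimes>\<^sub>M lborel)" using L2_fun_measurable[OF f] by (simp add: lborel_prod)
  have nn: "\<rho> s \<ge> 0" for s using m by (auto simp: mollifier_def)
  have "(\<integral>\<^sup>+z. ennreal ((cmod (moll L \<epsilon> \<rho> f z))\<^sup>2) \<partial>lborel)
      \<le> (\<integral>\<^sup>+z. \<integral>\<^sup>+w. ennreal (?k z w * (cmod (f w))\<^sup>2) \<partial>lborel \<partial>lborel)"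
    unfolding moll_def shrink_def
    by (intro nn_integral_mono order_trans[OF conv_sq_le[OF m f]]) (simp add: lam_def)
  also have "\<dots> = (\<integral>\<^sup>+w. \<integral>\<^sup>+z. ennreal (?k z w * (cmod (f w))\<^sup>2) \<partial>lborel \<partial>lborel)"
  proof (rule lborel_pair.Fubini'[symmetric])
    have "(\<lambda>(z, w). ennreal (?k z w * (cmod (f w))\<^sup>2)) \<in> borel_measurable ((lborel \<Otimes>\<^sub>M lborel) \<Otimes>\<^sub>M (lborel \<Otimes>\<^sub>M lborel))"
      using fm by measurable
    then show "(\<lambda>(z, w). ennreal (?k z w * (cmod (f w))\<^sup>2)) \<in> borel_measurable (lborel \<Otimes>\<^sub>M lborel)"
      by (simp add: lborel_prod)
  qed
  also have "\<dots> = (\<integral>\<^sup>+w. ennreal ((cmod (f w))\<^sup>2) * ennreal (1 / lam) \<partial>lborel)"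
  proof (rule nn_integral_cong)
    fix w
    have "(\<integral>\<^sup>+z. ennreal (?k z w * (cmod (f w))\<^sup>2) \<partial>lborel)
        = (\<integral>\<^sup>+z. ennreal ((cmod (f w))\<^sup>2) * (ennreal (\<rho> (fst w + (-1) * fst z)) * ennreal (\<rho> ((snd w - 2 * \<epsilon>) + (- lam) * snd z))) \<partial>lborel)"
      using nn by (intro nn_integral_cong) (simp add: ennreal_mult[symmetric] algebra_simps)
    also have "\<dots> = ennreal ((cmod (f w))\<^sup>2) * (\<integral>\<^sup>+z. ennreal (\<rho> (fst w + (-1) * fst z)) * ennreal (\<rho> ((snd w - 2 * \<epsilon>) + (- lam) * snd z)) \<partial>lborel)"
    proof (rule nn_integral_cmult)
      have "(\<lambda>z. ennreal (\<rho> (fst w + (-1) * fst z)) * ennreal (\<rho> ((snd w - 2 * \<epsilon>) + (- lam) * snd z))) \<in> borel_measurable (lborel \<Otimes>\<^sub>M lborel)"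
        by measurable
      then show "(\<lambda>z. ennreal (\<rho> (fst w + (-1) * fst z)) * ennreal (\<rho> ((snd w - 2 * \<epsilon>) + (- lam) * snd z))) \<in> borel_measurable lborel"
        unfolding lborel_prod .
    qed
    also have "(\<integral>\<^sup>+z. ennreal (\<rho> (fst w + (-1) * fst z)) * ennreal (\<rho> ((snd w - 2 * \<epsilon>) + (- lam) * snd z)) \<partial>lborel) =
        (\<integral>\<^sup>+s. ennreal (\<rho> (fst w + (-1) * s)) \<partial>lborel) * (\<integral>\<^sup>+s. ennreal (\<rho> ((snd w - 2 * \<epsilon>) + (- lam) * s)) \<partial>lborel)"
      by (rule nn_integral_lborel_times) measurable
    also have "\<dots> = ennreal (1 / \<bar>-1\<bar>) * ennreal (1 / \<bar>- lam\<bar>)"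
      using lam by (subst (1 2) mollifier_nn_integral[OF m]) auto
    finally show "(\<integral>\<^sup>+z. ennreal (?k z w * (cmod (f w))\<^sup>2) \<partial>lborel) = ennreal ((cmod (f w))\<^sup>2) * ennreal (1 / lam)"
      using lam by simp
  qed
  also have "\<dots> \<le> (\<integral>\<^sup>+w. ennreal ((cmod (f w))\<^sup>2) * 2 \<partial>lborel)"
  proof (intro nn_integral_mono mult_left_mono)
    have "1 / lam \<le> 2" using lam by (simp add: field_simps)
    then show "ennreal (1 / lam) \<le> 2" by (metis ennreal_leI ennreal_numeral zero_le_numeral)
  qed auto
  also have "\<dots> = 2 * (\<integral>\<^sup>+w. ennreal ((cmod (f w))\<^sup>2) \<partial>lborel)"
    using L2_fun_measurable[OF f] by (subst nn_integral_multc) (auto simp: mult.commute)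
  finally show ?thesis .
qed

lemma moll_L2:
  assumes m: "mollifier \<epsilon> \<rho> \<rho>'" and f: "L2_fun lborel f" and \<epsilon>: "0 < \<epsilon>" "\<epsilon> \<le> L / 8"
  shows "L2_fun lborel (moll L \<epsilon> \<rho> f)"
    "(LINT z|lborel. (cmod (moll L \<epsilon> \<rho> f z))\<^sup>2) \<le> 2 * (LINT w|lborel. (cmod (f w))\<^sup>2)"
proof -
  have [measurable]: "moll L \<epsilon> \<rho> f \<in> borel_measurable borel"
    using moll_continuous[OF m f] by (rule borel_measurable_continuous_onI)
  have "(\<integral>\<^sup>+w. ennreal ((cmod (f w))\<^sup>2) \<partial>lborel) = ennreal (LINT w|lborel. (cmod (f w))\<^sup>2)"
    using L2_fun_integrable[OF f] by (intro nn_integral_eq_integral) auto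
  then have le: "(\<integral>\<^sup>+z. ennreal ((cmod (moll L \<epsilon> \<rho> f z))\<^sup>2) \<partial>lborel) \<le> ennreal (2 * (LINT w|lborel. (cmod (f w))\<^sup>2))"
    using moll_sq_nn_integral_le[OF assms] by (simp add: ennreal_mult')
  then have int: "integrable lborel (\<lambda>z. (cmod (moll L \<epsilon> \<rho> f z))\<^sup>2)"
    by (intro integrableI_bounded) (auto simp: le_less_trans[OF _ ennreal_less_top])
  then show "L2_fun lborel (moll L \<epsilon> \<rho> f)" by (simp add: L2_fun_def)
  have "ennreal (LINT z|lborel. (cmod (moll L \<epsilon> \<rho> f z))\<^sup>2) = (\<integral>\<^sup>+z. ennreal ((cmod (moll L \<epsilon> \<rho> f z))\<^sup>2) \<partial>lborel)"
    using int by (intro nn_integral_eq_integral[symmetric]) auto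
  with le have "ennreal (LINT z|lborel. (cmod (moll L \<epsilon> \<rho> f z))\<^sup>2) \<le> ennreal (2 * (LINT w|lborel. (cmod (f w))\<^sup>2))"
    by simp
  then show "(LINT z|lborel. (cmod (moll L \<epsilon> \<rho> f z))\<^sup>2) \<le> 2 * (LINT w|lborel. (cmod (f w))\<^sup>2)"
    by (subst (asm) ennreal_le_iff) auto
qed

lemma moll_diff:
  assumes "mollifier \<epsilon> \<rho> \<rho>'" "L2_fun lborel f" "L2_fun lborel g"
  shows "moll L \<epsilon> \<rho> (\<lambda>z. f z - g z) z = moll L \<epsilon> \<rho> f z - moll L \<epsilon> \<rho> g z"
  unfolding moll_def conv_def scaleR_diff_right
  by (intro Bochner_Integration.integral_diff conv_integrable[OF mollifier_kern(1) mollifier_kern(1)]) (use assms in auto)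

text \<open>The kernel reaches \<epsilon> in either variable and \<open>shrink\<close> moves the
  height by at most \<open>2 * \<epsilon>\<close>, which adds up to
  \<open>4 * \<epsilon>\<close>.\<close>

lemma moll_near:
  assumes m: "mollifier \<epsilon> \<rho> \<rho>'" and f: "L2_fun lborel f" and \<epsilon>: "0 < \<epsilon>" "\<epsilon> \<le> L / 8" and z: "z \<in> strip L"
    and near: "\<And>w. w \<in> strip L \<Longrightarrow> dist w z < 4 * \<epsilon> \<Longrightarrow> cmod (f w - f z) \<le> \<eta>"
  shows "cmod (moll L \<epsilon> \<rho> f z - f z) \<le> \<eta>"
  unfolding moll_def
proof (rule conv_near[OF m f])
  fix w assume w: "\<bar>fst w - fst (fst z, shrink L \<epsilon> (snd z))\<bar> < \<epsilon>" "\<bar>snd w - snd (fst z, shrink L \<epsilon> (snd z))\<bar> < \<epsilon>"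
  have "0 \<le> snd z" "snd z \<le> L" using z by (auto simp: strip_def)
  note sb = shrink_bounds[OF \<epsilon> this]
  have "w \<in> strip L" using w sb \<epsilon> by (cases w) (auto simp: strip_def abs_less_iff)
  moreover have "dist w z < 4 * \<epsilon>"
  proof -
    have "dist w z \<le> \<bar>fst w - fst z\<bar> + \<bar>snd w - snd z\<bar>"
      unfolding dist_prod_def dist_real_def using sqrt_sum_squares_le_sum_abs by auto
    moreover have "\<bar>snd w - snd z\<bar> < 3 * \<epsilon>" using w(2) sb(3) by simp
    ultimately show ?thesis using w(1) by simp
  qed
  ultimately show "cmod (f w - f z) \<le> \<eta>" by (rule near)
qed

section \<open>Lebesgue measure on the strip and Borel measure on the plane\<close>

lemma strip_borel [measurable]: "strip L \<in> sets borel"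
  unfolding strip_def by (intro borel_closed closed_Times) auto

lemma integral_lebesgue_on:
  fixes f :: "'a::euclidean_space \<Rightarrow> 'b::{banach, second_countable_topology}"
  assumes "f \<in> borel_measurable borel" "S \<in> sets borel"
  shows "(LINT z|lebesgue_on S. f z) = (LINT z|lborel. indicator S z *\<^sub>R f z)"
    "integrable (lebesgue_on S) f \<longleftrightarrow> integrable lborel (\<lambda>z. indicator S z *\<^sub>R f z)"
proof -
  note [measurable] = assms
  have S: "S \<in> sets lebesgue" using assms(2) by simp
  have m: "(\<lambda>z. indicator S z *\<^sub>R f z) \<in> borel_measurable lborel" by measurable
  show "(LINT z|lebesgue_on S. f z) = (LINT z|lborel. indicator S z *\<^sub>R f z)"
    using S by (simp add: integral_restrict_space integral_completion[OF m])
  show "integrable (lebesgue_on S) f \<longleftrightarrow> integrable lborel (\<lambda>z. indicator S z *\<^sub>R f z)"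
    using S by (simp add: integrable_restrict_space integrable_completion[OF m])
qed

lemma AE_lebesgue_on:
  assumes "S \<in> sets borel"
  shows "(AE z in lebesgue_on S. P z) \<longleftrightarrow> (AE z in lborel. z \<in> S \<longrightarrow> P z)"
  using assms by (subst AE_restrict_space_iff) (auto simp: AE_completion_iff)

lemma measurable_lebesgue_on:
  "f \<in> borel_measurable borel \<Longrightarrow> f \<in> borel_measurable (lebesgue_on S)"
  by (intro measurable_restrict_space1 measurable_completion) simp

lemma L2_fun_lebesgue_on:
  assumes "L2_fun lborel f" "S \<in> sets borel"
  shows "L2_fun (lebesgue_on S) f"
proof -
  have [measurable]: "f \<in> borel_measurable borel" using L2_fun_measurable[OF assms(1)] by simp
  have "integrable lborel (\<lambda>z. indicator S z *\<^sub>R (cmod (f z))\<^sup>2)"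
    using L2_fun_integrable[OF assms(1)] assms(2) by (intro integrable_mult_indicator) auto
  then show ?thesis
    unfolding L2_fun_def using assms(2) by (subst integral_lebesgue_on(2)) (auto intro: measurable_lebesgue_on)
qed

lemma mass_lborel:
  assumes "f \<in> borel_measurable borel"
  shows "mass L f = (LINT z|lborel. indicator (strip L) z * (cmod (f z))\<^sup>2)"
  unfolding mass_def using assms by (subst integral_lebesgue_on(1)) auto

lemma mass_lborel':
  assumes "f \<in> borel_measurable borel" "\<And>z. z \<notin> strip L \<Longrightarrow> f z = 0"
  shows "mass L f = (LINT z|lborel. (cmod (f z))\<^sup>2)"
  unfolding mass_lborel[OF assms(1)]
  by (rule Bochner_Integration.integral_cong) (use assms(2) in \<open>auto simp: indicator_def\<close>)

lemma mass_nonneg: "mass L f \<ge> 0"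
  unfolding mass_def by (rule Bochner_Integration.integral_nonneg) auto

lemma mass_le:
  assumes "L2_fun lborel f"
  shows "mass L f \<le> (LINT z|lborel. (cmod (f z))\<^sup>2)"
proof -
  have [measurable]: "f \<in> borel_measurable borel" using L2_fun_measurable[OF assms(1)] by simp
  have "integrable lborel (\<lambda>z. indicator (strip L) z * (cmod (f z))\<^sup>2)"
    using integrable_mult_indicator[OF _ L2_fun_integrable[OF assms], of "strip L"] by simp
  then show ?thesis
    unfolding mass_lborel[OF \<open>f \<in> _\<close>] using L2_fun_integrable[OF assms]
    by (intro integral_mono) (auto simp: indicator_def)
qed

lemma mass_diff_le:
  assumes "L2_fun lborel f" "L2_fun lborel g" "L2_fun lborel h"
  shows "mass L (\<lambda>z. f z - h z) \<le> 2 * mass L (\<lambda>z. f z - g z) + 2 * mass L (\<lambda>z. g z - h z)"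
  unfolding mass_def by (intro integral_diff_sq_le L2_fun_lebesgue_on assms) auto

text \<open>Uniform continuity on a ball bounds the difference by a small \<eta> on a set of finite
  measure. Beyond radius \<open>R + 1\<close> both functions vanish once
  \<open>4 * \<epsilon> n < 1\<close>.\<close>

lemma moll_tendsto_continuous:
  assumes g: "continuous_on UNIV g" "\<And>z. R < norm z \<Longrightarrow> g z = 0" "L2_fun lborel g"
    and m: "\<And>n. mollifier (\<epsilon> n) (\<rho> n) (\<rho>' n)" and \<epsilon>: "\<And>n. 0 < \<epsilon> n" "\<And>n. \<epsilon> n \<le> L / 8" "\<epsilon> \<longlonglongrightarrow> 0"
  shows "(\<lambda>n. mass L (\<lambda>z. moll L (\<epsilon> n) (\<rho> n) g z - g z)) \<longlonglongrightarrow> 0"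
proof (rule LIMSEQ_I)
  fix r :: real assume r: "r > 0"
  define V where "V = measure lborel (cball (0::real\<times>real) (R + 1))"
  have V: "V \<ge> 0" by (simp add: V_def)
  \<comment> \<open>Chosen so that the square of \<eta> times the area \<open>V\<close> of the ball
    stays below \<open>r\<close>, also if \<open>V\<close> is 0.\<close>
  define \<eta> where "\<eta> = sqrt (r / (2 * (V + 1)))"
  have \<eta>: "\<eta> > 0" using r V by (simp add: \<eta>_def)
  have \<eta>2: "\<eta>\<^sup>2 * V < r"
  proof -
    have "\<eta>\<^sup>2 = r / (2 * (V + 1))" using r V by (simp add: \<eta>_def)
    then have "\<eta>\<^sup>2 * V = r * (V / (2 * (V + 1)))" by simp
    also have "\<dots> < r * 1" using r V by (intro mult_strict_left_mono) (auto simp: field_simps)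
    finally show ?thesis by simp
  qed
  have "uniformly_continuous_on (cball 0 (R + 2)) g"
    using g(1) by (intro compact_uniformly_continuous) (auto intro: continuous_on_subset)
  then obtain \<delta> where \<delta>: "\<delta> > 0"
    "\<And>w z. w \<in> cball 0 (R + 2) \<Longrightarrow> z \<in> cball 0 (R + 2) \<Longrightarrow> dist w z < \<delta> \<Longrightarrow> dist (g w) (g z) < \<eta>"
    unfolding uniformly_continuous_on_def using \<eta> by metis
  have "\<forall>\<^sub>F n in sequentially. \<epsilon> n < min 1 \<delta> / 4"
    using \<epsilon>(3) by (rule order_tendstoD(2)) (use \<delta>(1) in auto)
  then obtain N where N: "\<And>n. n \<ge> N \<Longrightarrow> \<epsilon> n < min 1 \<delta> / 4" by (auto simp: eventually_sequentially)
  have "mass L (\<lambda>z. moll L (\<epsilon> n) (\<rho> n) g z - g z) < r" if n: "n \<ge> N" for n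
  proof -
    let ?d = "\<lambda>z. moll L (\<epsilon> n) (\<rho> n) g z - g z"
    have e4: "4 * \<epsilon> n < 1" "4 * \<epsilon> n < \<delta>" using N[OF n] by auto
    have L2: "L2_fun lborel ?d" by (intro L2_fun_diff moll_L2(1)[OF m g(3) \<epsilon>(1,2)] g(3))
    then have [measurable]: "?d \<in> borel_measurable borel" using L2_fun_measurable by fastforce
    have le: "indicator (strip L) z * (cmod (?d z))\<^sup>2 \<le> indicator (cball 0 (R + 1)) z * \<eta>\<^sup>2" for z
    proof (cases "z \<in> strip L")
      case True
      have near: "cmod (g w - g z) \<le> (if z \<in> cball 0 (R + 1) then \<eta> else 0)" if w: "w \<in> strip L" "dist w z < 4 * \<epsilon> n" for w
      proof (cases "z \<in> cball 0 (R + 1)")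
        case True
        have "norm w \<le> norm z + dist w z" by (metis dist_norm norm_triangle_sub)
        then have "w \<in> cball 0 (R + 2)" using True w e4 by simp
        then have "dist (g w) (g z) < \<eta>" using True w e4 by (intro \<delta>(2)) auto
        then show ?thesis using True by (simp add: dist_norm)
      next
        case False
        have "norm z \<le> norm w + dist w z" by (metis dist_norm dist_commute norm_triangle_sub)
        then have "R < norm w" "R < norm z" using False w e4 by auto
        then show ?thesis using g(2) \<eta> by simp
      qed
      have "cmod (?d z) \<le> (if z \<in> cball 0 (R + 1) then \<eta> else 0)"
        by (rule moll_near[OF m g(3) \<epsilon>(1,2) True near])
      then have "(cmod (?d z))\<^sup>2 \<le> (if z \<in> cball 0 (R + 1) then \<eta> else 0)\<^sup>2" by (intro power_mono) auto
      then show ?thesis using True by (auto simp: indicator_def split: if_splits)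
    qed auto
    have "mass L ?d \<le> (LINT z|lborel. indicator (cball (0::real\<times>real) (R + 1)) z * \<eta>\<^sup>2)"
      unfolding mass_lborel[OF \<open>?d \<in> _\<close>]
    proof (rule integral_mono)
      show "indicator (strip L) z * (cmod (?d z))\<^sup>2 \<le> indicator (cball 0 (R + 1)) z * \<eta>\<^sup>2" for z by (rule le)
      show "integrable lborel (\<lambda>z. indicator (strip L) z * (cmod (?d z))\<^sup>2)"
        using integrable_mult_indicator[OF _ L2_fun_integrable[OF L2], of "strip L"] by simp
      show "integrable lborel (\<lambda>z::real\<times>real. indicator (cball 0 (R + 1)) z * \<eta>\<^sup>2 :: real)"
        using emeasure_bounded_finite[of "cball (0::real\<times>real) (R + 1)"]
        by (intro integrable_mult_left) (auto simp: integrable_indicator_iff)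
    qed
    also have "\<dots> = \<eta>\<^sup>2 * V" by (simp add: V_def)
    finally show ?thesis using \<eta>2 by simp
  qed
  then show "\<exists>N. \<forall>n\<ge>N. norm (mass L (\<lambda>z. moll L (\<epsilon> n) (\<rho> n) g z - g z) - 0) < r"
    using mass_nonneg by (intro exI[of _ N]) auto
qed

text \<open>The usual density argument: the operators are linear and bounded uniformly in
  \<open>n\<close>, and converge on the dense set of \<open>L2_dense\<close>.\<close>

lemma moll_tendsto:
  assumes f: "L2_fun lborel f"
    and m: "\<And>n. mollifier (\<epsilon> n) (\<rho> n) (\<rho>' n)" and \<epsilon>: "\<And>n. 0 < \<epsilon> n" "\<And>n. \<epsilon> n \<le> L / 8" "\<epsilon> \<longlonglongrightarrow> 0"
  shows "(\<lambda>n. mass L (\<lambda>z. moll L (\<epsilon> n) (\<rho> n) f z - f z)) \<longlonglongrightarrow> 0"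
proof (rule LIMSEQ_I)
  fix r :: real assume r: "r > 0"
  obtain g R where g: "continuous_on UNIV g" "\<And>z. R < norm z \<Longrightarrow> g z = 0" "L2_fun lborel g"
    and fg: "(LINT z|lborel. (cmod (f z - g z))\<^sup>2) < r / 16"
    using L2_dense[OF f, of "r / 16"] r by auto
  have "(\<lambda>n. mass L (\<lambda>z. moll L (\<epsilon> n) (\<rho> n) g z - g z)) \<longlonglongrightarrow> 0"
    by (rule moll_tendsto_continuous[OF g m \<epsilon>])
  then have "\<forall>\<^sub>F n in sequentially. mass L (\<lambda>z. moll L (\<epsilon> n) (\<rho> n) g z - g z) < r / 16"
    by (rule order_tendstoD(2)) (use r in simp)
  then obtain N where N: "\<And>n. n \<ge> N \<Longrightarrow> mass L (\<lambda>z. moll L (\<epsilon> n) (\<rho> n) g z - g z) < r / 16"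
    by (auto simp: eventually_sequentially)
  have "mass L (\<lambda>z. moll L (\<epsilon> n) (\<rho> n) f z - f z) < r" if n: "n \<ge> N" for n
  proof -
    let ?A = "moll L (\<epsilon> n) (\<rho> n)"
    note L2 = moll_L2(1)[OF m f \<epsilon>(1,2), of n] moll_L2(1)[OF m g(3) \<epsilon>(1,2), of n]
    have d: "L2_fun lborel (\<lambda>z. f z - g z)" by (rule L2_fun_diff[OF f g(3)])
    have 1: "mass L (\<lambda>z. ?A f z - f z) \<le> 2 * mass L (\<lambda>z. ?A f z - ?A g z) + 2 * mass L (\<lambda>z. ?A g z - f z)"
      by (rule mass_diff_le) (use L2 f in auto)
    have 2: "mass L (\<lambda>z. ?A g z - f z) \<le> 2 * mass L (\<lambda>z. ?A g z - g z) + 2 * mass L (\<lambda>z. g z - f z)"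
      by (rule mass_diff_le) (use L2 f g in auto)
    have 3: "mass L (\<lambda>z. g z - f z) < r / 16"
      using mass_le[OF L2_fun_diff[OF g(3) f], of L] fg by (simp add: norm_minus_commute)
    have "mass L (\<lambda>z. ?A f z - ?A g z) = mass L (?A (\<lambda>z. f z - g z))"
      by (rule arg_cong[of _ _ "mass L"], rule ext) (rule moll_diff[OF m f g(3), symmetric])
    also have "\<dots> \<le> (LINT z|lborel. (cmod (?A (\<lambda>z. f z - g z) z))\<^sup>2)"
      by (rule mass_le[OF moll_L2(1)[OF m d \<epsilon>(1,2)]])
    also have "\<dots> \<le> 2 * (LINT z|lborel. (cmod (f z - g z))\<^sup>2)"
      by (rule moll_L2(2)[OF m d \<epsilon>(1,2)])
    finally have "mass L (\<lambda>z. ?A f z - ?A g z) < r / 8" using fg by simp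
    then show ?thesis using 1 2 3 N[OF n] r by linarith
  qed
  then show "\<exists>N. \<forall>n\<ge>N. norm (mass L (\<lambda>z. moll L (\<epsilon> n) (\<rho> n) f z - f z) - 0) < r"
    using mass_nonneg by (intro exI[of _ N]) auto
qed

lemma moll_tendsto_pointwise:
  assumes f: "L2_fun lborel f" "continuous_on (strip L) f"
    and m: "\<And>n. mollifier (\<epsilon> n) (\<rho> n) (\<rho>' n)" and \<epsilon>: "\<And>n. 0 < \<epsilon> n" "\<And>n. \<epsilon> n \<le> L / 8" "\<epsilon> \<longlonglongrightarrow> 0"
    and z: "z \<in> strip L"
  shows "(\<lambda>n. moll L (\<epsilon> n) (\<rho> n) f z) \<longlonglongrightarrow> f z"
proof (rule LIMSEQ_I)
  fix r :: real assume r: "r > 0"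
  obtain \<delta> where \<delta>: "\<delta> > 0" "\<And>w. w \<in> strip L \<Longrightarrow> dist w z < \<delta> \<Longrightarrow> dist (f w) (f z) < r / 2"
    using f(2) z r unfolding continuous_on_iff by (metis half_gt_zero)
  have "\<forall>\<^sub>F n in sequentially. \<epsilon> n < \<delta> / 4"
    using \<epsilon>(3) by (rule order_tendstoD(2)) (use \<delta>(1) in auto)
  then obtain N where N: "\<And>n. n \<ge> N \<Longrightarrow> \<epsilon> n < \<delta> / 4" by (auto simp: eventually_sequentially)
  have "cmod (moll L (\<epsilon> n) (\<rho> n) f z - f z) < r" if n: "n \<ge> N" for n
  proof -
    have "cmod (moll L (\<epsilon> n) (\<rho> n) f z - f z) \<le> r / 2"
    proof (rule moll_near[OF m f(1) \<epsilon>(1,2) z])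
      show "cmod (f w - f z) \<le> r / 2" if "w \<in> strip L" "dist w z < 4 * \<epsilon> n" for w
        using \<delta>(2)[of w] that N[OF n] by (simp add: dist_norm)
    qed
    then show ?thesis using r by simp
  qed
  then show "\<exists>N. \<forall>n\<ge>N. norm (moll L (\<epsilon> n) (\<rho> n) f z - f z) < r" by blast
qed

section \<open>Weak derivatives\<close>

text \<open>Fubini's theorem is available for Borel functions, hence the passage from the Lebesgue
  measurable \<open>u\<close> to a Borel function \<open>u'\<close> that vanishes outside of the strip.\<close>
definition rep :: "real \<Rightarrow> (real \<times> real \<Rightarrow> complex) \<Rightarrow> (real \<times> real \<Rightarrow> complex) \<Rightarrow> bool" where
  "rep L u u' \<longleftrightarrow> L2_fun lborel u' \<and> (\<forall>z. z \<notin> strip L \<longrightarrow> u' z = 0) \<and> (AE z in lebesgue_on (strip L). u z = u' z)"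

lemma lebesgue_AE_borel_complex:
  fixes f :: "'a::euclidean_space \<Rightarrow> complex"
  assumes "f \<in> borel_measurable lebesgue"
  shows "\<exists>f'\<in>borel_measurable borel. AE z in lborel. f z = f' z"
proof -
  have "(\<lambda>z. Re (f z)) \<in> borel_measurable (completion lborel)" "(\<lambda>z. Im (f z)) \<in> borel_measurable (completion lborel)"
    using assms by measurable
  then obtain r i where ri: "r \<in> borel_measurable lborel" "AE z in lborel. Re (f z) = r z"
    "i \<in> borel_measurable lborel" "AE z in lborel. Im (f z) = i z"
    using completion_ex_borel_measurable_real by metis
  have "(\<lambda>z. complex_of_real (r z) + \<i> * complex_of_real (i z)) \<in> borel_measurable borel"
    using ri(1,3) by measurable
  moreover have "AE z in lborel. f z = complex_of_real (r z) + \<i> * complex_of_real (i z)"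
    using ri(2,4) by eventually_elim (rule complex_eqI, simp_all)
  ultimately show ?thesis
    by (intro bexI[where x = "\<lambda>z. complex_of_real (r z) + \<i> * complex_of_real (i z)"])
qed

lemma rep_exists:
  assumes u: "L2_fun (lebesgue_on (strip L)) u"
  shows "\<exists>u'. rep L u u'"
proof -
  have s: "strip L \<in> sets lebesgue" using strip_borel by simp
  have "(\<lambda>z. indicator (strip L) z *\<^sub>R u z) \<in> borel_measurable lebesgue"
    using L2_fun_measurable[OF u] s by (subst (asm) borel_measurable_restrict_space_iff) auto
  then obtain f where f: "f \<in> borel_measurable borel" and ae: "AE z in lborel. indicator (strip L) z *\<^sub>R u z = f z"
    using lebesgue_AE_borel_complex by blast
  note [measurable] = f
  define u' where "u' z = indicator (strip L) z *\<^sub>R f z" for z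
  have m: "u' \<in> borel_measurable borel" unfolding u'_def by measurable
  have ae': "AE z in lebesgue_on (strip L). u z = u' z"
    unfolding AE_lebesgue_on[OF strip_borel] u'_def using ae by eventually_elim auto
  have "integrable (lebesgue_on (strip L)) (\<lambda>z. (cmod (u' z))\<^sup>2)"
  proof (rule integrable_cong_AE_imp[OF L2_fun_integrable[OF u]])
    show "(\<lambda>z. (cmod (u' z))\<^sup>2) \<in> borel_measurable (lebesgue_on (strip L))"
      using m by (intro measurable_lebesgue_on) measurable
    show "AE z in lebesgue_on (strip L). (cmod (u z))\<^sup>2 = (cmod (u' z))\<^sup>2" using ae' by eventually_elim simp
  qed
  then have "integrable lborel (\<lambda>z. indicator (strip L) z *\<^sub>R (cmod (u' z))\<^sup>2)"
    using m by (subst (asm) integral_lebesgue_on(2)) auto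
  also have "(\<lambda>z. indicator (strip L) z *\<^sub>R (cmod (u' z))\<^sup>2) = (\<lambda>z. (cmod (u' z))\<^sup>2)"
    by (auto simp: u'_def indicator_def fun_eq_iff)
  finally have "L2_fun lborel u'" using m by (simp add: L2_fun_def)
  then show ?thesis unfolding rep_def using ae' by (intro exI[of _ u']) (auto simp: u'_def)
qed

lemma rep_integral:
  fixes h :: "real \<times> real \<Rightarrow> real"
  assumes r: "rep L u u'" and u: "u \<in> borel_measurable (lebesgue_on (strip L))" and h: "h \<in> borel_measurable borel"
  shows "(LINT z|lebesgue_on (strip L). h z *\<^sub>R u z) = (LINT z|lborel. h z *\<^sub>R u' z)"
proof -
  have [measurable]: "u' \<in> borel_measurable borel" using r L2_fun_measurable[of lborel u'] by (simp add: rep_def)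
  have hu: "(\<lambda>z. h z *\<^sub>R u' z) \<in> borel_measurable borel" using h by measurable
  have "(LINT z|lebesgue_on (strip L). h z *\<^sub>R u z) = (LINT z|lebesgue_on (strip L). h z *\<^sub>R u' z)"
  proof (rule integral_cong_AE)
    show "(\<lambda>z. h z *\<^sub>R u z) \<in> borel_measurable (lebesgue_on (strip L))"
      using u measurable_lebesgue_on[OF h] by measurable
    show "AE z in lebesgue_on (strip L). h z *\<^sub>R u z = h z *\<^sub>R u' z"
      using r unfolding rep_def by (auto elim: AE_mp)
  qed (use hu in \<open>rule measurable_lebesgue_on\<close>)
  also have "\<dots> = (LINT z|lborel. indicator (strip L) z *\<^sub>R (h z *\<^sub>R u' z))"
    by (rule integral_lebesgue_on(1)[OF hu strip_borel])
  also have "\<dots> = (LINT z|lborel. h z *\<^sub>R u' z)"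
    by (rule Bochner_Integration.integral_cong) (use r in \<open>auto simp: rep_def indicator_def\<close>)
  finally show ?thesis .
qed

lemma rep_mass:
  assumes r: "rep L u u'" and u: "u \<in> borel_measurable (lebesgue_on (strip L))"
  shows "mass L u = (LINT z|lborel. (cmod (u' z))\<^sup>2)"
proof -
  have m: "u' \<in> borel_measurable borel" using r L2_fun_measurable[of lborel u'] by (simp add: rep_def)
  have "mass L u = mass L u'"
    unfolding mass_def
  proof (rule integral_cong_AE)
    show "AE z in lebesgue_on (strip L). (cmod (u z))\<^sup>2 = (cmod (u' z))\<^sup>2"
      using r unfolding rep_def by (auto elim: AE_mp)
  qed (use u measurable_lebesgue_on[OF m] in measurable)
  also have "\<dots> = (LINT z|lborel. (cmod (u' z))\<^sup>2)"
    by (rule mass_lborel'[OF m]) (use r in \<open>auto simp: rep_def\<close>)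
  finally show ?thesis .
qed

lemma test_fun_differentiable: "test_fun L \<phi> \<Longrightarrow> \<phi> differentiable (at z)"
  unfolding test_fun_def by (metis Ck_fun.simps(2))

lemma test_fun_continuous:
  assumes "test_fun L \<phi>" shows "continuous_on UNIV \<phi>" "continuous_on UNIV (dirD e \<phi>)"
proof -
  have "Ck_fun 0 \<phi>" "Ck_fun (Suc 0) \<phi>" using assms unfolding test_fun_def by blast+
  then show "continuous_on UNIV \<phi>" "continuous_on UNIV (dirD e \<phi>)" by (simp_all del: split_paired_All)
qed

lemma test_fun_support:
  assumes "test_fun L \<phi>"
  shows "\<exists>R. \<forall>z. \<not> (norm z \<le> R \<and> 0 < snd z \<and> snd z < L) \<longrightarrow> \<phi> z = 0 \<and> dirD e \<phi> z = 0"
proof -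
  obtain K where K: "compact K" "K \<subseteq> UNIV \<times> {0<..<L}" "\<And>z. z \<notin> K \<Longrightarrow> \<phi> z = 0"
    using assms unfolding test_fun_def by blast
  obtain R where R: "\<And>z. z \<in> K \<Longrightarrow> norm z \<le> R"
    using compact_imp_bounded[OF K(1)] unfolding bounded_iff by blast
  have "dirD e \<phi> z = 0" if "z \<notin> K" for z
  proof -
    have "(\<phi> has_derivative (\<lambda>_. 0)) (at z)"
      by (rule has_derivative_transform_within_open[of "\<lambda>_. 0" _ z UNIV "- K"])
         (use K(3) that open_Compl[OF compact_imp_closed[OF K(1)]] in \<open>auto intro!: derivative_intros\<close>)
    then have "frechet_derivative \<phi> (at z) = (\<lambda>_. 0)" by (rule frechet_derivative_at[symmetric])
    then show ?thesis by simp
  qed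
  moreover have "norm z \<le> R \<and> 0 < snd z \<and> snd z < L" if "z \<in> K" for z
    using R[OF that] subsetD[OF K(2) that] by (cases z) auto
  ultimately have "\<forall>z. \<not> (norm z \<le> R \<and> 0 < snd z \<and> snd z < L) \<longrightarrow> \<phi> z = 0 \<and> dirD e \<phi> z = 0"
    using K(3) by blast
  then show ?thesis ..
qed

lemma test_fun_integrable:
  assumes "test_fun L \<phi>" "L2_fun lborel u"
  shows "integrable lborel (\<lambda>z. \<phi> z *\<^sub>R u z)" "integrable lborel (\<lambda>z. dirD e \<phi> z *\<^sub>R u z)"
proof -
  have main: "integrable lborel (\<lambda>z. h z *\<^sub>R u z)" if h: "continuous_on UNIV h" and s: "\<And>z. \<not> norm z \<le> R \<Longrightarrow> h z = 0"
    for h :: "real \<times> real \<Rightarrow> real" and R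
  proof -
    have "compact (h ` cball 0 R)"
      using h by (intro compact_continuous_image) (auto intro: continuous_on_subset)
    then obtain B where B: "\<And>z. z \<in> cball 0 R \<Longrightarrow> \<bar>h z\<bar> \<le> B"
      using compact_imp_bounded bounded_iff by (metis image_eqI real_norm_def)
    obtain a b where ab: "cball (0::real\<times>real) R \<subseteq> cbox a b"
      using bounded_subset_cbox_symmetric[OF bounded_cball] by metis
    have [measurable]: "h \<in> borel_measurable borel" using h by (rule borel_measurable_continuous_onI)
    note [measurable] = L2_fun_measurable[OF assms(2)]
    show ?thesis
    proof (rule Bochner_Integration.integrable_bound)
      show "integrable lborel (\<lambda>z. max 0 B * (indicator (cbox a b) z * cmod (u z)))"
        by (intro integrable_mult_right L2_fun_integrable_box assms)
      have "norm (h z *\<^sub>R u z) \<le> norm (max 0 B * (indicator (cbox a b) z * cmod (u z)))" for z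
      proof (cases "norm z \<le> R")
        case True
        then have "z \<in> cbox a b" "\<bar>h z\<bar> \<le> max 0 B" using ab B[of z] by auto
        then show ?thesis by (auto simp: abs_mult intro!: mult_right_mono)
      qed (use s in simp)
      then show "AE z in lborel. norm (h z *\<^sub>R u z) \<le> norm (max 0 B * (indicator (cbox a b) z * cmod (u z)))" by simp
    qed measurable
  qed
  obtain R where "\<forall>z. \<not> (norm z \<le> R \<and> 0 < snd z \<and> snd z < L) \<longrightarrow> \<phi> z = 0 \<and> dirD e \<phi> z = 0"
    using test_fun_support[OF assms(1), of e] by blast
  then have R: "\<phi> z = 0" "dirD e \<phi> z = 0" if "\<not> norm z \<le> R" for z using that by blast+
  show "integrable lborel (\<lambda>z. \<phi> z *\<^sub>R u z)"
    by (rule main[OF test_fun_continuous(1)[OF assms(1)] R(1)])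
  show "integrable lborel (\<lambda>z. dirD e \<phi> z *\<^sub>R u z)"
    by (rule main[OF test_fun_continuous(2)[OF assms(1)] R(2)])
qed

text \<open>The defining identity of the weak derivative for representatives that vanish off the
  strip. The integrals extend over the plane, where Fubini's theorem is available.\<close>

definition wder :: "real \<Rightarrow> real \<times> real \<Rightarrow> (real \<times> real \<Rightarrow> complex) \<Rightarrow> (real \<times> real \<Rightarrow> complex) \<Rightarrow> bool" where
  "wder L e u v \<longleftrightarrow> (\<forall>\<phi>. test_fun L \<phi> \<longrightarrow> (LINT z|lborel. dirD e \<phi> z *\<^sub>R u z) = - (LINT z|lborel. \<phi> z *\<^sub>R v z))"

lemma has_weak_deriv_rep:
  assumes "rep L u u'" "rep L v v'" "u \<in> borel_measurable (lebesgue_on (strip L))" "L2_fun (lebesgue_on (strip L)) v"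
  shows "has_weak_deriv L e u v \<longleftrightarrow> wder L e u' v'"
  unfolding has_weak_deriv_def wder_def
  using rep_integral[OF assms(1,3)] rep_integral[OF assms(2) L2_fun_measurable[OF assms(4)]] assms(4)
    borel_measurable_continuous_onI[OF test_fun_continuous(1)] borel_measurable_continuous_onI[OF test_fun_continuous(2)]
  by auto

lemma wder_diff:
  assumes "wder L e u a" "wder L e v b" "L2_fun lborel u" "L2_fun lborel v" "L2_fun lborel a" "L2_fun lborel b"
  shows "wder L e (\<lambda>z. u z - v z) (\<lambda>z. a z - b z)"
  using assms unfolding wder_def by (simp add: scaleR_diff_right test_fun_integrable)

text \<open>The bounds on \<open>y\<close> are those that \<open>shrink\<close> guarantees; they put
  the support of the kernel into the open strip.\<close>

lemma moll_test_fun: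
  assumes m: "mollifier \<epsilon> \<rho> \<rho>'" and e: "0 < \<epsilon>" and y: "2 * \<epsilon> \<le> y" "y \<le> L - 2 * \<epsilon>"
  shows "test_fun L (\<lambda>w. \<rho> (fst w - x) * \<rho> (snd w - y))"
    "dirD (1, 0) (\<lambda>w. \<rho> (fst w - x) * \<rho> (snd w - y)) w = \<rho>' (fst w - x) * \<rho> (snd w - y)"
    "dirD (0, 1) (\<lambda>w. \<rho> (fst w - x) * \<rho> (snd w - y)) w = \<rho> (fst w - x) * \<rho>' (snd w - y)"
proof -
  have "smooth_fun (\<lambda>w::real\<times>real. \<rho> (fst w - x) * \<rho> (snd w - y))" using m by (simp add: mollifier_def)
  moreover have "\<rho> (fst w - x) * \<rho> (snd w - y) = 0" if "w \<notin> cbox (x - \<epsilon>, y - \<epsilon>) (x + \<epsilon>, y + \<epsilon>)" for w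
  proof -
    have "\<epsilon> \<le> \<bar>fst w - x\<bar> \<or> \<epsilon> \<le> \<bar>snd w - y\<bar>" using that by (cases w) (auto simp: cbox_Pair_eq)
    then show ?thesis using m by (auto simp: mollifier_def)
  qed
  moreover have "cbox (x - \<epsilon>, y - \<epsilon>) (x + \<epsilon>, y + \<epsilon>) \<subseteq> UNIV \<times> {0<..<L}"
    using y e by (auto simp: cbox_Pair_eq)
  ultimately show "test_fun L (\<lambda>w. \<rho> (fst w - x) * \<rho> (snd w - y))"
    unfolding test_fun_def
    by (intro conjI allI impI exI[of _ "cbox (x - \<epsilon>, y - \<epsilon>) (x + \<epsilon>, y + \<epsilon>)"] smooth_fun_Ck compact_cbox)
  have d: "(\<rho> has_real_derivative \<rho>' s) (at s)" for s using m by (simp add: mollifier_def)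
  have "((\<lambda>w. \<rho> (fst w - x)) has_derivative (\<lambda>h. \<rho>' (fst w - x) * fst h)) (at w)" for w :: "real \<times> real"
    by (rule has_derivative_eq_rhs, rule DERIV_compose_FDERIV[OF d, where g = "\<lambda>w. fst w - x"])
       (auto intro!: derivative_eq_intros simp: mult.commute)
  moreover have "((\<lambda>w. \<rho> (snd w - y)) has_derivative (\<lambda>h. \<rho>' (snd w - y) * snd h)) (at w)" for w :: "real \<times> real"
    by (rule has_derivative_eq_rhs, rule DERIV_compose_FDERIV[OF d, where g = "\<lambda>w. snd w - y"])
       (auto intro!: derivative_eq_intros simp: mult.commute)
  ultimately have "((\<lambda>w. \<rho> (fst w - x) * \<rho> (snd w - y)) has_derivative
      (\<lambda>h. \<rho> (fst w - x) * (\<rho>' (snd w - y) * snd h) + \<rho>' (fst w - x) * fst h * \<rho> (snd w - y))) (at w)"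
    by (rule has_derivative_mult)
  from frechet_derivative_at[OF this, symmetric]
  show "dirD (1, 0) (\<lambda>w. \<rho> (fst w - x) * \<rho> (snd w - y)) w = \<rho>' (fst w - x) * \<rho> (snd w - y)"
    "dirD (0, 1) (\<lambda>w. \<rho> (fst w - x) * \<rho> (snd w - y)) w = \<rho> (fst w - x) * \<rho>' (snd w - y)"
    by simp_all
qed

text \<open>The derivative falls on the kernel, which is a test function, and the weak derivative
  moves it over to \<open>a\<close>. All this holds for \<open>y\<close> on the boundary as well,
  which makes the mollification smooth up to there.\<close>

lemma moll_derivative_fst:
  assumes m: "mollifier \<epsilon> \<rho> \<rho>'" and e: "0 < \<epsilon>" "\<epsilon> \<le> L / 8" and y: "0 \<le> y" "y \<le> L"
    and u: "L2_fun lborel u" and w: "wder L (1, 0) u a"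
  shows "((\<lambda>x. moll L \<epsilon> \<rho> u (x, y)) has_vector_derivative moll L \<epsilon> \<rho> a (x, y)) (at x)"
proof -
  note sb = shrink_bounds[OF e y]
  note tf = moll_test_fun[OF m e(1) sb(1,2)]
  have "conv \<rho>' \<rho> u (x, shrink L \<epsilon> y) = - conv \<rho> \<rho> a (x, shrink L \<epsilon> y)"
    using w[unfolded wder_def, rule_format, OF tf(1), of x] by (simp add: tf(2) conv_def)
  moreover have "((\<lambda>x. conv \<rho> \<rho> u (x, shrink L \<epsilon> y)) has_vector_derivative - conv \<rho>' \<rho> u (x, shrink L \<epsilon> y)) (at x)"
    using m by (intro conv_derivative_fst[OF mollifier_kern(1)[OF m] mollifier_kern(1)[OF m] mollifier_kern(2)[OF m] _ u])
      (auto simp: mollifier_def)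
  ultimately show ?thesis by (simp add: moll_def)
qed

text \<open>Here the chain rule through \<open>shrink\<close> leaves its slope as a factor, which
  tends to 1 with \<epsilon>.\<close>

lemma moll_derivative_snd:
  assumes m: "mollifier \<epsilon> \<rho> \<rho>'" and e: "0 < \<epsilon>" "\<epsilon> \<le> L / 8" and y: "0 \<le> y" "y \<le> L"
    and u: "L2_fun lborel u" and w: "wder L (0, 1) u b"
  shows "((\<lambda>y. moll L \<epsilon> \<rho> u (x, y)) has_vector_derivative (1 - 4 * \<epsilon> / L) *\<^sub>R moll L \<epsilon> \<rho> b (x, y)) (at y)"
proof -
  note sb = shrink_bounds[OF e y]
  note tf = moll_test_fun[OF m e(1) sb(1,2)]
  have "conv \<rho> \<rho>' u (x, shrink L \<epsilon> y) = - conv \<rho> \<rho> b (x, shrink L \<epsilon> y)"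
    using w[unfolded wder_def, rule_format, OF tf(1), of x] by (simp add: tf(3) conv_def)
  moreover have "((\<lambda>y. conv \<rho> \<rho> u (x, y)) has_vector_derivative - conv \<rho> \<rho>' u (x, shrink L \<epsilon> y)) (at (shrink L \<epsilon> y))"
    using m by (intro conv_derivative_snd[OF mollifier_kern(1)[OF m] mollifier_kern(1)[OF m] mollifier_kern(2)[OF m] _ u])
      (auto simp: mollifier_def)
  moreover have "(shrink L \<epsilon> has_vector_derivative (1 - 4 * \<epsilon> / L)) (at y)"
    unfolding shrink_def has_real_derivative_iff_has_vector_derivative[symmetric]
    by (auto intro!: derivative_eq_intros)
  ultimately have "(((\<lambda>y. conv \<rho> \<rho> u (x, y)) \<circ> shrink L \<epsilon>) has_vector_derivative
      (1 - 4 * \<epsilon> / L) *\<^sub>R conv \<rho> \<rho> b (x, shrink L \<epsilon> y)) (at y)"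
    by (intro vector_diff_chain_at) auto
  then show ?thesis by (simp add: moll_def comp_def)
qed

text \<open>Radii that tend to 0 and respect the bound \<open>L / 8\<close> for every
  \<open>n\<close>.\<close>

definition steps :: "real \<Rightarrow> nat \<Rightarrow> real" where
  "steps L n = L / (8 * (real n + 1))"

lemma steps:
  assumes "L > 0"
  shows "0 < steps L n" "steps L n \<le> L / 8" "steps L \<longlonglongrightarrow> 0"
proof -
  show "0 < steps L n" using assms by (simp add: steps_def)
  have "L / (8 * (real n + 1)) \<le> L / 8" using assms by (intro divide_left_mono) auto
  then show "steps L n \<le> L / 8" by (simp add: steps_def)
  have "(\<lambda>n. L / 8 * (1 / (real n + 1))) \<longlonglongrightarrow> L / 8 * 0"
    by (intro tendsto_mult_left LIMSEQ_Suc[OF lim_inverse_n', simplified add.commute])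
       (use LIMSEQ_Suc[OF lim_inverse_n'] in \<open>simp add: add.commute\<close>)
  then show "steps L \<longlonglongrightarrow> 0" by (simp add: steps_def[abs_def])
qed

lemma mollifiers_exist: "L > 0 \<Longrightarrow> \<exists>\<rho> \<rho>'. \<forall>n. mollifier (steps L n) (\<rho> n) (\<rho>' n)"
  using mollifier_exists[OF steps(1)] by metis

text \<open>The kernels are test functions, so the mollifications of \<open>v - w\<close> vanish on
  the strip; but they converge to \<open>v - w\<close> in the mean.\<close>

lemma wder_unique:
  assumes L: "L > 0" and e: "wder L e u v" "wder L e u w" and v: "L2_fun lborel v" "\<And>z. z \<notin> strip L \<Longrightarrow> v z = 0"
    and w: "L2_fun lborel w" "\<And>z. z \<notin> strip L \<Longrightarrow> w z = 0"
  shows "AE z in lborel. v z = w z"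
proof -
  define d where "d z = v z - w z" for z
  have d: "L2_fun lborel d" "\<And>z. z \<notin> strip L \<Longrightarrow> d z = 0"
    using L2_fun_diff[OF v(1) w(1)] v(2) w(2) by (auto simp: d_def[abs_def])
  have dm: "d \<in> borel_measurable borel" using L2_fun_measurable[OF d(1)] by simp
  have 0: "(LINT z|lborel. \<phi> z *\<^sub>R d z) = 0" if "test_fun L \<phi>" for \<phi>
    using that e v w unfolding wder_def by (simp add: d_def scaleR_diff_right test_fun_integrable)
  obtain \<rho> \<rho>' where m: "\<And>n. mollifier (steps L n) (\<rho> n) (\<rho>' n)" using mollifiers_exist[OF L] by blast
  have "moll L (steps L n) (\<rho> n) d z = 0" if "z \<in> strip L" for n z
  proof -
    have "0 \<le> snd z" "snd z \<le> L" using that by (auto simp: strip_def)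
    note sb = shrink_bounds[OF steps(1,2)[OF L] this]
    show ?thesis
      using 0[OF moll_test_fun(1)[OF m steps(1)[OF L] sb(1,2)]] by (simp add: moll_def conv_def)
  qed
  then have "mass L (\<lambda>z. moll L (steps L n) (\<rho> n) d z - d z) = mass L d" for n
    unfolding mass_def by (intro Bochner_Integration.integral_cong) auto
  with moll_tendsto[OF d(1) m steps[OF L]] have "mass L d = 0"
    by (simp add: LIMSEQ_const_iff)
  then have "(LINT z|lborel. (cmod (d z))\<^sup>2) = 0" using mass_lborel'[OF dm d(2)] by simp
  then have "AE z in lborel. (cmod (d z))\<^sup>2 = 0"
    using integral_nonneg_eq_0_iff_AE[OF L2_fun_integrable[OF d(1)]] by simp
  then show ?thesis by eventually_elim (simp add: d_def)
qed

section \<open>Classical derivatives are weak derivatives\<close>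

lemma integral_derivative_zero:
  fixes G :: "real \<Rightarrow> complex"
  assumes "finite S" "p \<le> q" "\<And>t. t \<in> {p<..<q} - S \<Longrightarrow> (G has_vector_derivative F t) (at t)"
    and "continuous_on {p..q} G" "G p = 0" "G q = 0" and "integrable lborel F" "\<And>t. t \<notin> {p..q} \<Longrightarrow> F t = 0"
  shows "(LINT t|lborel. F t) = 0"
proof -
  have "(F has_integral (G q - G p)) {p..q}"
    by (rule fundamental_theorem_of_calculus_interior_strong[OF assms(1,2,3,4)])
  then have "(F has_integral 0) UNIV"
    using assms(5,6) has_integral_on_superset[of F 0 "{p..q}" UNIV] assms(8) by simp
  with has_integral_integral_lborel[OF assms(7)] show ?thesis by (rule has_integral_unique)
qed

lemma test_fun_derivative_line:
  assumes "test_fun L \<phi>"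
  shows "((\<lambda>x. \<phi> (x, y)) has_vector_derivative dirD (1, 0) \<phi> (x, y)) (at x)"
    "((\<lambda>y. \<phi> (x, y)) has_vector_derivative dirD (0, 1) \<phi> (x, y)) (at y)"
proof -
  have D: "(\<phi> has_derivative frechet_derivative \<phi> (at z)) (at z)" for z
    using test_fun_differentiable[OF assms] frechet_derivative_works by blast
  have lin: "linear (frechet_derivative \<phi> (at z))" for z using D has_derivative_linear by blast
  have "((\<lambda>x. (x, y)) has_derivative (\<lambda>h. (h, 0))) (at x)" by (auto intro!: derivative_eq_intros)
  from diff_chain_at[OF this, of \<phi>, OF D] 
  have 1: "((\<lambda>x. \<phi> (x, y)) has_derivative (\<lambda>h. frechet_derivative \<phi> (at (x, y)) (h, 0))) (at x)" by (simp add: comp_def)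
  have "frechet_derivative \<phi> (at (x, y)) (h, 0) = h *\<^sub>R dirD (1, 0) \<phi> (x, y)" for h
    using linear_scale[OF lin, of "(x, y)" h "(1, 0)"] by simp
  then show "((\<lambda>x. \<phi> (x, y)) has_vector_derivative dirD (1, 0) \<phi> (x, y)) (at x)"
    unfolding has_vector_derivative_def by (intro has_derivative_eq_rhs[OF 1] ext)
  have "((\<lambda>y. (x, y)) has_derivative (\<lambda>h. (0, h))) (at y)" by (auto intro!: derivative_eq_intros)
  from diff_chain_at[OF this, of \<phi>, OF D] 
  have 2: "((\<lambda>y. \<phi> (x, y)) has_derivative (\<lambda>h. frechet_derivative \<phi> (at (x, y)) (0, h))) (at y)" by (simp add: comp_def)
  have "frechet_derivative \<phi> (at (x, y)) (0, h) = h *\<^sub>R dirD (0, 1) \<phi> (x, y)" for h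
    using linear_scale[OF lin, of "(x, y)" h "(0, 1)"] by simp
  then show "((\<lambda>y. \<phi> (x, y)) has_vector_derivative dirD (0, 1) \<phi> (x, y)) (at y)"
    unfolding has_vector_derivative_def by (intro has_derivative_eq_rhs[OF 2] ext)
qed

text \<open>Integration by parts on horizontal lines and Fubini's theorem. The finite set
  \<open>S\<close> admits the corner of the ground state at \<open>x = 0\<close>.\<close>

lemma wder_fst_of_derivative:
  assumes u: "L2_fun lborel u" "\<And>z. z \<notin> strip L \<Longrightarrow> u z = 0" and a: "L2_fun lborel a" "\<And>z. z \<notin> strip L \<Longrightarrow> a z = 0"
    and S: "finite S" and c: "\<And>y. y \<in> {0..L} \<Longrightarrow> continuous_on UNIV (\<lambda>x. u (x, y))"
    and d: "\<And>x y. y \<in> {0..L} \<Longrightarrow> x \<notin> S \<Longrightarrow> ((\<lambda>x. u (x, y)) has_vector_derivative a (x, y)) (at x)"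
  shows "wder L (1, 0) u a"
  unfolding wder_def
proof (intro allI impI)
  fix \<phi> assume \<phi>: "test_fun L \<phi>"
  obtain R where R: "\<And>z. \<not> (norm z \<le> R \<and> 0 < snd z \<and> snd z < L) \<Longrightarrow> \<phi> z = 0 \<and> dirD (1, 0) \<phi> z = 0"
    using test_fun_support[OF \<phi>, of "(1, 0)"] by blast
  define F where "F x y = \<phi> (x, y) *\<^sub>R a (x, y) + dirD (1, 0) \<phi> (x, y) *\<^sub>R u (x, y)" for x y
  note int = test_fun_integrable(1)[OF \<phi> a(1)] test_fun_integrable(2)[OF \<phi> u(1), of "(1, 0)"]
  have Fint: "integrable (lborel \<Otimes>\<^sub>M lborel) (case_prod F)"
    using Bochner_Integration.integrable_add[OF int] unfolding lborel_prod
    by (simp add: F_def case_prod_beta')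
  have "AE y in lborel. (LINT x|lborel. F x y) = 0"
    using lborel_pair.AE_integrable_snd[OF Fint]
  proof eventually_elim
    case (elim y)
    show ?case
    proof (cases "y \<in> {0..L}")
      case False
      then have "F x y = 0" for x using u(2)[of "(x, y)"] a(2)[of "(x, y)"] by (simp add: F_def strip_def)
      then show ?thesis by simp
    next
      case True
      define p where "p = max R 0 + 1"
      have out: "\<phi> (x, y) = 0 \<and> dirD (1, 0) \<phi> (x, y) = 0" if "\<bar>x\<bar> \<ge> p" for x
      proof -
        have "\<bar>x\<bar> \<le> norm (x, y)" using norm_fst_le[of x y] by simp
        then show ?thesis using that by (intro R) (auto simp: p_def)
      qed
      show ?thesis
      proof (rule integral_derivative_zero[where G = "\<lambda>x. \<phi> (x, y) *\<^sub>R u (x, y)" and S = S and p = "- p" and q = p])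
        show "((\<lambda>x. \<phi> (x, y) *\<^sub>R u (x, y)) has_vector_derivative F t y) (at t)" if "t \<in> {- p<..<p} - S" for t
          unfolding F_def
          using has_vector_derivative_scaleR[OF test_fun_derivative_line(1)[OF \<phi>, of y t, folded has_real_derivative_iff_has_vector_derivative] d[OF True, of t]] that
          by auto
        show "continuous_on {- p..p} (\<lambda>x. \<phi> (x, y) *\<^sub>R u (x, y))"
          by (intro continuous_on_scaleR continuous_on_subset[OF c[OF True]]
              continuous_on_compose2[OF test_fun_continuous(1)[OF \<phi>]] continuous_on_Pair continuous_on_id continuous_on_const) auto
        show "F t y = 0" if "t \<notin> {- p..p}" for t
          using out[of t] that by (auto simp: F_def)
        show "\<phi> (- p, y) *\<^sub>R u (- p, y) = 0" "\<phi> (p, y) *\<^sub>R u (p, y) = 0"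
          using out[of "- p"] out[of p] by auto
      qed (use S elim in \<open>auto simp: p_def\<close>)
    qed
  qed
  then have "(LINT y|lborel. LINT x|lborel. F x y) = (LINT y|(lborel :: real measure). 0)"
    by (intro integral_cong_AE) (use borel_measurable_integrable[OF lborel_pair.integrable_snd[OF Fint]] in auto)
  then have "(LINT z|lborel. case_prod F z) = 0"
    unfolding lborel_pair.integral_snd[OF Fint] lborel_prod by simp
  then have "(LINT z|lborel. \<phi> z *\<^sub>R a z) + (LINT z|lborel. dirD (1, 0) \<phi> z *\<^sub>R u z) = 0"
    unfolding Bochner_Integration.integral_add[OF int, symmetric] by (simp add: F_def case_prod_beta')
  then show "(LINT z|lborel. dirD (1, 0) \<phi> z *\<^sub>R u z) = - (LINT z|lborel. \<phi> z *\<^sub>R a z)"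
    by (simp add: add_eq_0_iff)
qed

text \<open>The test function vanishes at both ends of the vertical segments, so \<open>u\<close> is
  subject to no boundary condition at \<open>y = 0\<close> and \<open>y = L\<close>.\<close>

lemma wder_snd_of_derivative:
  assumes u: "L2_fun lborel u" "\<And>z. z \<notin> strip L \<Longrightarrow> u z = 0" and a: "L2_fun lborel a" "\<And>z. z \<notin> strip L \<Longrightarrow> a z = 0"
    and L: "L > 0" and c: "\<And>x. continuous_on {0..L} (\<lambda>y. u (x, y))"
    and d: "\<And>x y. y \<in> {0<..<L} \<Longrightarrow> ((\<lambda>y. u (x, y)) has_vector_derivative a (x, y)) (at y)"
  shows "wder L (0, 1) u a"
  unfolding wder_def
proof (intro allI impI)
  fix \<phi> assume \<phi>: "test_fun L \<phi>"
  obtain R where R: "\<And>z. \<not> (norm z \<le> R \<and> 0 < snd z \<and> snd z < L) \<Longrightarrow> \<phi> z = 0 \<and> dirD (0, 1) \<phi> z = 0"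
    using test_fun_support[OF \<phi>, of "(0, 1)"] by blast
  define F where "F x y = \<phi> (x, y) *\<^sub>R a (x, y) + dirD (0, 1) \<phi> (x, y) *\<^sub>R u (x, y)" for x y
  note int = test_fun_integrable(1)[OF \<phi> a(1)] test_fun_integrable(2)[OF \<phi> u(1), of "(0, 1)"]
  have Fint: "integrable (lborel \<Otimes>\<^sub>M lborel) (case_prod F)"
    using Bochner_Integration.integrable_add[OF int] unfolding lborel_prod
    by (simp add: F_def case_prod_beta')
  have "AE x in lborel. (LINT y|lborel. F x y) = 0"
    using lborel_pair.AE_integrable_fst[OF Fint]
  proof eventually_elim
    case (elim x)
    have out: "\<phi> (x, y) = 0 \<and> dirD (0, 1) \<phi> (x, y) = 0" if "\<not> (0 < y \<and> y < L)" for y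
      using R[of "(x, y)"] that by simp
    show ?case
    proof (rule integral_derivative_zero[where G = "\<lambda>y. \<phi> (x, y) *\<^sub>R u (x, y)" and S = "{}" and p = 0 and q = L])
      show "((\<lambda>y. \<phi> (x, y) *\<^sub>R u (x, y)) has_vector_derivative F x t) (at t)" if "t \<in> {0<..<L} - {}" for t
        unfolding F_def
        using has_vector_derivative_scaleR[OF test_fun_derivative_line(2)[OF \<phi>, of x t, folded has_real_derivative_iff_has_vector_derivative] d[of t x]] that
        by auto
      show "continuous_on {0..L} (\<lambda>y. \<phi> (x, y) *\<^sub>R u (x, y))"
        by (intro continuous_on_scaleR c
            continuous_on_compose2[OF test_fun_continuous(1)[OF \<phi>]] continuous_on_Pair continuous_on_id continuous_on_const) auto
      show "F x t = 0" if "t \<notin> {0..L}" for t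
        using out[of t] that by (auto simp: F_def)
      show "\<phi> (x, 0) *\<^sub>R u (x, 0) = 0" "\<phi> (x, L) *\<^sub>R u (x, L) = 0"
        using out[of 0] out[of L] by auto
    qed (use L elim in auto)
  qed
  then have "(LINT x|lborel. LINT y|lborel. F x y) = (LINT x|(lborel :: real measure). 0)"
    by (intro integral_cong_AE) (use borel_measurable_integrable[OF lborel_pair.integrable_fst[OF Fint]] in auto)
  then have "(LINT z|lborel. case_prod F z) = 0"
    unfolding lborel_pair.integral_fst[OF Fint] lborel_prod by simp
  then have "(LINT z|lborel. \<phi> z *\<^sub>R a z) + (LINT z|lborel. dirD (0, 1) \<phi> z *\<^sub>R u z) = 0"
    unfolding Bochner_Integration.integral_add[OF int, symmetric] by (simp add: F_def case_prod_beta')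
  then show "(LINT z|lborel. dirD (0, 1) \<phi> z *\<^sub>R u z) = - (LINT z|lborel. \<phi> z *\<^sub>R a z)"
    by (simp add: add_eq_0_iff)
qed

text \<open>Carries the weak derivatives as arguments, which keeps the choice operator of
  \<open>weak_deriv\<close> out of all later estimates.\<close>

definition H1b :: "real \<Rightarrow> (real \<times> real \<Rightarrow> complex) \<Rightarrow> (real \<times> real \<Rightarrow> complex) \<Rightarrow> (real \<times> real \<Rightarrow> complex) \<Rightarrow> bool" where
  "H1b L u a b \<longleftrightarrow> L2_fun lborel u \<and> L2_fun lborel a \<and> L2_fun lborel b \<and>
     (\<forall>z. z \<notin> strip L \<longrightarrow> u z = 0 \<and> a z = 0 \<and> b z = 0) \<and> wder L (1, 0) u a \<and> wder L (0, 1) u b"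

lemma H1_imp_H1b:
  assumes "u \<in> H1 L"
  shows "\<exists>u' a b. H1b L u' a b \<and> rep L u u'"
proof -
  have u: "L2_fun (lebesgue_on (strip L)) u" using assms by (simp add: H1_def)
  obtain v w where vw: "has_weak_deriv L (1, 0) u v" "has_weak_deriv L (0, 1) u w" using assms by (auto simp: H1_def)
  then have L2: "L2_fun (lebesgue_on (strip L)) v" "L2_fun (lebesgue_on (strip L)) w" by (auto simp: has_weak_deriv_def)
  obtain u' where u': "rep L u u'" using rep_exists[OF u] by blast
  obtain a where a: "rep L v a" using rep_exists[OF L2(1)] by blast
  obtain b where b: "rep L w b" using rep_exists[OF L2(2)] by blast
  have "wder L (1, 0) u' a" "wder L (0, 1) u' b"
    using has_weak_deriv_rep[OF u' a L2_fun_measurable[OF u] L2(1)] has_weak_deriv_rep[OF u' b L2_fun_measurable[OF u] L2(2)] vw by auto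
  then have "H1b L u' a b" using u' a b by (auto simp: H1b_def rep_def)
  then show ?thesis using u' by blast
qed

lemma rep_self: "L2_fun lborel a \<Longrightarrow> (\<And>z. z \<notin> strip L \<Longrightarrow> a z = 0) \<Longrightarrow> rep L a a"
  by (simp add: rep_def)

text \<open>\<open>weak_deriv\<close> is an arbitrary choice among the weak derivatives. By
  \<open>wder_unique\<close> a Borel representative of it agrees with \<open>a\<close> almost
  everywhere, so its norm is that of \<open>a\<close>.\<close>

lemma weak_deriv_rep:
  assumes L: "L > 0" and u: "L2_fun (lebesgue_on (strip L)) u" and r: "rep L u u'"
    and a: "L2_fun lborel a" "\<And>z. z \<notin> strip L \<Longrightarrow> a z = 0" and w: "wder L e u' a"
  shows "has_weak_deriv L e u a" "L2_fun (lebesgue_on (strip L)) (weak_deriv L e u)"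
    "mass L (weak_deriv L e u) = (LINT z|lborel. (cmod (a z))\<^sup>2)"
proof -
  show hw: "has_weak_deriv L e u a"
    using has_weak_deriv_rep[OF r rep_self[OF a] L2_fun_measurable[OF u]] w L2_fun_lebesgue_on[OF a(1) strip_borel] by simp
  define v where "v = weak_deriv L e u"
  have v: "has_weak_deriv L e u v" unfolding v_def weak_deriv_def by (rule someI[of "has_weak_deriv L e u", OF hw])
  then have vL2: "L2_fun (lebesgue_on (strip L)) v" by (simp add: has_weak_deriv_def)
  then show "L2_fun (lebesgue_on (strip L)) (weak_deriv L e u)" by (simp add: v_def)
  obtain v' where v': "rep L v v'" using rep_exists[OF vL2] by blast
  then have v'L2: "L2_fun lborel v'" "\<And>z. z \<notin> strip L \<Longrightarrow> v' z = 0" by (auto simp: rep_def)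
  have "wder L e u' v'" using has_weak_deriv_rep[OF r v' L2_fun_measurable[OF u] vL2] v by simp
  then have ae: "AE z in lborel. v' z = a z" by (rule wder_unique[OF L _ w v'L2 a])
  note [measurable] = L2_fun_measurable[OF v'L2(1)] L2_fun_measurable[OF a(1)]
  have "mass L v = (LINT z|lborel. (cmod (v' z))\<^sup>2)" by (rule rep_mass[OF v' L2_fun_measurable[OF vL2]])
  also have "\<dots> = (LINT z|lborel. (cmod (a z))\<^sup>2)"
    by (rule integral_cong_AE) (measurable, use ae in \<open>auto elim: AE_mp\<close>)
  finally show "mass L (weak_deriv L e u) = (LINT z|lborel. (cmod (a z))\<^sup>2)" by (simp add: v_def)
qed

lemma H1b_imp_H1:
  assumes L: "L > 0" and h: "H1b L u' a b" and r: "rep L u u'" and u: "L2_fun (lebesgue_on (strip L)) u"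
  shows "u \<in> H1 L" "mass L u = (LINT z|lborel. (cmod (u' z))\<^sup>2)"
    "grad_norm_sq L u = (LINT z|lborel. (cmod (a z))\<^sup>2) + (LINT z|lborel. (cmod (b z))\<^sup>2)"
proof -
  have a: "L2_fun lborel a" "\<And>z. z \<notin> strip L \<Longrightarrow> a z = 0" "wder L (1, 0) u' a"
    and b: "L2_fun lborel b" "\<And>z. z \<notin> strip L \<Longrightarrow> b z = 0" "wder L (0, 1) u' b"
    using h by (auto simp: H1b_def)
  note A = weak_deriv_rep[OF L u r a] and B = weak_deriv_rep[OF L u r b]
  show "u \<in> H1 L" unfolding H1_def using u A(1) B(1) by blast
  show "mass L u = (LINT z|lborel. (cmod (u' z))\<^sup>2)" by (rule rep_mass[OF r L2_fun_measurable[OF u]])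
  have "grad_norm_sq L u = mass L (weak_deriv L (1, 0) u) + mass L (weak_deriv L (0, 1) u)"
    unfolding grad_norm_sq_def mass_def
    by (rule Bochner_Integration.integral_add) (use A(2) B(2) L2_fun_integrable in blast)+
  then show "grad_norm_sq L u = (LINT z|lborel. (cmod (a z))\<^sup>2) + (LINT z|lborel. (cmod (b z))\<^sup>2)"
    using A(3) B(3) by simp
qed

lemma H1b_diff:
  assumes "H1b L u a b" "H1b L v c d"
  shows "H1b L (\<lambda>z. u z - v z) (\<lambda>z. a z - c z) (\<lambda>z. b z - d z)"
  using assms unfolding H1b_def by (auto intro: L2_fun_diff wder_diff)

lemma rep_diff:
  assumes "rep L u u'" "rep L v v'"
  shows "rep L (\<lambda>z. u z - v z) (\<lambda>z. u' z - v' z)"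
proof -
  have "AE z in lebesgue_on (strip L). u z = u' z" "AE z in lebesgue_on (strip L). v z = v' z"
    using assms by (auto simp: rep_def)
  then have "AE z in lebesgue_on (strip L). u z - v z = u' z - v' z" by eventually_elim simp
  then show ?thesis using assms L2_fun_diff unfolding rep_def by auto
qed

section \<open>Traces\<close>

lemma L2_fun_scaleR:
  assumes "L2_fun M f" shows "L2_fun M (\<lambda>z. c *\<^sub>R f z)"
proof -
  note [measurable] = L2_fun_measurable[OF assms]
  show ?thesis using L2_fun_integrable[OF assms] unfolding L2_fun_def by (simp add: power_mult_distrib)
qed

lemma L2_tendsto_AE_subseq:
  assumes f: "\<And>n. L2_fun M (f n)" and lim: "(\<lambda>n. LINT z|M. (cmod (f n z))\<^sup>2) \<longlonglongrightarrow> 0"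
  shows "\<exists>r::nat\<Rightarrow>nat. strict_mono r \<and> (AE z in M. (\<lambda>n. f (r n) z) \<longlonglongrightarrow> 0)"
proof -
  have "\<exists>r::nat\<Rightarrow>nat. strict_mono r \<and> (AE z in M. (\<lambda>n. (cmod (f (r n) z))\<^sup>2) \<longlonglongrightarrow> 0)"
    by (rule tendsto_L1_AE_subseq) (use f L2_fun_integrable lim in auto)
  then obtain r where r: "strict_mono r" "AE z in M. (\<lambda>n. (cmod (f (r n) z))\<^sup>2) \<longlonglongrightarrow> 0" by blast
  from r(2) have "AE z in M. (\<lambda>n. f (r n) z) \<longlonglongrightarrow> 0"
  proof eventually_elim
    case (elim z)
    then have "(\<lambda>n. sqrt ((cmod (f (r n) z))\<^sup>2)) \<longlonglongrightarrow> sqrt 0" by (rule tendsto_real_sqrt)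
    then show ?case by (simp add: tendsto_norm_zero_iff)
  qed
  then show ?thesis using r(1) by blast
qed

section \<open>Approximation by functions that are smooth up to the boundary\<close>

definition restr :: "real \<Rightarrow> (real \<times> real \<Rightarrow> complex) \<Rightarrow> real \<times> real \<Rightarrow> complex" where
  "restr L f z = indicator (strip L) z *\<^sub>R f z"

lemma restr_simps [simp]: "z \<in> strip L \<Longrightarrow> restr L f z = f z" "z \<notin> strip L \<Longrightarrow> restr L f z = 0"
  by (simp_all add: restr_def)

lemma restr_measurable: "f \<in> borel_measurable borel \<Longrightarrow> restr L f \<in> borel_measurable borel"
  unfolding restr_def[abs_def] by measurable

lemma restr_L2:
  assumes "L2_fun lborel f"
  shows "L2_fun lborel (restr L f)"
proof -
  have "f \<in> borel_measurable borel" using L2_fun_measurable[OF assms] by simp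
  then have [measurable]: "restr L f \<in> borel_measurable borel" by (rule restr_measurable)
  have "integrable lborel (\<lambda>z. (cmod (restr L f z))\<^sup>2)"
    by (rule Bochner_Integration.integrable_bound[OF L2_fun_integrable[OF assms]], measurable)
       (auto simp: restr_def indicator_def)
  then show ?thesis by (simp add: L2_fun_def)
qed

lemma mass_restr:
  assumes f: "f \<in> borel_measurable borel" and w: "w \<in> borel_measurable borel" "\<And>z. z \<notin> strip L \<Longrightarrow> w z = 0"
  shows "(LINT z|lborel. (cmod (restr L f z - w z))\<^sup>2) = mass L (\<lambda>z. f z - w z)"
proof -
  have "mass L (\<lambda>z. f z - w z) = (LINT z|lborel. indicator (strip L) z * (cmod (f z - w z))\<^sup>2)"
    using f w by (intro mass_lborel) measurable
  also have "\<dots> = (LINT z|lborel. (cmod (restr L f z - w z))\<^sup>2)"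
    by (rule Bochner_Integration.integral_cong) (use w in \<open>auto simp: restr_def indicator_def\<close>)
  finally show ?thesis by simp
qed

text \<open>The mollifications \<open>v n\<close> are smooth up to the boundary of the strip; \<open>a' n\<close> and \<open>b' n\<close>
  are their classical derivatives.\<close>
definition approx :: "real \<Rightarrow> (real \<times> real \<Rightarrow> complex) \<Rightarrow> (real \<times> real \<Rightarrow> complex) \<Rightarrow> (real \<times> real \<Rightarrow> complex) \<Rightarrow>
    (nat \<Rightarrow> real \<times> real \<Rightarrow> complex) \<Rightarrow> (nat \<Rightarrow> real \<times> real \<Rightarrow> complex) \<Rightarrow> (nat \<Rightarrow> real \<times> real \<Rightarrow> complex) \<Rightarrow> bool" where
  "approx L u a b v a' b' \<longleftrightarrow>
     (\<forall>n. L2_fun lborel (v n) \<and> L2_fun lborel (a' n) \<and> L2_fun lborel (b' n)) \<and>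
     (\<forall>n. continuous_on UNIV (v n) \<and> continuous_on UNIV (a' n) \<and> continuous_on UNIV (b' n)) \<and>
     (\<forall>n. \<forall>x. \<forall>y\<in>{0..L}. ((\<lambda>x. v n (x, y)) has_vector_derivative a' n (x, y)) (at x)) \<and>
     (\<forall>n. \<forall>x. \<forall>y\<in>{0..L}. ((\<lambda>y. v n (x, y)) has_vector_derivative b' n (x, y)) (at y)) \<and>
     (\<lambda>n. mass L (\<lambda>z. v n z - u z)) \<longlonglongrightarrow> 0 \<and> (\<lambda>n. mass L (\<lambda>z. a' n z - a z)) \<longlonglongrightarrow> 0 \<and>
     (\<lambda>n. mass L (\<lambda>z. b' n z - b z)) \<longlonglongrightarrow> 0 \<and>
     (continuous_on (strip L) u \<longrightarrow> (\<forall>z\<in>strip L. (\<lambda>n. v n z) \<longlonglongrightarrow> u z)) \<and>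
     ((AE z in lborel. b z = 0) \<longrightarrow> (\<forall>n z. b' n z = 0))"

lemma approx_exists:
  assumes L: "L > 0" and h: "H1b L u a b"
  shows "\<exists>v a' b'. approx L u a b v a' b'"
proof -
  have u: "L2_fun lborel u" and a: "L2_fun lborel a" and b: "L2_fun lborel b"
    and wa: "wder L (1, 0) u a" and wb: "wder L (0, 1) u b" using h by (auto simp: H1b_def)
  obtain \<rho> \<rho>' where m: "\<And>n. mollifier (steps L n) (\<rho> n) (\<rho>' n)" using mollifiers_exist[OF L] by blast
  note st = steps[OF L]
  define M where "M n = moll L (steps L n) (\<rho> n)" for n
  define c where "c n = 4 * steps L n / L" for n
  define b' where "b' n z = (1 - c n) *\<^sub>R M n b z" for n z
  have ML2: "L2_fun lborel (M n f)" if "L2_fun lborel f" for n f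
    unfolding M_def by (rule moll_L2(1)[OF m that st(1,2)])
  have Mc: "continuous_on UNIV (M n f)" if "L2_fun lborel f" for n f
    unfolding M_def by (rule moll_continuous[OF m that])
  have "(\<lambda>n. 4 * steps L n / L) \<longlonglongrightarrow> 4 * 0 / L"
    by (intro tendsto_divide tendsto_mult tendsto_const st(3)) (use L in auto)
  then have c: "c \<longlonglongrightarrow> 0" by (simp add: c_def[abs_def])
  have lim: "(\<lambda>n. mass L (\<lambda>z. M n f z - f z)) \<longlonglongrightarrow> 0" if "L2_fun lborel f" for f
    unfolding M_def by (rule moll_tendsto[OF that m st])
  \<comment> \<open>The factor \<open>1 - c n\<close> in the vertical derivative costs an error of
    norm proportional to \<open>c n\<close>, because mollification is bounded uniformly in
    \<open>n\<close>.\<close>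
  have b'_lim: "(\<lambda>n. mass L (\<lambda>z. b' n z - b z)) \<longlonglongrightarrow> 0"
  proof -
    let ?B = "LINT z|lborel. (cmod (b z))\<^sup>2"
    have "mass L (\<lambda>z. b' n z - b z) \<le> 2 * ((c n)\<^sup>2 * (2 * ?B)) + 2 * mass L (\<lambda>z. M n b z - b z)" for n
    proof -
      have "mass L (\<lambda>z. b' n z - b z) \<le> 2 * mass L (\<lambda>z. b' n z - M n b z) + 2 * mass L (\<lambda>z. M n b z - b z)"
        unfolding b'_def by (intro mass_diff_le L2_fun_scaleR ML2 b)
      moreover have "mass L (\<lambda>z. b' n z - M n b z) = mass L (\<lambda>z. c n *\<^sub>R M n b z)"
        unfolding mass_def b'_def
        by (rule Bochner_Integration.integral_cong) (simp_all add: scaleR_diff_left norm_minus_commute power_mult_distrib)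
      moreover have "mass L (\<lambda>z. c n *\<^sub>R M n b z) \<le> (LINT z|lborel. (cmod (c n *\<^sub>R M n b z))\<^sup>2)"
        by (intro mass_le L2_fun_scaleR ML2 b)
      moreover have "(LINT z|lborel. (cmod (c n *\<^sub>R M n b z))\<^sup>2) = (c n)\<^sup>2 * (LINT z|lborel. (cmod (M n b z))\<^sup>2)"
        by (simp add: power_mult_distrib)
      moreover have "(c n)\<^sup>2 * (LINT z|lborel. (cmod (M n b z))\<^sup>2) \<le> (c n)\<^sup>2 * (2 * ?B)"
        unfolding M_def by (intro mult_left_mono moll_L2(2)[OF m b st(1,2)]) auto
      ultimately show ?thesis by linarith
    qed
    moreover have "(\<lambda>n. 2 * ((c n)\<^sup>2 * (2 * ?B)) + 2 * mass L (\<lambda>z. M n b z - b z)) \<longlonglongrightarrow> 2 * (0\<^sup>2 * (2 * ?B)) + 2 * 0"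
      by (intro tendsto_intros c lim b)
    ultimately show ?thesis
      by (intro tendsto_sandwich[OF _ _ tendsto_const, of 0 "\<lambda>n. mass L (\<lambda>z. b' n z - b z)" sequentially
          "\<lambda>n. 2 * ((c n)\<^sup>2 * (2 * ?B)) + 2 * mass L (\<lambda>z. M n b z - b z)"])
         (auto simp: mass_nonneg)
  qed
  have "approx L u a b (\<lambda>n. M n u) (\<lambda>n. M n a) b'"
    unfolding approx_def
  proof (intro conjI allI impI ballI)
    fix n show "L2_fun lborel (M n u)" "L2_fun lborel (M n a)" by (intro ML2 u a)+
    show "L2_fun lborel (b' n)" unfolding b'_def by (intro L2_fun_scaleR ML2 b)
    show "continuous_on UNIV (M n u)" "continuous_on UNIV (M n a)" by (intro Mc u a)+
    show "continuous_on UNIV (b' n)" unfolding b'_def by (intro continuous_on_scaleR continuous_on_const Mc b)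
  next
    fix n x y assume y: "y \<in> {0..L}"
    then have y: "0 \<le> y" "y \<le> L" by auto
    show "((\<lambda>x. M n u (x, y)) has_vector_derivative M n a (x, y)) (at x)"
      unfolding M_def by (rule moll_derivative_fst[OF m st(1,2) y u wa])
    show "((\<lambda>y. M n u (x, y)) has_vector_derivative b' n (x, y)) (at y)"
      unfolding M_def b'_def c_def by (rule moll_derivative_snd[OF m st(1,2) y u wb])
  next
    fix z assume "continuous_on (strip L) u" "z \<in> strip L"
    then show "(\<lambda>n. M n u z) \<longlonglongrightarrow> u z" unfolding M_def by (intro moll_tendsto_pointwise[OF u _ m st])
  next
    fix n z assume ae: "AE z in lborel. b z = 0"
    \<comment> \<open>A convolution does not see null sets: if \<open>b\<close> vanishes almost
      everywhere, the vertical derivatives of the approximations vanish everywhere.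
      \<open>indep_of_y_of_weak_deriv\<close> rests on this.\<close>
    have "conv \<alpha> \<beta> b z = 0" for \<alpha> \<beta> z
      unfolding conv_def by (rule integral_eq_zero_AE) (use ae in \<open>auto elim: AE_mp\<close>)
    then show "b' n z = 0" by (simp add: b'_def M_def moll_def)
  qed (use lim u a b'_lim in auto)
  then show ?thesis by blast
qed

lemma approx_H1b:
  assumes L: "L > 0" and ap: "approx L u a b v a' b'"
  shows "H1b L (restr L (v n)) (restr L (a' n)) (restr L (b' n))"
proof -
  have L2: "L2_fun lborel (v n)" "L2_fun lborel (a' n)" "L2_fun lborel (b' n)"
    and c: "continuous_on UNIV (v n)"
    and d: "\<And>x y. y \<in> {0..L} \<Longrightarrow> ((\<lambda>x. v n (x, y)) has_vector_derivative a' n (x, y)) (at x)"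
    "\<And>x y. y \<in> {0..L} \<Longrightarrow> ((\<lambda>y. v n (x, y)) has_vector_derivative b' n (x, y)) (at y)"
    using ap unfolding approx_def by blast+
  have mem: "(x, y) \<in> strip L \<longleftrightarrow> y \<in> {0..L}" for x y by (auto simp: strip_def)
  have "wder L (1, 0) (restr L (v n)) (restr L (a' n))"
  proof (rule wder_fst_of_derivative[where S = "{}"])
    fix y assume y: "y \<in> {0..L}"
    then have e: "restr L f (x, y) = f (x, y)" for f x using mem by simp
    show "continuous_on UNIV (\<lambda>x. restr L (v n) (x, y))"
      unfolding e by (intro continuous_on_compose2[OF c] continuous_on_Pair continuous_on_id continuous_on_const) auto
    show "((\<lambda>x. restr L (v n) (x, y)) has_vector_derivative restr L (a' n) (x, y)) (at x)" for x
      unfolding e by (rule d(1)[OF y])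
  qed (use L2 restr_L2 in auto)
  moreover have "wder L (0, 1) (restr L (v n)) (restr L (b' n))"
  proof (rule wder_snd_of_derivative)
    fix x
    show "continuous_on {0..L} (\<lambda>y. restr L (v n) (x, y))"
    proof (rule continuous_on_eq)
      show "continuous_on {0..L} (\<lambda>y. v n (x, y))"
        by (intro continuous_on_compose2[OF c] continuous_on_Pair continuous_on_id continuous_on_const) auto
    qed (use mem in auto)
    show "((\<lambda>y. restr L (v n) (x, y)) has_vector_derivative restr L (b' n) (x, y)) (at y)" if y: "y \<in> {0<..<L}" for y
    proof (rule has_vector_derivative_transform_within_open[of "\<lambda>y. v n (x, y)" _ _ "{0<..<L}"])
      have y': "y \<in> {0..L}" using y by auto
      show "((\<lambda>y. v n (x, y)) has_vector_derivative restr L (b' n) (x, y)) (at y)"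
        using d(2)[OF y', of x] y' mem by simp
    qed (use y mem in auto)
  qed (use L2 restr_L2 L in auto)
  ultimately show ?thesis
    using L2 restr_L2 by (auto simp: H1b_def)
qed

text \<open>An explicit formula for the trace on \<open>{x = 0}\<close> of a function \<open>u\<close> with weak derivative \<open>a\<close> in \<open>x\<close>;
  it spares the completeness of \<open>L\<^sup>2\<close>.\<close>
definition trc :: "(real \<times> real \<Rightarrow> complex) \<Rightarrow> (real \<times> real \<Rightarrow> complex) \<Rightarrow> real \<Rightarrow> complex" where
  "trc u a y = (LINT x|lborel. indicator {0..1} x *\<^sub>R (u (x, y) - (1 - x) *\<^sub>R a (x, y)))"

text \<open>Integrate the derivative of \<open>(1 - x) v\<close> over \<open>[0, 1]\<close>.\<close>
lemma trc_of_derivative: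
  assumes d: "\<And>x. ((\<lambda>x. v (x, y)) has_vector_derivative a (x, y)) (at x)"
    and a: "continuous_on UNIV (\<lambda>x. a (x, y))"
  shows "trc v a y = v (0, y)"
proof -
  have cv: "continuous_on UNIV (\<lambda>x. v (x, y))"
    using d by (intro continuous_at_imp_continuous_on) (auto intro: has_vector_derivative_continuous)
  let ?F = "\<lambda>x. - ((1 - x) *\<^sub>R v (x, y))"
  have "(LINT x|lborel. indicator {0..1} x *\<^sub>R (v (x, y) - (1 - x) *\<^sub>R a (x, y))) = ?F 1 - ?F 0"
  proof (rule integral_FTC_Icc)
    fix x :: real
    have "((\<lambda>x. 1 - x) has_real_derivative - 1) (at x)" by (auto intro!: derivative_eq_intros)
    from has_vector_derivative_minus[OF has_vector_derivative_scaleR[OF this d]]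
    have "(?F has_vector_derivative v (x, y) - (1 - x) *\<^sub>R a (x, y)) (at x)" by simp
    then show "(?F has_vector_derivative v (x, y) - (1 - x) *\<^sub>R a (x, y)) (at x within {0..1})"
      by (rule has_vector_derivative_at_within)
    show "continuous_on {0..1} (\<lambda>x. v (x, y) - (1 - x) *\<^sub>R a (x, y))"
      by (intro continuous_on_diff continuous_on_scaleR continuous_on_const continuous_on_id
          continuous_on_subset[OF cv] continuous_on_subset[OF a]) auto
  qed auto
  then show ?thesis by (simp add: trc_def)
qed

lemma slice_measurable:
  fixes u :: "real \<times> real \<Rightarrow> 'b::topological_space"
  assumes "u \<in> borel_measurable borel"
  shows "(\<lambda>x. u (x, y)) \<in> borel_measurable borel" "(\<lambda>y. u (x, y)) \<in> borel_measurable borel"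
    "u \<in> borel_measurable (lborel \<Otimes>\<^sub>M lborel)"
proof -
  show m: "u \<in> borel_measurable (lborel \<Otimes>\<^sub>M lborel)" using assms unfolding lborel_prod by simp
  show "(\<lambda>x. u (x, y)) \<in> borel_measurable borel" "(\<lambda>y. u (x, y)) \<in> borel_measurable borel"
    using measurable_Pair1[OF m, of y] measurable_Pair2[OF m, of x] by simp_all
qed

text \<open>Jensen's inequality with the indicator of \<open>{0..1}\<close> as weight, where
  \<open>1 - x\<close> is at most 1. Integrated over \<open>y\<close> it becomes the trace
  inequality \<open>trc_L2\<close>.\<close>

lemma trc_sq_le:
  assumes u: "u \<in> borel_measurable borel" and a: "a \<in> borel_measurable borel"
  shows "ennreal ((cmod (trc u a y))\<^sup>2) \<le> (\<integral>\<^sup>+x. ennreal (2 * (cmod (u (x, y)))\<^sup>2 + 2 * (cmod (a (x, y)))\<^sup>2) \<partial>lborel)"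
proof -
  note [measurable] = slice_measurable(1)[OF u] slice_measurable(1)[OF a]
  have "ennreal ((cmod (trc u a y))\<^sup>2) \<le> (\<integral>\<^sup>+x. ennreal (indicator {0..1} x * (cmod (u (x, y) - (1 - x) *\<^sub>R a (x, y)))\<^sup>2) \<partial>lborel)"
    unfolding trc_def by (rule weighted_mean_sq_le) auto
  also have "\<dots> \<le> (\<integral>\<^sup>+x. ennreal (2 * (cmod (u (x, y)))\<^sup>2 + 2 * (cmod (a (x, y)))\<^sup>2) \<partial>lborel)"
  proof (intro nn_integral_mono ennreal_leI)
    fix x :: real
    show "indicator {0..1} x * (cmod (u (x, y) - (1 - x) *\<^sub>R a (x, y)))\<^sup>2 \<le> 2 * (cmod (u (x, y)))\<^sup>2 + 2 * (cmod (a (x, y)))\<^sup>2"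
    proof (cases "x \<in> {0..1}")
      case True
      have "cmod ((1 - x) *\<^sub>R a (x, y)) \<le> cmod (a (x, y))" using True by (simp add: mult_left_le_one_le)
      then have "(cmod ((1 - x) *\<^sub>R a (x, y)))\<^sup>2 \<le> (cmod (a (x, y)))\<^sup>2" by (intro power_mono) auto
      moreover have "indicator {0..1} x * (cmod (u (x, y) - (1 - x) *\<^sub>R a (x, y)))\<^sup>2 = (cmod (u (x, y) - (1 - x) *\<^sub>R a (x, y)))\<^sup>2"
        using True by simp
      ultimately show ?thesis using cmod_diff_sq[of "u (x, y)" "(1 - x) *\<^sub>R a (x, y)"] by linarith
    qed simp
  qed
  finally show ?thesis .
qed

lemma trc_L2:
  assumes u: "L2_fun lborel u" and a: "L2_fun lborel a"
  shows "L2_fun lborel (trc u a)"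
    "(LINT y|lborel. (cmod (trc u a y))\<^sup>2) \<le> 2 * (LINT z|lborel. (cmod (u z))\<^sup>2) + 2 * (LINT z|lborel. (cmod (a z))\<^sup>2)"
proof -
  have um: "u \<in> borel_measurable borel" and am: "a \<in> borel_measurable borel"
    using u a by (auto simp: L2_fun_def)
  note [measurable] = slice_measurable(3)[OF um] slice_measurable(3)[OF am]
  have "trc u a \<in> borel_measurable lborel"
    unfolding trc_def[abs_def] by (rule lborel.borel_measurable_lebesgue_integral) measurable
  then have [measurable]: "trc u a \<in> borel_measurable borel" by simp
  let ?f = "\<lambda>z. 2 * (cmod (u z))\<^sup>2 + 2 * (cmod (a z))\<^sup>2"
  have int: "integrable lborel ?f" using L2_fun_integrable[OF u] L2_fun_integrable[OF a] by simp
  have "(\<integral>\<^sup>+y. ennreal ((cmod (trc u a y))\<^sup>2) \<partial>lborel) \<le> (\<integral>\<^sup>+y. \<integral>\<^sup>+x. ennreal (?f (x, y)) \<partial>lborel \<partial>lborel)"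
    using trc_sq_le[OF um am] by (intro nn_integral_mono) simp
  also have "\<dots> = (\<integral>\<^sup>+z. ennreal (?f z) \<partial>(lborel \<Otimes>\<^sub>M lborel))"
    by (rule lborel_pair.nn_integral_snd) measurable
  also have "\<dots> = ennreal (LINT z|lborel. ?f z)"
    unfolding lborel_prod using int by (intro nn_integral_eq_integral) auto
  finally have le: "(\<integral>\<^sup>+y. ennreal ((cmod (trc u a y))\<^sup>2) \<partial>lborel) \<le> ennreal (LINT z|lborel. ?f z)" .
  have int2: "integrable lborel (\<lambda>y. (cmod (trc u a y))\<^sup>2)"
    by (intro integrableI_bounded) (use le in \<open>auto simp: le_less_trans[OF _ ennreal_less_top]\<close>)
  then show "L2_fun lborel (trc u a)" by (simp add: L2_fun_def)
  have "ennreal (LINT y|lborel. (cmod (trc u a y))\<^sup>2) \<le> ennreal (LINT z|lborel. ?f z)"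
    using le int2 by (subst nn_integral_eq_integral[symmetric]) auto
  then have "(LINT y|lborel. (cmod (trc u a y))\<^sup>2) \<le> (LINT z|lborel. ?f z)"
    by (subst (asm) ennreal_le_iff) (auto intro!: Bochner_Integration.integral_nonneg)
  then show "(LINT y|lborel. (cmod (trc u a y))\<^sup>2) \<le> 2 * (LINT z|lborel. (cmod (u z))\<^sup>2) + 2 * (LINT z|lborel. (cmod (a z))\<^sup>2)"
    using L2_fun_integrable[OF u] L2_fun_integrable[OF a] by simp
qed

lemma slice_integrable_AE:
  fixes u :: "real \<times> real \<Rightarrow> complex"
  assumes u: "L2_fun lborel u"
  shows "AE y in lborel. integrable lborel (\<lambda>x. (cmod (u (x, y)))\<^sup>2)"
  using lborel_pair.AE_integrable_snd[of "\<lambda>x y. (cmod (u (x, y)))\<^sup>2"] L2_fun_integrable[OF u]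
  by (simp add: lborel_prod case_prod_beta')

lemma trc_integrable_AE:
  fixes u a :: "real \<times> real \<Rightarrow> complex"
  assumes u: "L2_fun lborel u" and a: "L2_fun lborel a"
  shows "AE y in lborel. integrable lborel (\<lambda>x. indicator {0..1} x *\<^sub>R (u (x, y) - (1 - x) *\<^sub>R a (x, y)))"
  using slice_integrable_AE[OF u] slice_integrable_AE[OF a]
proof eventually_elim
  case (elim y)
  have um: "u \<in> borel_measurable borel" and am: "a \<in> borel_measurable borel"
    using u a by (auto simp: L2_fun_def)
  note [measurable] = slice_measurable(1)[OF um] slice_measurable(1)[OF am]
  show ?case
  proof (rule Bochner_Integration.integrable_bound)
    show "integrable lborel (\<lambda>x. 2 * indicator {0..1::real} x + (cmod (u (x, y)))\<^sup>2 + (cmod (a (x, y)))\<^sup>2)"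
      using elim by (intro Bochner_Integration.integrable_add integrable_mult_right) auto
    have t: "t \<le> 1 + t\<^sup>2" for t :: real
      using zero_le_power2[of "t - 1/2"] by (simp add: power2_eq_square algebra_simps)
    have "norm (indicator {0..1} x *\<^sub>R (u (x, y) - (1 - x) *\<^sub>R a (x, y)))
        \<le> 2 * indicator {0..1} x + (cmod (u (x, y)))\<^sup>2 + (cmod (a (x, y)))\<^sup>2" for x
    proof (cases "x \<in> {0..1}")
      case True
      have "cmod ((1 - x) *\<^sub>R a (x, y)) \<le> cmod (a (x, y))" using True by (simp add: mult_left_le_one_le)
      then have "cmod (u (x, y) - (1 - x) *\<^sub>R a (x, y)) \<le> cmod (u (x, y)) + cmod (a (x, y))"
        using norm_triangle_ineq4[of "u (x, y)" "(1 - x) *\<^sub>R a (x, y)"] by linarith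
      then show ?thesis using True t[of "cmod (u (x, y))"] t[of "cmod (a (x, y))"] by simp
    qed simp
    then show "AE x in lborel. norm (indicator {0..1} x *\<^sub>R (u (x, y) - (1 - x) *\<^sub>R a (x, y)))
        \<le> norm (2 * indicator {0..1} x + (cmod (u (x, y)))\<^sup>2 + (cmod (a (x, y)))\<^sup>2)"
      by (intro AE_I2) (simp add: order_trans[OF _ abs_ge_self])
  qed measurable
qed

text \<open>Additivity can fail at heights where a slice is not integrable, since the integral then
  has the default value 0; by Fubini's theorem these heights form a null set.\<close>

lemma trc_diff_AE:
  assumes "L2_fun lborel u" "L2_fun lborel a" "L2_fun lborel v" "L2_fun lborel c"
  shows "AE y in lborel. trc (\<lambda>z. u z - v z) (\<lambda>z. a z - c z) y = trc u a y - trc v c y"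
  using trc_integrable_AE[OF assms(1,2)] trc_integrable_AE[OF assms(3,4)]
proof eventually_elim
  case (elim y)
  show ?case
    unfolding trc_def
    by (subst Bochner_Integration.integral_diff[OF elim, symmetric])
       (rule Bochner_Integration.integral_cong, auto simp: scaleR_diff_right)
qed

lemma trc_restr: "y \<in> {0..L} \<Longrightarrow> trc (restr L u) (restr L a) y = trc u a y"
  unfolding trc_def by (rule Bochner_Integration.integral_cong) (auto simp: restr_def strip_def)

lemma L2_norm_tendsto:
  assumes f: "\<And>n. L2_fun M (f n)" and g: "L2_fun M g" and lim: "(\<lambda>n. LINT z|M. (cmod (f n z - g z))\<^sup>2) \<longlonglongrightarrow> 0"
  shows "(\<lambda>n. LINT z|M. (cmod (f n z))\<^sup>2) \<longlonglongrightarrow> (LINT z|M. (cmod (g z))\<^sup>2)"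
proof (rule LIMSEQ_I)
  fix r :: real assume r: "r > 0"
  define N where "N = (LINT z|M. (cmod (g z))\<^sup>2)"
  have N: "N \<ge> 0" unfolding N_def by (rule Bochner_Integration.integral_nonneg) auto
  define \<delta> where "\<delta> = r / (2 * (N + 1))"
  have \<delta>: "\<delta> > 0" "\<delta> * N < r / 2"
  proof -
    show "\<delta> > 0" using r N by (simp add: \<delta>_def)
    have "\<delta> * N = r / 2 * (N / (N + 1))" by (simp add: \<delta>_def)
    also have "\<dots> < r / 2 * 1" using r N by (intro mult_strict_left_mono) auto
    finally show "\<delta> * N < r / 2" by simp
  qed
  define C where "C = 1 + 1 / \<delta>"
  have C: "C > 0" using \<delta> by (simp add: C_def add_pos_pos)
  have "\<forall>\<^sub>F n in sequentially. (LINT z|M. (cmod (f n z - g z))\<^sup>2) < r / (2 * C)"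
    using lim by (rule order_tendstoD(2)) (use r C in auto)
  then obtain n0 where n0: "\<And>n. n \<ge> n0 \<Longrightarrow> (LINT z|M. (cmod (f n z - g z))\<^sup>2) < r / (2 * C)"
    by (auto simp: eventually_sequentially)
  \<comment> \<open>Young's inequality. The term with \<delta> integrates to less than
    \<open>r / 2\<close> by the choice of \<delta>, and the one with \<open>C\<close> tends to
    0.\<close>
  have key: "\<bar>s\<^sup>2 - t\<^sup>2\<bar> \<le> C * e\<^sup>2 + \<delta> * t\<^sup>2" if "\<bar>s - t\<bar> \<le> e" "t \<ge> 0" for s t e :: real
  proof -
    have e: "e \<ge> 0" using that by linarith
    have "\<bar>s\<^sup>2 - t\<^sup>2\<bar> = \<bar>s - t\<bar> * \<bar>(s - t) + 2 * t\<bar>" by (simp add: abs_mult[symmetric] power2_eq_square algebra_simps)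
    also have "\<dots> \<le> e * (e + 2 * t)" using that e by (intro mult_mono) auto
    also have "\<dots> \<le> C * e\<^sup>2 + \<delta> * t\<^sup>2"
    proof -
      have "0 \<le> (e - \<delta> * t)\<^sup>2 / \<delta>" using \<delta> by simp
      also have "\<dots> = e\<^sup>2 / \<delta> - 2 * e * t + \<delta> * t\<^sup>2" using \<delta> by (simp add: power2_eq_square field_simps)
      finally show ?thesis by (simp add: C_def power2_eq_square algebra_simps)
    qed
    finally show ?thesis .
  qed
  have "\<bar>(LINT z|M. (cmod (f n z))\<^sup>2) - N\<bar> < r" if n: "n \<ge> n0" for n
  proof -
    note int = L2_fun_integrable[OF f, of n] L2_fun_integrable[OF g] L2_fun_integrable[OF L2_fun_diff[OF f g], of n]
    have "\<bar>(LINT z|M. (cmod (f n z))\<^sup>2) - N\<bar> = \<bar>LINT z|M. (cmod (f n z))\<^sup>2 - (cmod (g z))\<^sup>2\<bar>"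
      unfolding N_def using int by simp
    also have "\<dots> \<le> (LINT z|M. \<bar>(cmod (f n z))\<^sup>2 - (cmod (g z))\<^sup>2\<bar>)" by (rule integral_abs_bound)
    also have "\<dots> \<le> (LINT z|M. C * (cmod (f n z - g z))\<^sup>2 + \<delta> * (cmod (g z))\<^sup>2)"
      by (rule integral_mono) (use int key[OF norm_triangle_ineq3 norm_ge_zero] in auto)
    also have "\<dots> = C * (LINT z|M. (cmod (f n z - g z))\<^sup>2) + \<delta> * N" using int by (simp add: N_def)
    also have "C * (LINT z|M. (cmod (f n z - g z))\<^sup>2) \<le> r / 2"
      using mult_left_mono[OF less_imp_le[OF n0[OF n]], of C] C by simp
    finally show ?thesis using \<delta>(2) by simp
  qed
  then show "\<exists>n0. \<forall>n\<ge>n0. norm ((LINT z|M. (cmod (f n z))\<^sup>2) - (LINT z|M. (cmod (g z))\<^sup>2)) < r"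
    unfolding N_def by auto
qed

lemma L2_fun_continuous_Icc:
  fixes f :: "real \<Rightarrow> complex"
  assumes "continuous_on {p..q} f"
  shows "L2_fun (lebesgue_on {p..q}) f"
  unfolding L2_fun_def
proof
  show "f \<in> borel_measurable (lebesgue_on {p..q})"
    using assms by (intro continuous_imp_measurable_on_sets_lebesgue) auto
  show "integrable (lebesgue_on {p..q}) (\<lambda>z. (cmod (f z))\<^sup>2)"
    by (intro continuous_imp_integrable_real continuous_intros assms)
qed

lemma integral_lebesgue_on_le:
  fixes f :: "'a::euclidean_space \<Rightarrow> complex"
  assumes "L2_fun lborel f" "S \<in> sets borel"
  shows "(LINT z|lebesgue_on S. (cmod (f z))\<^sup>2) \<le> (LINT z|lborel. (cmod (f z))\<^sup>2)"
proof -
  have [measurable]: "f \<in> borel_measurable borel" using L2_fun_measurable[OF assms(1)] by simp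
  have "integrable lborel (\<lambda>z. indicator S z *\<^sub>R (cmod (f z))\<^sup>2)"
    using assms(2) by (intro integrable_mult_indicator L2_fun_integrable[OF assms(1)]) auto
  then show ?thesis
    using L2_fun_integrable[OF assms(1)] assms(2) by (subst integral_lebesgue_on(1)) (auto intro!: integral_mono simp: indicator_def)
qed

lemma continuous_on_strip_line:
  assumes "continuous_on (strip L) w"
  shows "continuous_on {0..L} (\<lambda>y. w (x, y))"
  by (intro continuous_on_compose2[OF assms] continuous_on_Pair continuous_on_id continuous_on_const) (auto simp: strip_def)

lemma approx_trc:
  assumes "approx L u a b v a' b'" "y \<in> {0..L}"
  shows "trc (v n) (a' n) y = v n (0, y)"
proof (rule trc_of_derivative)
  show "((\<lambda>x. v n (x, y)) has_vector_derivative a' n (x, y)) (at x)" for x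
    using assms unfolding approx_def by blast
  have "continuous_on UNIV (a' n)" using assms unfolding approx_def by blast
  then show "continuous_on UNIV (\<lambda>x. a' n (x, y))"
    by (rule continuous_on_compose2) (auto intro!: continuous_intros)
qed

lemma approx_integral:
  assumes "approx L u a b v a' b'" "H1b L u a b"
  shows "(LINT z|lborel. (cmod (restr L (v n) z - u z))\<^sup>2) = mass L (\<lambda>z. v n z - u z)"
    "(LINT z|lborel. (cmod (restr L (a' n) z - a z))\<^sup>2) = mass L (\<lambda>z. a' n z - a z)"
    "(LINT z|lborel. (cmod (restr L (b' n) z - b z))\<^sup>2) = mass L (\<lambda>z. b' n z - b z)"
  using assms unfolding approx_def H1b_def L2_fun_def by (auto intro!: mass_restr)

text \<open>For the mollifications \<open>trc\<close> is the classical restriction to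
  \<open>x = 0\<close>. These restrictions converge to \<open>w (0, y)\<close> because
  \<open>w\<close> is continuous up to the boundary, and along a subsequence to
  \<open>trc w a y\<close> for almost every \<open>y\<close> by the trace inequality.\<close>

lemma trc_of_continuous:
  assumes L: "L > 0" and h: "H1b L w a b" and c: "continuous_on (strip L) w"
  shows "AE y in lborel. y \<in> {0..L} \<longrightarrow> w (0, y) = trc w a y"
proof -
  obtain v a' b' where ap: "approx L w a b v a' b'" using approx_exists[OF L h] by blast
  have w: "L2_fun lborel w" and a: "L2_fun lborel a" using h by (auto simp: H1b_def)
  have v: "L2_fun lborel (restr L (v n))" "L2_fun lborel (restr L (a' n))" for n
    using ap unfolding approx_def by (auto intro: restr_L2)
  let ?d = "\<lambda>n z. restr L (v n) z - w z" and ?e = "\<lambda>n z. restr L (a' n) z - a z"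
  have de: "L2_fun lborel (?d n)" "L2_fun lborel (?e n)" for n by (intro L2_fun_diff v w a)+
  have "(\<lambda>n. LINT y|lborel. (cmod (trc (?d n) (?e n) y))\<^sup>2) \<longlonglongrightarrow> 0"
  proof (rule tendsto_sandwich[OF _ _ tendsto_const])
    show "\<forall>\<^sub>F n in sequentially. (LINT y|lborel. (cmod (trc (?d n) (?e n) y))\<^sup>2)
        \<le> 2 * mass L (\<lambda>z. v n z - w z) + 2 * mass L (\<lambda>z. a' n z - a z)"
      using trc_L2(2)[OF de] by (simp add: approx_integral[OF ap h])
    have "(\<lambda>n. 2 * mass L (\<lambda>z. v n z - w z) + 2 * mass L (\<lambda>z. a' n z - a z)) \<longlonglongrightarrow> 2 * 0 + 2 * 0"
      using ap unfolding approx_def by (intro tendsto_intros) auto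
    then show "(\<lambda>n. 2 * mass L (\<lambda>z. v n z - w z) + 2 * mass L (\<lambda>z. a' n z - a z)) \<longlonglongrightarrow> 0" by simp
  qed simp
  from L2_tendsto_AE_subseq[OF trc_L2(1)[OF de] this] obtain r where
    r: "strict_mono r" "AE y in lborel. (\<lambda>n. trc (?d (r n)) (?e (r n)) y) \<longlonglongrightarrow> 0" by blast
  have "AE y in lborel. \<forall>n. trc (?d n) (?e n) y = trc (restr L (v n)) (restr L (a' n)) y - trc w a y"
    unfolding AE_all_countable by (intro allI trc_diff_AE v w a)
  with r(2) show ?thesis
  proof eventually_elim
    case (elim y)
    show ?case
    proof
      assume y: "y \<in> {0..L}"
      then have "(0, y) \<in> strip L" by (simp add: strip_def)
      then have "(\<lambda>n. v n (0, y)) \<longlonglongrightarrow> w (0, y)" using ap c unfolding approx_def by blast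
      then have 1: "(\<lambda>n. v (r n) (0, y)) \<longlonglongrightarrow> w (0, y)"
        using LIMSEQ_subseq_LIMSEQ[OF _ r(1)] by (fastforce simp: comp_def)
      have "trc (restr L (v n)) (restr L (a' n)) y = v n (0, y)" for n
        using approx_trc[OF ap y] trc_restr[OF y] by simp
      with elim have "(\<lambda>n. v (r n) (0, y) - trc w a y) \<longlonglongrightarrow> 0" by simp
      then have 2: "(\<lambda>n. v (r n) (0, y)) \<longlonglongrightarrow> trc w a y" by (simp add: LIM_zero_iff)
      show "w (0, y) = trc w a y" by (rule LIMSEQ_unique[OF 1 2])
    qed
  qed
qed

text \<open>The trace inequality for a difference in which only \<open>w\<close> has meaningful
  values on the line \<open>x = 0\<close>.\<close>

lemma trace_dist_le:
  assumes L: "L > 0" and w: "H1b L w c d" "continuous_on (strip L) w" and u: "H1b L u a b"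
  shows "(LINT y|lebesgue_on {0..L}. (cmod (w (0, y) - trc u a y))\<^sup>2)
    \<le> 2 * (LINT z|lborel. (cmod (w z - u z))\<^sup>2) + 2 * (LINT z|lborel. (cmod (c z - a z))\<^sup>2)"
proof -
  have L2: "L2_fun lborel w" "L2_fun lborel c" "L2_fun lborel u" "L2_fun lborel a"
    using w u by (auto simp: H1b_def)
  let ?t = "trc (\<lambda>z. w z - u z) (\<lambda>z. c z - a z)"
  note t = trc_L2[OF L2_fun_diff[OF L2(1,3)] L2_fun_diff[OF L2(2,4)]]
  have "AE y in lborel. y \<in> {0..L} \<longrightarrow> w (0, y) - trc u a y = ?t y"
    using trc_of_continuous[OF L w] trc_diff_AE[OF L2] by eventually_elim auto
  then have ae: "AE y in lebesgue_on {0..L}. w (0, y) - trc u a y = ?t y"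
    by (subst AE_lebesgue_on) auto
  have "(LINT y|lebesgue_on {0..L}. (cmod (w (0, y) - trc u a y))\<^sup>2) = (LINT y|lebesgue_on {0..L}. (cmod (?t y))\<^sup>2)"
  proof (rule integral_cong_AE)
    have m: "(\<lambda>y. w (0, y)) \<in> borel_measurable (lebesgue_on {0..L})"
      by (rule L2_fun_measurable[OF L2_fun_continuous_Icc[OF continuous_on_strip_line[OF w(2)]]])
    have m2: "trc u a \<in> borel_measurable (lebesgue_on {0..L})" "?t \<in> borel_measurable (lebesgue_on {0..L})"
      using L2_fun_lebesgue_on[OF trc_L2(1)[OF L2(3,4)], of "{0..L}"] L2_fun_lebesgue_on[OF t(1), of "{0..L}"]
      by (auto intro: L2_fun_measurable)
    show "(\<lambda>y. (cmod (w (0, y) - trc u a y))\<^sup>2) \<in> borel_measurable (lebesgue_on {0..L})" using m m2(1) by measurable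
    show "(\<lambda>y. (cmod (?t y))\<^sup>2) \<in> borel_measurable (lebesgue_on {0..L})" using m2(2) by measurable
    show "AE y in lebesgue_on {0..L}. (cmod (w (0, y) - trc u a y))\<^sup>2 = (cmod (?t y))\<^sup>2"
      using ae by eventually_elim simp
  qed
  also have "\<dots> \<le> (LINT y|lborel. (cmod (?t y))\<^sup>2)" by (rule integral_lebesgue_on_le[OF t(1)]) simp
  also note t(2)
  finally show ?thesis .
qed

section \<open>Identification of the trace with the explicit formula\<close>

lemma H1b_cong_AE:
  assumes h: "H1b L u a b" and w: "w \<in> borel_measurable borel" "\<And>z. z \<notin> strip L \<Longrightarrow> w z = 0" and ae: "AE z in lborel. u z = w z"
  shows "H1b L w a b"
proof -
  have um: "u \<in> borel_measurable borel" using h by (auto simp: H1b_def L2_fun_def)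
  have "integrable lborel (\<lambda>z. (cmod (w z))\<^sup>2)"
  proof (rule integrable_cong_AE_imp)
    show "integrable lborel (\<lambda>z. (cmod (u z))\<^sup>2)" using h by (auto simp: H1b_def L2_fun_def)
    show "(\<lambda>z. (cmod (w z))\<^sup>2) \<in> borel_measurable lborel" using w(1) by measurable
    show "AE z in lborel. (cmod (u z))\<^sup>2 = (cmod (w z))\<^sup>2" using ae by eventually_elim simp
  qed
  then have L2: "L2_fun lborel w" using w(1) by (simp add: L2_fun_def)
  have "(LINT z|lborel. dirD e \<phi> z *\<^sub>R w z) = (LINT z|lborel. dirD e \<phi> z *\<^sub>R u z)" if "test_fun L \<phi>" for e \<phi>
  proof (rule integral_cong_AE)
    have "dirD e \<phi> \<in> borel_measurable borel" using test_fun_continuous(2)[OF that] by (rule borel_measurable_continuous_onI)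
    then show "(\<lambda>z. dirD e \<phi> z *\<^sub>R w z) \<in> borel_measurable lborel" "(\<lambda>z. dirD e \<phi> z *\<^sub>R u z) \<in> borel_measurable lborel"
      using w(1) um by measurable
    show "AE z in lborel. dirD e \<phi> z *\<^sub>R w z = dirD e \<phi> z *\<^sub>R u z" using ae by eventually_elim simp
  qed
  then show ?thesis using h L2 w(2) unfolding H1b_def wder_def by simp
qed

text \<open>The line \<open>x = 0\<close> is a null set, so an arbitrary representative may have
  lost the values on it. A continuous function can serve as its own representative, which preserves
  them.\<close>

lemma H1_continuous_H1b:
  assumes u: "u \<in> H1 L" and c: "continuous_on (strip L) u"
  shows "\<exists>a b. H1b L (restr L u) a b \<and> rep L u (restr L u)"
proof -
  obtain u' a b where h: "H1b L u' a b" "rep L u u'" using H1_imp_H1b[OF u] by blast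
  have m: "restr L u \<in> borel_measurable borel"
    unfolding restr_def[abs_def] using c by (intro borel_measurable_continuous_on_indicator) auto
  have ae: "AE z in lborel. z \<in> strip L \<longrightarrow> u z = u' z"
    using h(2) unfolding rep_def AE_lebesgue_on[OF strip_borel] by blast
  have z0: "u' z = 0" if "z \<notin> strip L" for z using h(2) that unfolding rep_def by blast
  from ae have "AE z in lborel. u' z = restr L u z"
  proof eventually_elim
    case (elim z)
    then show ?case by (cases "z \<in> strip L") (simp_all add: z0)
  qed
  then have "H1b L (restr L u) a b" by (intro H1b_cong_AE[OF h(1) m]) auto
  moreover have "rep L u (restr L u)"
    unfolding rep_def AE_lebesgue_on[OF strip_borel] using calculation by (auto simp: H1b_def)
  ultimately show ?thesis by blast
qed

text \<open>By \<open>trace_dist_le\<close> the restrictions of any sequence that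
  \<open>has_trace\<close> may supply converge to \<open>trc u' a\<close>. Thus the choice made in
  \<open>trace0\<close> affects no integral.\<close>

lemma has_trace_unique:
  assumes L: "L > 0" and h: "H1b L u' a b" and r: "rep L u u'" and u: "u \<in> H1 L" and g: "has_trace L u g"
  shows "AE y in lebesgue_on {0..L}. g y = trc u' a y"
proof -
  have uL2: "L2_fun (lebesgue_on (strip L)) u" using u by (simp add: H1_def)
  have gL2: "L2_fun (lebesgue_on {0..L}) g" using g by (simp add: has_trace_def)
  obtain v where v: "\<And>n. v n \<in> H1 L" "\<And>n. continuous_on (strip L) (v n)"
    and lim: "(\<lambda>n. mass L (\<lambda>z. v n z - u z) + grad_norm_sq L (\<lambda>z. v n z - u z)) \<longlonglongrightarrow> 0"
    and limg: "(\<lambda>n. LINT y|lebesgue_on {0..L}. (cmod (v n (0, y) - g y))\<^sup>2) \<longlonglongrightarrow> 0"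
    using g unfolding has_trace_def by blast
  let ?G = "trc u' a"
  have GL2: "L2_fun (lebesgue_on {0..L}) ?G"
    using h by (intro L2_fun_lebesgue_on trc_L2(1)) (auto simp: H1b_def)
  have le: "(LINT y|lebesgue_on {0..L}. (cmod (v n (0, y) - ?G y))\<^sup>2)
      \<le> 2 * (mass L (\<lambda>z. v n z - u z) + grad_norm_sq L (\<lambda>z. v n z - u z))" for n
  proof -
    obtain c d where w: "H1b L (restr L (v n)) c d" "rep L (v n) (restr L (v n))"
      using H1_continuous_H1b[OF v] by blast
    have vL2: "L2_fun (lebesgue_on (strip L)) (v n)" using v(1)[of n] by (simp add: H1_def)
    note E = H1b_imp_H1[OF L H1b_diff[OF w(1) h] rep_diff[OF w(2) r] L2_fun_diff[OF vL2 uL2]]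
    have cw: "continuous_on (strip L) (restr L (v n))"
      by (rule continuous_on_eq[OF v(2)]) auto
    have "(LINT y|lebesgue_on {0..L}. (cmod (v n (0, y) - ?G y))\<^sup>2)
        = (LINT y|lebesgue_on {0..L}. (cmod (restr L (v n) (0, y) - ?G y))\<^sup>2)"
      by (rule Bochner_Integration.integral_cong) (auto simp: strip_def)
    also have "\<dots> \<le> 2 * (LINT z|lborel. (cmod (restr L (v n) z - u' z))\<^sup>2) + 2 * (LINT z|lborel. (cmod (c z - a z))\<^sup>2)"
      by (rule trace_dist_le[OF L w(1) cw h])
    also have "\<dots> \<le> 2 * (mass L (\<lambda>z. v n z - u z) + grad_norm_sq L (\<lambda>z. v n z - u z))"
      unfolding E(2,3) by simp
    finally show ?thesis .
  qed
  have cL2: "L2_fun (lebesgue_on {0..L}) (\<lambda>y. v n (0, y))" for n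
    by (intro L2_fun_continuous_Icc continuous_on_strip_line v(2))
  have "(LINT y|lebesgue_on {0..L}. (cmod (g y - ?G y))\<^sup>2)
      \<le> 2 * (LINT y|lebesgue_on {0..L}. (cmod (v n (0, y) - g y))\<^sup>2)
        + 2 * (2 * (mass L (\<lambda>z. v n z - u z) + grad_norm_sq L (\<lambda>z. v n z - u z)))" for n
    using integral_diff_sq_le[OF gL2 cL2[of n] GL2] le[of n] by (simp add: norm_minus_commute)
  moreover have "(\<lambda>n. 2 * (LINT y|lebesgue_on {0..L}. (cmod (v n (0, y) - g y))\<^sup>2)
        + 2 * (2 * (mass L (\<lambda>z. v n z - u z) + grad_norm_sq L (\<lambda>z. v n z - u z)))) \<longlonglongrightarrow> 2 * 0 + 2 * (2 * 0)"
    by (intro tendsto_intros lim limg)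
  ultimately have "(LINT y|lebesgue_on {0..L}. (cmod (g y - ?G y))\<^sup>2) \<le> 2 * 0 + 2 * (2 * 0)"
    by (intro LIMSEQ_le_const) auto
  moreover have "(LINT y|lebesgue_on {0..L}. (cmod (g y - ?G y))\<^sup>2) \<ge> 0"
    by (rule Bochner_Integration.integral_nonneg) auto
  ultimately have "(LINT y|lebesgue_on {0..L}. (cmod (g y - ?G y))\<^sup>2) = 0" by simp
  then have "AE y in lebesgue_on {0..L}. (cmod (g y - ?G y))\<^sup>2 = 0"
    using integral_nonneg_eq_0_iff_AE[OF L2_fun_integrable[OF L2_fun_diff[OF gL2 GL2]]] by simp
  then show ?thesis by eventually_elim simp
qed

lemma has_trace_exists:
  assumes L: "L > 0" and h: "H1b L u' a b" and r: "rep L u u'" and u: "u \<in> H1 L"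
  shows "has_trace L u (trc u' a)"
proof -
  obtain v a' b' where ap: "approx L u' a b v a' b'" using approx_exists[OF L h] by blast
  have uL2: "L2_fun (lebesgue_on (strip L)) u" using u by (simp add: H1_def)
  have vL2: "L2_fun lborel (v n)" "continuous_on UNIV (v n)" for n using ap unfolding approx_def by blast+
  have vS: "L2_fun (lebesgue_on (strip L)) (v n)" for n by (intro L2_fun_lebesgue_on vL2) simp
  have vr: "rep L (v n) (restr L (v n))" for n
    unfolding rep_def AE_lebesgue_on[OF strip_borel] using restr_L2[OF vL2(1)] by auto
  note hn = approx_H1b[OF L ap]
  have vH1: "v n \<in> H1 L" for n by (rule H1b_imp_H1(1)[OF L hn vr vS])
  note E = H1b_imp_H1[OF L H1b_diff[OF hn h] rep_diff[OF vr r] L2_fun_diff[OF vS uL2]]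
  have lims: "(\<lambda>n. mass L (\<lambda>z. v n z - u' z)) \<longlonglongrightarrow> 0" "(\<lambda>n. mass L (\<lambda>z. a' n z - a z)) \<longlonglongrightarrow> 0"
    "(\<lambda>n. mass L (\<lambda>z. b' n z - b z)) \<longlonglongrightarrow> 0" using ap unfolding approx_def by blast+
  show ?thesis
    unfolding has_trace_def
  proof (intro conjI exI[of _ v] allI)
    show "L2_fun (lebesgue_on {0..L}) (trc u' a)"
      using h by (intro L2_fun_lebesgue_on trc_L2(1)) (auto simp: H1b_def)
    fix n show "v n \<in> H1 L" by (rule vH1)
    show "continuous_on (strip L) (v n)" using vL2(2) by (rule continuous_on_subset) simp
  next
    have "(\<lambda>n. mass L (\<lambda>z. v n z - u' z) + (mass L (\<lambda>z. a' n z - a z) + mass L (\<lambda>z. b' n z - b z))) \<longlonglongrightarrow> 0 + (0 + 0)"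
      by (intro tendsto_add lims)
    then show "(\<lambda>n. mass L (\<lambda>z. v n z - u z) + grad_norm_sq L (\<lambda>z. v n z - u z)) \<longlonglongrightarrow> 0"
      unfolding E(2,3) approx_integral[OF ap h] by simp
    have "(LINT y|lebesgue_on {0..L}. (cmod (v n (0, y) - trc u' a y))\<^sup>2)
        \<le> 2 * mass L (\<lambda>z. v n z - u' z) + 2 * mass L (\<lambda>z. a' n z - a z)" for n
    proof -
      have cw: "continuous_on (strip L) (restr L (v n))"
        by (rule continuous_on_eq[OF continuous_on_subset[OF vL2(2)[of n]]]) auto
      have "(LINT y|lebesgue_on {0..L}. (cmod (v n (0, y) - trc u' a y))\<^sup>2)
          = (LINT y|lebesgue_on {0..L}. (cmod (restr L (v n) (0, y) - trc u' a y))\<^sup>2)"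
        by (rule Bochner_Integration.integral_cong) (auto simp: strip_def)
      then show ?thesis using trace_dist_le[OF L hn cw h] by (simp add: approx_integral[OF ap h])
    qed
    moreover have "(\<lambda>n. 2 * mass L (\<lambda>z. v n z - u' z) + 2 * mass L (\<lambda>z. a' n z - a z)) \<longlonglongrightarrow> 2 * 0 + 2 * 0"
      by (intro tendsto_intros lims)
    ultimately show "(\<lambda>n. LINT y|lebesgue_on {0..L}. (cmod (v n (0, y) - trc u' a y))\<^sup>2) \<longlonglongrightarrow> 0"
      by (intro tendsto_sandwich[OF _ _ tendsto_const, of 0 "\<lambda>n. LINT y|lebesgue_on {0..L}. (cmod (v n (0, y) - trc u' a y))\<^sup>2"
           sequentially "\<lambda>n. 2 * mass L (\<lambda>z. v n z - u' z) + 2 * mass L (\<lambda>z. a' n z - a z)"]) auto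
  qed
qed

lemma trace0_integral:
  assumes L: "L > 0" and h: "H1b L u' a b" and r: "rep L u u'" and u: "u \<in> H1 L"
  shows "(LINT y|lebesgue_on {0..L}. (cmod (trace0 L u y))\<^sup>2) = (LINT y|lebesgue_on {0..L}. (cmod (trc u' a y))\<^sup>2)"
proof -
  have t: "has_trace L u (trace0 L u)"
    unfolding trace0_def by (rule someI[of "has_trace L u", OF has_trace_exists[OF assms]])
  have m: "trace0 L u \<in> borel_measurable (lebesgue_on {0..L})" "trc u' a \<in> borel_measurable (lebesgue_on {0..L})"
    using t has_trace_exists[OF assms] by (auto simp: has_trace_def L2_fun_def)
  show ?thesis
  proof (rule integral_cong_AE)
    show "AE y in lebesgue_on {0..L}. (cmod (trace0 L u y))\<^sup>2 = (cmod (trc u' a y))\<^sup>2"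
      using has_trace_unique[OF assms t] by eventually_elim simp
  qed (use m in measurable)
qed

lemma approx_trace_tendsto:
  assumes L: "L > 0" and h: "H1b L u a b" and ap: "approx L u a b v a' b'"
  shows "(\<lambda>n. LINT y|lebesgue_on {0..L}. (cmod (v n (0, y)))\<^sup>2) \<longlonglongrightarrow> (LINT y|lebesgue_on {0..L}. (cmod (trc u a y))\<^sup>2)"
proof (rule L2_norm_tendsto)
  have vc: "continuous_on UNIV (v n)" for n using ap unfolding approx_def by blast
  show "L2_fun (lebesgue_on {0..L}) (\<lambda>y. v n (0, y))" for n
    by (intro L2_fun_continuous_Icc continuous_on_strip_line continuous_on_subset[OF vc]) simp
  show "L2_fun (lebesgue_on {0..L}) (trc u a)"
    using h by (intro L2_fun_lebesgue_on trc_L2(1)) (auto simp: H1b_def)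
  have lims: "(\<lambda>n. mass L (\<lambda>z. v n z - u z)) \<longlonglongrightarrow> 0" "(\<lambda>n. mass L (\<lambda>z. a' n z - a z)) \<longlonglongrightarrow> 0"
    using ap unfolding approx_def by blast+
  have "(LINT y|lebesgue_on {0..L}. (cmod (v n (0, y) - trc u a y))\<^sup>2)
      \<le> 2 * mass L (\<lambda>z. v n z - u z) + 2 * mass L (\<lambda>z. a' n z - a z)" for n
  proof -
    have cw: "continuous_on (strip L) (restr L (v n))"
      by (rule continuous_on_eq[OF continuous_on_subset[OF vc[of n]]]) auto
    have "(LINT y|lebesgue_on {0..L}. (cmod (v n (0, y) - trc u a y))\<^sup>2)
        = (LINT y|lebesgue_on {0..L}. (cmod (restr L (v n) (0, y) - trc u a y))\<^sup>2)"
      by (rule Bochner_Integration.integral_cong) (auto simp: strip_def)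
    then show ?thesis using trace_dist_le[OF L approx_H1b[OF L ap] cw h] by (simp add: approx_integral[OF ap h])
  qed
  moreover have "(\<lambda>n. 2 * mass L (\<lambda>z. v n z - u z) + 2 * mass L (\<lambda>z. a' n z - a z)) \<longlonglongrightarrow> 2 * 0 + 2 * 0"
    by (intro tendsto_intros lims)
  ultimately show "(\<lambda>n. LINT y|lebesgue_on {0..L}. (cmod (v n (0, y) - trc u a y))\<^sup>2) \<longlonglongrightarrow> 0"
    by (intro tendsto_sandwich[OF _ _ tendsto_const, of 0 "\<lambda>n. LINT y|lebesgue_on {0..L}. (cmod (v n (0, y) - trc u a y))\<^sup>2"
         sequentially "\<lambda>n. 2 * mass L (\<lambda>z. v n z - u z) + 2 * mass L (\<lambda>z. a' n z - a z)"]) auto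
qed

section \<open>The ground states on the line\<close>

text \<open>Here \<open>g = - \<gamma> / 2\<close>, \<open>k = 2 / (p + 1)\<close> and \<open>q = (p - 1) / 2\<close>, while \<open>\<theta>\<close> is the maximum of \<open>\<bar>v\<bar>\<^sup>2\<close>.
  The ground state with maximum \<open>sqrt \<theta>\<close> has frequency \<open>freq\<close> and mass \<open>gmass\<close>, and its energy
  plus \<open>freq / 2\<close> times its mass is \<open>act\<close>; the integrals are rescaled from \<open>[0, \<theta>]\<close> to \<open>[0, 1]\<close>.\<close>
definition freq :: "real \<Rightarrow> real \<Rightarrow> real \<Rightarrow> real \<Rightarrow> real" where
  "freq g k q \<theta> = g\<^sup>2 + k * \<theta> powr q"

text \<open>The square of the logarithmic derivative of the ground state at a point where its square
  is \<open>t * \<theta>\<close>. For \<open>t = 1\<close>, next to the delta, it is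
  \<open>g\<^sup>2\<close>, the jump condition.\<close>

definition speed2 :: "real \<Rightarrow> real \<Rightarrow> real \<Rightarrow> real \<Rightarrow> real \<Rightarrow> real" where
  "speed2 g k q \<theta> t = g\<^sup>2 + k * \<theta> powr q * (1 - t powr q)"

definition act :: "real \<Rightarrow> real \<Rightarrow> real \<Rightarrow> real \<Rightarrow> real" where
  "act g k q \<theta> = integral {0..1} (\<lambda>t. \<theta> * (sqrt (speed2 g k q \<theta> t) - g))"

definition gmass :: "real \<Rightarrow> real \<Rightarrow> real \<Rightarrow> real \<Rightarrow> real" where
  "gmass g k q \<theta> = integral {0..1} (\<lambda>t. \<theta> / sqrt (speed2 g k q \<theta> t))"

context
  fixes g k q :: real
  assumes g: "g > 0" and k: "k > 0" and q: "0 < q" "q < 1"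
begin

lemma speed2_ge: "t \<in> {0..1} \<Longrightarrow> g\<^sup>2 \<le> speed2 g k q \<theta> t"
  using k q by (auto simp: speed2_def powr_le1)

lemma speed2_pos: "t \<in> {0..1} \<Longrightarrow> 0 < speed2 g k q \<theta> t"
  using speed2_ge[of t \<theta>] g by (smt (verit) zero_less_power)

lemma speed2_le: "t \<in> {0..1} \<Longrightarrow> speed2 g k q \<theta> t \<le> freq g k q \<theta>"
  using k q by (auto simp: speed2_def freq_def mult_left_le)

lemma cont_powr_unit: "continuous_on {0..1} (\<lambda>t::real. t powr q)"
  using q by (intro continuous_on_powr') (auto intro!: continuous_intros)

lemma continuous_speed2: "continuous_on ({0<..} \<times> {0..1}) (\<lambda>(\<theta>, t). speed2 g k q \<theta> t)"
  unfolding speed2_def case_prod_beta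
  using q by (intro continuous_intros continuous_on_powr') (auto intro!: continuous_intros)

lemma continuous_speed2_unit: "continuous_on {0..1} (\<lambda>t. speed2 g k q \<theta> t)"
  unfolding speed2_def by (intro continuous_intros cont_powr_unit)

text \<open>The right-hand side is half the derivative of \<open>freq\<close>, times the mass: the
  shape of the ground state contributes nothing to first order, since it is a critical point. The
  computation below checks this envelope identity without using the ground state.\<close>

lemma act_has_derivative:
  assumes "\<theta> > 0"
  shows "(act g k q has_real_derivative k * q * \<theta> powr (q - 1) * gmass g k q \<theta> / 2) (at \<theta>)"
proof -
  let ?R = "speed2 g k q"
  let ?f' = "\<lambda>\<theta> t. sqrt (?R \<theta> t) - g + \<theta> * (k * (q * \<theta> powr (q - 1)) * (1 - t powr q) / (2 * sqrt (?R \<theta> t)))"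
  have "((\<lambda>\<theta>. integral (cbox 0 1) (\<lambda>t. \<theta> * (sqrt (?R \<theta> t) - g))) has_real_derivative
      integral (cbox 0 1) (?f' \<theta>)) (at \<theta> within {0<..})"
  proof (rule leibniz_rule_field_derivative[where f = "\<lambda>\<theta> t. \<theta> * (sqrt (?R \<theta> t) - g)" and fx = ?f'])
    fix x t :: real assume xt: "x \<in> {0<..}" "t \<in> cbox 0 1"
    then have d: "((\<lambda>x. ?R x t) has_real_derivative k * (q * x powr (q - 1)) * (1 - t powr q)) (at x within {0<..})"
      unfolding speed2_def by (auto intro!: derivative_eq_intros)
    have p: "0 < ?R x t" using xt by (intro speed2_pos) simp
    note DERIV_chain2[where f = sqrt and g = "\<lambda>x. ?R x t" and x = x, OF DERIV_real_sqrt[OF p] d]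
    then have *: "((\<lambda>x. sqrt (?R x t)) has_real_derivative
        inverse (sqrt (?R x t)) / 2 * (k * (q * x powr (q - 1)) * (1 - t powr q))) (at x within {0<..})" .
    have "((\<lambda>x. x * (sqrt (?R x t) - g)) has_real_derivative ?f' x t) (at x within {0<..})"
      by (rule DERIV_cong[OF DERIV_mult'[OF DERIV_ident DERIV_diff[OF * DERIV_const]]])
         (simp add: inverse_eq_divide mult.commute)
    then show "((\<lambda>x. x * (sqrt (?R x t) - g)) has_real_derivative ?f' x t) (at x within {0<..})" .
  next
    show "(\<lambda>t. x * (sqrt (?R x t) - g)) integrable_on cbox 0 1" for x
      by (intro integrable_continuous) (auto intro!: continuous_intros continuous_speed2_unit)
    have cR: "continuous_on ({0<..} \<times> {0..1}) (\<lambda>z. ?R (fst z) (snd z))"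
      using continuous_speed2 by (simp add: case_prod_beta)
    have c1: "continuous_on ({0<..} \<times> {0..1::real}) (\<lambda>z::real\<times>real. fst z powr (q - 1))"
      by (intro continuous_on_powr) (auto intro!: continuous_intros)
    have c2: "continuous_on ({0<..} \<times> {0..1::real}) (\<lambda>z::real\<times>real. snd z powr q)"
      using q by (intro continuous_on_powr') (auto intro!: continuous_intros)
    have "sqrt (?R (fst z) (snd z)) \<noteq> 0" if "z \<in> {0<..} \<times> {0..1}" for z
      using that speed2_pos[of "snd z" "fst z"] by auto
    then have "continuous_on ({0<..} \<times> {0..1}) (\<lambda>z. ?f' (fst z) (snd z))"
      by (intro continuous_on_add continuous_on_diff continuous_on_mult continuous_on_divide
          continuous_on_real_sqrt continuous_on_const continuous_on_fst continuous_on_id c1 c2 cR) auto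
    then show "continuous_on ({0<..} \<times> cbox 0 1) (\<lambda>(x, t). ?f' x t)"
      by (simp add: case_prod_beta)
  qed (use assms in auto)
  then have D: "(act g k q has_real_derivative integral {0..1} (?f' \<theta>)) (at \<theta>)"
    unfolding act_def using assms by (subst (asm) at_within_open) auto
  have f'_int: "?f' \<theta> integrable_on {0..1}"
    using speed2_pos[of _ \<theta>]
    by (intro integrable_continuous_real continuous_intros continuous_speed2_unit cont_powr_unit)
       (auto simp: less_imp_neq[symmetric])
  \<comment> \<open>The derivative in \<open>t\<close> of
    \<open>t * (sqrt (?R \<theta> t) - g)\<close>, which vanishes at \<open>t = 0\<close> and, as
    the root is \<open>g\<close> there, at \<open>t = 1\<close>. Subtracting it does not change the
    integral, cancels the root and leaves a multiple of the integrand of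
    \<open>gmass\<close>.\<close>
  let ?F' = "\<lambda>t. sqrt (?R \<theta> t) - g + t * (- (k * \<theta> powr q * (q * t powr (q - 1))) / (2 * sqrt (?R \<theta> t)))"
  have "(?F' has_integral 1 * (sqrt (?R \<theta> 1) - g) - 0 * (sqrt (?R \<theta> 0) - g)) {0..1}"
  proof (rule fundamental_theorem_of_calculus_interior)
    fix t :: real assume t: "t \<in> {0<..<1}"
    then have "((\<lambda>t. ?R \<theta> t) has_real_derivative - (k * \<theta> powr q * (q * t powr (q - 1)))) (at t)"
      unfolding speed2_def by (auto intro!: derivative_eq_intros)
    from DERIV_chain2[where f = sqrt and g = "?R \<theta>" and x = t, OF DERIV_real_sqrt[OF speed2_pos[of t \<theta>]] this] t
    have *: "((\<lambda>t. sqrt (?R \<theta> t)) has_real_derivative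
        inverse (sqrt (?R \<theta> t)) / 2 * (- (k * \<theta> powr q * (q * t powr (q - 1))))) (at t)"
      by simp
    show "((\<lambda>t. t * (sqrt (?R \<theta> t) - g)) has_vector_derivative ?F' t) (at t)"
      unfolding has_real_derivative_iff_has_vector_derivative[symmetric]
      by (rule DERIV_cong[OF DERIV_mult'[OF DERIV_ident DERIV_diff[OF * DERIV_const]]])
         (simp add: inverse_eq_divide mult.commute)
  qed (auto intro!: continuous_intros continuous_speed2_unit)
  then have "(?F' has_integral 0) {0..1}"
    using g by (simp add: speed2_def)
  from has_integral_diff[OF integrable_integral[OF f'_int] this]
  have 1: "((\<lambda>t. ?f' \<theta> t - ?F' t) has_integral integral {0..1} (?f' \<theta>)) {0..1}" by simp
  have 2: "?f' \<theta> t - ?F' t = k * q * \<theta> powr (q - 1) / 2 * (\<theta> / sqrt (?R \<theta> t))"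
    if t: "t \<in> {0..1}" for t
  proof -
    have e: "\<theta> powr q = \<theta> * \<theta> powr (q - 1)" "t * t powr (q - 1) = t powr q"
      using assms t q by (auto simp: powr_diff)
    have aux: "u + \<theta> * (A / (2 * S)) - (u + t * (- B / (2 * S))) = (\<theta> * A + t * B) / (2 * S)"
      for u A B S :: real by (simp add: add_divide_distrib)
    have "?f' \<theta> t - ?F' t = (\<theta> * (k * (q * \<theta> powr (q - 1)) * (1 - t powr q))
        + t * (k * \<theta> powr q * (q * t powr (q - 1)))) / (2 * sqrt (?R \<theta> t))"
      by (rule aux)
    also have "\<theta> * (k * (q * \<theta> powr (q - 1)) * (1 - t powr q)) + t * (k * \<theta> powr q * (q * t powr (q - 1)))
        = k * q * (\<theta> * \<theta> powr (q - 1)) * (1 - t powr q) + k * q * \<theta> powr q * (t * t powr (q - 1))"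
      by (simp only: ac_simps)
    also have "\<dots> = k * q * \<theta> powr (q - 1) * \<theta>"
      unfolding e by (simp add: algebra_simps)
    also have "k * q * \<theta> powr (q - 1) * \<theta> / (2 * sqrt (?R \<theta> t)) = k * q * \<theta> powr (q - 1) / 2 * (\<theta> / sqrt (?R \<theta> t))"
      by simp
    finally show ?thesis .
  qed
  have "((\<lambda>t. k * q * \<theta> powr (q - 1) / 2 * (\<theta> / sqrt (?R \<theta> t))) has_integral integral {0..1} (?f' \<theta>)) {0..1}"
    by (rule has_integral_eq[OF 2 1])
  from integral_unique[OF this] have eq: "integral {0..1} (?f' \<theta>) = k * q * \<theta> powr (q - 1) / 2 * gmass g k q \<theta>"
    by (simp only: gmass_def Henstock_Kurzweil_Integration.integral_mult_right)
  show ?thesis using D unfolding eq by simp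
qed

text \<open>This is where \<open>q < 1\<close>, that is \<open>p < 3\<close>, enters.\<close>
lemma gmass_scaling:
  assumes "0 < a" "a \<le> b"
  shows "gmass g k q a * b powr (q / 2) \<le> gmass g k q b * a powr (q / 2)"
proof -
  let ?R = "speed2 g k q"
  have int: "(\<lambda>t. x / sqrt (?R x t)) integrable_on {0..1}" for x
    using speed2_pos[of _ x]
    by (intro integrable_continuous_real continuous_intros continuous_speed2_unit)
       (auto simp: less_imp_neq[symmetric])
  have "a / sqrt (?R a t) * b powr (q / 2) \<le> b / sqrt (?R b t) * a powr (q / 2)" if t: "t \<in> {0..1}" for t
  proof -
    define s where "s = 1 - t powr q"
    have s: "s \<ge> 0" using t q by (auto simp: s_def powr_le1)
    have R: "?R a t > 0" "?R b t > 0" using speed2_pos t by auto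
    have b: "b > 0" using assms by simp
    \<comment> \<open>That is, \<open>x powr (1 - q)\<close> is increasing: the only use of
      \<open>q < 1\<close>.\<close>
    have h: "a * b powr q \<le> b * a powr q"
    proof -
      have "a powr (1 - q) \<le> b powr (1 - q)" using assms q by (intro powr_mono2) auto
      then have "a powr (1 - q) * (a powr q * b powr q) \<le> b powr (1 - q) * (a powr q * b powr q)"
        by (intro mult_right_mono) auto
      moreover have "a powr (1 - q) * a powr q = a" "b powr (1 - q) * b powr q = b"
        using assms b by (simp_all add: powr_add[symmetric])
      ultimately show ?thesis by (metis mult.assoc mult.commute)
    qed
    \<comment> \<open>After squaring, the claim splits into a part with \<open>g\<^sup>2\<close> and
      a part with \<open>k * s\<close>; the first is \<open>a \<le> b\<close> times
      \<open>h\<close>, the second \<open>h\<close> times \<open>h\<close>.\<close>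
    have "a * (a * b powr q) \<le> b * (b * a powr q)"
      using assms b by (intro mult_mono[OF assms(2) h]) auto
    moreover have "(a * b powr q) * (a * b powr q) \<le> (b * a powr q) * (b * a powr q)"
      using assms b by (intro mult_mono[OF h h]) auto
    ultimately have "g\<^sup>2 * (a * (a * b powr q)) + k * s * ((a * b powr q) * (a * b powr q))
        \<le> g\<^sup>2 * (b * (b * a powr q)) + k * s * ((b * a powr q) * (b * a powr q))"
      using s k by (intro add_mono mult_left_mono) auto
    then have "a\<^sup>2 * b powr q * ?R b t \<le> b\<^sup>2 * a powr q * ?R a t"
      by (simp add: speed2_def s_def[symmetric] power2_eq_square algebra_simps)
    then have "sqrt (a\<^sup>2 * b powr q * ?R b t) \<le> sqrt (b\<^sup>2 * a powr q * ?R a t)"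
      by (rule real_sqrt_le_mono)
    moreover have "sqrt (x powr q) = x powr (q / 2)" if "x > 0" for x
      using that by (simp add: powr_half_sqrt[symmetric] powr_powr)
    ultimately have "a * b powr (q / 2) * sqrt (?R b t) \<le> b * a powr (q / 2) * sqrt (?R a t)"
      using assms b by (simp add: real_sqrt_mult)
    then show ?thesis using R by (simp add: field_simps)
  qed
  then have "integral {0..1} (\<lambda>t. a / sqrt (?R a t) * b powr (q / 2))
      \<le> integral {0..1} (\<lambda>t. b / sqrt (?R b t) * a powr (q / 2))"
    by (intro integral_le integrable_on_mult_left int)
  then show ?thesis
    unfolding gmass_def Henstock_Kurzweil_Integration.integral_mult_left .
qed

text \<open>Crude, but it tends to 0 with \<theta>, and so extends \<open>act_tangent\<close> to
  \<theta> = 0.\<close>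

lemma act_le: "\<theta> \<ge> 0 \<Longrightarrow> act g k q \<theta> \<le> \<theta> * sqrt (freq g k q \<theta>)"
proof -
  assume \<theta>: "\<theta> \<ge> 0"
  have "act g k q \<theta> \<le> integral {0..1::real} (\<lambda>t. \<theta> * sqrt (freq g k q \<theta>))"
    unfolding act_def
  proof (rule integral_le)
    show "(\<lambda>t. \<theta> * (sqrt (speed2 g k q \<theta> t) - g)) integrable_on {0..1}"
      by (intro integrable_continuous_real continuous_intros continuous_speed2_unit)
    show "\<theta> * (sqrt (speed2 g k q \<theta> t) - g) \<le> \<theta> * sqrt (freq g k q \<theta>)" if "t \<in> {0..1}" for t
    proof -
      have "sqrt (speed2 g k q \<theta> t) \<le> sqrt (freq g k q \<theta>)"
        by (rule real_sqrt_le_mono[OF speed2_le[OF that]])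
      then show ?thesis using g \<theta> by (intro mult_left_mono) linarith+
    qed
  qed auto
  then show ?thesis by simp
qed

text \<open>The right-hand side arises by integrating the derivative of \<open>act\<close> with
  \<open>gmass\<close> replaced by the pure power of exponent q/2 that agrees with it at \<theta>0.
  By \<open>gmass_scaling\<close> the difference of the two sides decreases before \<theta>0 and
  increases after it.\<close>

lemma act_tangent:
  assumes t0: "\<theta>0 > 0" and t: "\<theta> \<ge> 0"
  shows "act g k q \<theta> \<ge> act g k q \<theta>0
           + gmass g k q \<theta>0 * k * \<theta>0 powr q / 3 * ((\<theta> / \<theta>0) powr (3 * q / 2) - 1)"
proof -
  define m where "m = gmass g k q \<theta>0"
  define D where "D \<theta> = act g k q \<theta> - m * k * \<theta>0 powr q / 3 * ((\<theta> / \<theta>0) powr (3 * q / 2) - 1)" for \<theta>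
  define D' where "D' \<theta> = k * q * \<theta> powr (q - 1) / 2 * (gmass g k q \<theta> - m * (\<theta> / \<theta>0) powr (q / 2))" for \<theta>
  have D: "(D has_real_derivative D' \<theta>) (at \<theta>)" if "\<theta> > 0" for \<theta>
  proof -
    have e: "\<theta>0 powr q * ((\<theta> / \<theta>0) powr (3 * q / 2 - 1) / \<theta>0) = \<theta> powr (q - 1) * (\<theta> / \<theta>0) powr (q / 2)"
    proof -
      have "3 * q / 2 - 1 = (q - 1) + q / 2" by simp
      then have "(\<theta> / \<theta>0) powr (3 * q / 2 - 1) = (\<theta> / \<theta>0) powr (q - 1) * (\<theta> / \<theta>0) powr (q / 2)"
        using that t0 by (metis powr_add)
      moreover have "(\<theta> / \<theta>0) powr (q - 1) = \<theta> powr (q - 1) * \<theta>0 / \<theta>0 powr q"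
        using that t0 by (simp add: powr_divide powr_diff)
      ultimately show ?thesis using t0 by simp
    qed
    have pw: "((\<lambda>\<theta>. (\<theta> / \<theta>0) powr (3 * q / 2)) has_real_derivative
        3 * q / 2 * ((\<theta> / \<theta>0) powr (3 * q / 2 - 1) / \<theta>0)) (at \<theta>)"
    proof -
      have "((\<lambda>x. x / \<theta>0) has_real_derivative 1 / \<theta>0) (at \<theta>)"
        using t0 by (auto intro!: derivative_eq_intros)
      from DERIV_chain2[where f = "\<lambda>z. z powr (3 * q / 2)", OF has_real_derivative_powr this]
      show ?thesis using that t0 by auto
    qed
    have "(D has_real_derivative k * q * \<theta> powr (q - 1) * gmass g k q \<theta> / 2
        - m * k * \<theta>0 powr q / 3 * (3 * q / 2 * ((\<theta> / \<theta>0) powr (3 * q / 2 - 1) / \<theta>0) - 0)) (at \<theta>)"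
      unfolding D_def
      by (intro DERIV_diff DERIV_cmult DERIV_const pw act_has_derivative that)
    moreover have "m * k * \<theta>0 powr q / 3 * (3 * q / 2 * ((\<theta> / \<theta>0) powr (3 * q / 2 - 1) / \<theta>0) - 0)
        = m * k * q / 2 * (\<theta> powr (q - 1) * (\<theta> / \<theta>0) powr (q / 2))"
      unfolding e[symmetric] by simp
    moreover have "D' \<theta> = k * q * \<theta> powr (q - 1) * gmass g k q \<theta> / 2
        - m * k * q / 2 * (\<theta> powr (q - 1) * (\<theta> / \<theta>0) powr (q / 2))"
      unfolding D'_def by (simp add: algebra_simps)
    ultimately show ?thesis by (simp only:)
  qed
  have up: "D' \<theta> \<ge> 0" if "\<theta> \<ge> \<theta>0" for \<theta>
  proof -
    have "m * (\<theta> / \<theta>0) powr (q / 2) \<le> gmass g k q \<theta>"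
      using gmass_scaling[OF t0 that] t0 that by (simp add: m_def powr_divide field_simps)
    then show ?thesis using k q by (simp add: D'_def)
  qed
  have down: "D' \<theta> \<le> 0" if "\<theta> \<le> \<theta>0" "\<theta> > 0" for \<theta>
  proof -
    have "m * (\<theta> / \<theta>0) powr (q / 2) \<ge> gmass g k q \<theta>"
      using gmass_scaling[OF that(2,1)] t0 that by (simp add: m_def powr_divide field_simps)
    then show ?thesis using k q by (simp add: D'_def mult_nonneg_nonpos)
  qed
  have pos: "D \<theta> \<ge> D \<theta>0" if "\<theta> > 0" for \<theta>
  proof (cases "\<theta> \<ge> \<theta>0")
    case True
    show ?thesis
      by (rule DERIV_nonneg_imp_nondecreasing[OF True]) (intro exI conjI, rule D, use t0 in linarith, rule up)
  next
    case False
    then have "\<theta> \<le> \<theta>0" by simp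
    from DERIV_nonpos_imp_nonincreasing[OF this, of D] show ?thesis
      using D down that by force
  qed
  have "D \<theta> \<ge> D \<theta>0"
  proof (cases "\<theta> = 0")
    case False then show ?thesis using pos t by simp
  next
    case True
    \<comment> \<open>\<open>D\<close> is controlled for positive arguments only. The majorant
      \<open>h\<close> is continuous at 0 and has the same value there as \<open>D\<close>.\<close>
    define h where "h \<theta> = \<theta> * sqrt (freq g k q \<theta>)
        - m * k * \<theta>0 powr q / 3 * ((\<theta> / \<theta>0) powr (3 * q / 2) - 1)" for \<theta>
    have c1: "continuous_on {0..} (\<lambda>\<theta>::real. \<theta> powr q)"
      using q by (intro continuous_on_powr' continuous_on_id continuous_on_const) auto
    have c2: "continuous_on {0..} (\<lambda>\<theta>. (\<theta> / \<theta>0) powr (3 * q / 2))"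
      using q t0 by (intro continuous_on_powr' continuous_on_divide continuous_on_id continuous_on_const) auto
    have "continuous_on {0..} h"
      unfolding h_def freq_def
      by (intro continuous_on_diff continuous_on_mult continuous_on_add continuous_on_real_sqrt
          continuous_on_id continuous_on_const c1 c2)
    then have "(h \<longlongrightarrow> h 0) (at 0 within {0..})"
      by (simp add: continuous_on)
    then have "(h \<longlongrightarrow> h 0) (at_right 0)"
      by (rule tendsto_within_subset) auto
    moreover have "eventually (\<lambda>x. D \<theta>0 \<le> h x) (at_right 0)"
    proof -
      have "D \<theta>0 \<le> h x" if "x > 0" for x
        using pos[OF that] act_le[of x] that unfolding D_def h_def by simp
      then show ?thesis by (auto simp: eventually_at_right_field intro: exI[of _ 1])
    qed
    ultimately have "D \<theta>0 \<le> h 0"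
      by (intro tendsto_lowerbound) auto
    then show ?thesis using True by (simp add: h_def D_def act_def)
  qed
  then show ?thesis using t0 by (simp add: D_def m_def)
qed

text \<open>By the intermediate value theorem: \<open>gmass\<close> lies between the quotient of
  \<theta> by the root of \<open>freq\<close>, which is unbounded since \<open>q < 1\<close>, and
  \<open>\<theta> / g\<close>, which is small near 0.\<close>

lemma gmass_surj:
  assumes "m > 0"
  shows "\<exists>\<theta>>0. gmass g k q \<theta> = m"
proof -
  let ?R = "speed2 g k q"
  have int: "(\<lambda>t. x / sqrt (?R x t)) integrable_on {0..1}" for x
    using speed2_pos[of _ x]
    by (intro integrable_continuous_real continuous_intros continuous_speed2_unit)
       (auto simp: less_imp_neq[symmetric])
  have upper: "gmass g k q x \<le> x / g" if "x > 0" for x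
  proof -
    have "gmass g k q x \<le> integral {0..1::real} (\<lambda>t. x / g)"
      unfolding gmass_def
    proof (rule integral_le[OF int])
      show "x / sqrt (?R x t) \<le> x / g" if "t \<in> {0..1}" for t
        using real_sqrt_le_mono[OF speed2_ge[OF that, of x]] g \<open>x > 0\<close>
        by (intro divide_left_mono) (auto simp: real_sqrt_gt_0_iff intro!: mult_pos_pos speed2_pos that)
    qed auto
    then show ?thesis by simp
  qed
  have lower: "x / sqrt (freq g k q x) \<le> gmass g k q x" if "x > 0" for x
  proof -
    have "integral {0..1::real} (\<lambda>t. x / sqrt (freq g k q x)) \<le> gmass g k q x"
      unfolding gmass_def
    proof (rule integral_le[OF _ int])
      show "x / sqrt (freq g k q x) \<le> x / sqrt (?R x t)" if "t \<in> {0..1}" for t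
        using real_sqrt_le_mono[OF speed2_le[OF that, of x]] speed2_le[OF that, of x] 
          speed2_pos[OF that, of x] \<open>x > 0\<close>
        by (intro divide_left_mono) auto
    qed auto
    then show ?thesis by simp
  qed
  define a where "a = g * m"
  have a: "a > 0" "gmass g k q a \<le> m" using upper[of a] g assms by (auto simp: a_def)
  \<comment> \<open>The bound 1 gives \<open>b powr q \<le> b\<close>, hence
    \<open>freq g k q b \<le> (g\<^sup>2 + k) * b\<close>; with the last entry this makes the lower
    bound at \<open>b\<close> at least \<open>m\<close>.\<close>
  define b where "b = max 1 (max a (m\<^sup>2 * (g\<^sup>2 + k)))"
  have b: "b \<ge> 1" "b \<ge> a" "b \<ge> m\<^sup>2 * (g\<^sup>2 + k)" by (auto simp: b_def)
  have "m \<le> gmass g k q b"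
  proof -
    have "b powr q \<le> b powr 1" using b q by (intro powr_mono) auto
    then have "freq g k q b \<le> (g\<^sup>2 + k) * b"
    proof -
      have "g\<^sup>2 * 1 \<le> g\<^sup>2 * b" using b by (intro mult_left_mono) auto
      moreover have "k * b powr q \<le> k * b" using k b \<open>b powr q \<le> b powr 1\<close> by (intro mult_left_mono) auto
      ultimately show ?thesis by (simp add: freq_def algebra_simps)
    qed
    then have "m\<^sup>2 * freq g k q b \<le> m\<^sup>2 * ((g\<^sup>2 + k) * b)" by (intro mult_left_mono) auto
    also have "\<dots> = (m\<^sup>2 * (g\<^sup>2 + k)) * b" by simp
    also have "\<dots> \<le> b * b" using b by (intro mult_right_mono) auto
    finally have "sqrt (m\<^sup>2 * freq g k q b) \<le> sqrt (b * b)" by (rule real_sqrt_le_mono)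
    then have "m * sqrt (freq g k q b) \<le> b" using assms b by (simp add: real_sqrt_mult)
    moreover have "freq g k q b > 0" using g k by (simp add: freq_def add_pos_nonneg)
    ultimately have "m \<le> b / sqrt (freq g k q b)" by (simp add: field_simps)
    also have "\<dots> \<le> gmass g k q b" using b by (intro lower) auto
    finally show ?thesis .
  qed
  moreover have "continuous_on {a..b} (gmass g k q)"
  proof -
    have "continuous_on ({0<..} \<times> {0..1}) (\<lambda>z. ?R (fst z) (snd z))"
      using continuous_speed2 by (simp add: case_prod_beta)
    then have "continuous_on ({0<..} \<times> cbox 0 1) (\<lambda>(x, t). x / sqrt (?R x t))"
      unfolding case_prod_beta using speed2_pos
      by (auto intro!: continuous_intros simp: less_imp_neq[symmetric])
    then have "continuous_on {0<..} (\<lambda>x. integral (cbox 0 1) (\<lambda>t. x / sqrt (?R x t)))"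
      by (rule integral_continuous_on_param)
    then show ?thesis unfolding gmass_def using a
      by (auto intro: continuous_on_subset)
  qed
  ultimately obtain x where "a \<le> x" "gmass g k q x = m"
    using IVT'[of "gmass g k q" a m b] a b by auto
  then show ?thesis using a by (intro exI[of _ x]) auto
qed

lemma gmass_nonneg: "\<theta> \<ge> 0 \<Longrightarrow> gmass g k q \<theta> \<ge> 0"
  unfolding gmass_def using speed2_pos[of _ \<theta>]
  by (intro integral_nonneg integrable_continuous_real continuous_intros continuous_speed2_unit)
     (auto simp: less_imp_neq[symmetric] intro!: divide_nonneg_nonneg real_sqrt_ge_zero intro: less_imp_le)

text \<open>In terms of \<open>Z = (\<theta> / \<theta>0) powr (q / 2)\<close> the difference of the two sides is bounded below by
  \<open>k \<theta>0 powr q / (6 m\<^sup>2) (m Z - \<mu>)\<^sup>2 (2 m Z + \<mu>)\<close>.\<close>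
lemma act_mass_lower:
  assumes t0: "\<theta>0 > 0" and t: "\<theta> \<ge> 0" and \<mu>: "\<mu> \<ge> 0" and m: "m = gmass g k q \<theta>0" "m > 0"
  shows "act g k q \<theta> - freq g k q \<theta> * \<mu> / 2 \<ge> act g k q \<theta>0 - freq g k q \<theta>0 * m / 2
     - freq g k q \<theta>0 / 2 * (\<mu> - m) - k * \<theta>0 powr q / (6 * m\<^sup>2) * ((\<mu> - m)\<^sup>2 * (2 * m + \<mu>))"
proof -
  define Z where "Z = (\<theta> / \<theta>0) powr (q / 2)"
  define z where "z = k * \<theta>0 powr q"
  have z: "z > 0" using k t0 by (simp add: z_def)
  have Z0: "Z \<ge> 0" by (simp add: Z_def)
  have pw: "(\<theta> / \<theta>0) powr (real n * (q / 2)) = Z ^ n" if "n > 0" for n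
  proof (cases "\<theta> = 0")
    case False
    then have "Z > 0" using t t0 by (simp add: Z_def)
    then have "Z ^ n = Z powr real n" by (simp add: powr_realpow)
    then show ?thesis by (simp add: Z_def powr_powr mult.commute)
  qed (use that in \<open>simp add: Z_def\<close>)
  have Z3: "(\<theta> / \<theta>0) powr (3 * q / 2) = Z ^ 3" using pw[of 3] by simp
  have "(\<theta> / \<theta>0) powr q = Z ^ 2" using pw[of 2] by simp
  then have "\<theta> powr q = \<theta>0 powr q * Z\<^sup>2"
    using t t0 by (simp add: powr_divide field_simps)
  then have fr: "freq g k q \<theta> = g\<^sup>2 + z * Z\<^sup>2" "freq g k q \<theta>0 = g\<^sup>2 + z" by (simp_all add: freq_def z_def)
  have A: "act g k q \<theta> \<ge> act g k q \<theta>0 + m * z / 3 * (Z ^ 3 - 1)"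
    using act_tangent[OF t0 t] by (simp add: Z3 m(1) z_def mult.assoc)
  \<comment> \<open>With x = m Z the product is 2 x^3 - 3 \<mu> x^2 + \<mu>^3, which has a double
    zero at x = \<mu>. The correction term of the statement is its value at Z = 1, so that the terms
    in \<mu>^3 cancel.\<close>
  have "0 \<le> z / (6 * m\<^sup>2) * ((m * Z - \<mu>)\<^sup>2 * (2 * m * Z + \<mu>))"
    using z m Z0 \<mu> by auto
  also have "\<dots> = m * z / 3 * (Z ^ 3 - 1) - z * Z\<^sup>2 * \<mu> / 2 + z * m / 2 + z / 2 * (\<mu> - m)
      + z / (6 * m\<^sup>2) * ((\<mu> - m)\<^sup>2 * (2 * m + \<mu>))"
    using m(2) by (simp add: field_simps power2_eq_square power3_eq_cube)
  finally show ?thesis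
    using A unfolding fr z_def[symmetric] by (simp add: algebra_simps add_divide_distrib diff_divide_distrib)
qed

text \<open>Substitution \<open>s = \<theta> * t\<close>. The form over \<open>{0..1}\<close> is the
  one to differentiate in \<theta>; the form over \<open>{0..\<theta>}\<close> is the one that the
  Modica-Mortola estimate produces, with the delta term split off.\<close>

lemma act_eq:
  assumes "\<theta> > 0"
  shows "act g k q \<theta> = integral {0..\<theta>} (\<lambda>s. sqrt (freq g k q \<theta> - k * s powr q)) - g * \<theta>"
proof -
  let ?h = "\<lambda>s. sqrt (freq g k q \<theta> - k * s powr q) - g"
  have cont: "continuous_on {0..\<theta>} ?h" "continuous_on {0..\<theta>} (\<lambda>s. sqrt (freq g k q \<theta> - k * s powr q))"
    using q by (auto intro!: continuous_intros continuous_on_powr')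
  have "((\<lambda>t. \<theta> *\<^sub>R ?h (\<theta> * t)) has_integral integral {\<theta> * 0..\<theta> * 1} ?h) {0..1}"
    by (rule has_integral_substitution[where c = 0 and d = \<theta>])
       (use assms cont in \<open>auto intro!: derivative_eq_intros simp: mult_left_le\<close>)
  then have "((\<lambda>t. \<theta> * (sqrt (speed2 g k q \<theta> t) - g)) has_integral integral {0..\<theta>} ?h) {0..1}"
    using has_integral_cong[of "{0..1}" "\<lambda>t. \<theta> *\<^sub>R ?h (\<theta> * t)" "\<lambda>t. \<theta> * (sqrt (speed2 g k q \<theta> t) - g)"] assms
    by (auto simp: speed2_def freq_def powr_mult algebra_simps)
  then have "act g k q \<theta> = integral {0..\<theta>} ?h"
    unfolding act_def by (rule integral_unique)
  also have "\<dots> = integral {0..\<theta>} (\<lambda>s. sqrt (freq g k q \<theta> - k * s powr q)) - integral {0..\<theta>} (\<lambda>s. g)"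
    by (rule Henstock_Kurzweil_Integration.integral_diff) (auto intro!: integrable_continuous_real cont)
  finally show ?thesis using assms by simp
qed

end

section \<open>Existence of the ground states\<close>

lemma nn_integral_even:
  fixes F :: "real \<Rightarrow> ennreal"
  assumes [measurable]: "F \<in> borel_measurable borel"
  shows "(\<integral>\<^sup>+x. F \<bar>x\<bar> \<partial>lborel) = 2 * (\<integral>\<^sup>+x. F x * indicator {0..} x \<partial>lborel)"
proof -
  have "(\<integral>\<^sup>+x. F \<bar>x\<bar> \<partial>lborel) = (\<integral>\<^sup>+x. F x * indicator {0..} x + F (- x) * indicator {0..} (- x) \<partial>lborel)"
  proof (rule nn_integral_cong_AE)
    have "AE x in lborel. x \<noteq> (0::real)" by (rule AE_lborel_singleton)
    then show "AE x in lborel. F \<bar>x\<bar> = F x * indicator {0..} x + F (- x) * indicator {0..} (- x)"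
      by eventually_elim (auto simp: indicator_def)
  qed
  also have "\<dots> = (\<integral>\<^sup>+x. F x * indicator {0..} x \<partial>lborel) + (\<integral>\<^sup>+x. F (- x) * indicator {0..} (- x) \<partial>lborel)"
    by (rule nn_integral_add) measurable
  also have "(\<integral>\<^sup>+x. F (- x) * indicator {0..} (- x) \<partial>lborel) = (\<integral>\<^sup>+x. F x * indicator {0..} x \<partial>lborel)"
    using nn_integral_real_affine[of "\<lambda>x. F x * indicator {0..} x" "-1" 0] by simp
  finally show ?thesis by (simp add: mult_2)
qed

context
  fixes g k q :: real
  assumes g: "g > 0" and k: "k > 0" and q: "0 < q" "q < 1"
begin

lemma gmass_eq:
  assumes "\<theta> > 0"
  shows "gmass g k q \<theta> = integral {0..\<theta>} (\<lambda>s. 1 / sqrt (freq g k q \<theta> - k * s powr q))"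
proof -
  let ?h = "\<lambda>s. 1 / sqrt (freq g k q \<theta> - k * s powr q)"
  have pos: "freq g k q \<theta> - k * s powr q > 0" if "s \<in> {0..\<theta>}" for s
  proof -
    have "k * s powr q \<le> k * \<theta> powr q" using that k q by (intro mult_left_mono powr_mono2) auto
    moreover have "g\<^sup>2 > 0" using g by simp
    ultimately show ?thesis unfolding freq_def by linarith
  qed
  have cp: "continuous_on {0..\<theta>} (\<lambda>s::real. s powr q)"
    using q by (intro continuous_on_powr' continuous_on_id continuous_on_const) auto
  have cont: "continuous_on {0..\<theta>} ?h"
    by (intro continuous_on_divide continuous_on_real_sqrt continuous_on_diff continuous_on_mult continuous_on_const cp)
       (use pos in force)
  have "((\<lambda>t. \<theta> *\<^sub>R ?h (\<theta> * t)) has_integral integral {\<theta> * 0..\<theta> * 1} ?h) {0..1}"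
    by (rule has_integral_substitution[where c = 0 and d = \<theta>])
       (use assms cont in \<open>auto intro!: derivative_eq_intros simp: mult_left_le\<close>)
  moreover have "\<theta> *\<^sub>R ?h (\<theta> * t) = \<theta> / sqrt (speed2 g k q \<theta> t)" if "t \<in> {0..1}" for t
    using assms that by (simp add: speed2_def freq_def powr_mult algebra_simps)
  ultimately have "((\<lambda>t. \<theta> / sqrt (speed2 g k q \<theta> t)) has_integral integral {\<theta> * 0..\<theta> * 1} ?h) {0..1}"
    using has_integral_eq[of "{0..1}" "\<lambda>t. \<theta> *\<^sub>R ?h (\<theta> * t)" "\<lambda>t. \<theta> / sqrt (speed2 g k q \<theta> t)"] by blast
  then show ?thesis unfolding gmass_def by (simp add: integral_unique)
qed

text \<open>The ground state on the line: with \<open>tanh y = g / sqrt \<omega>\<close> it is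
  \<open>sqrt \<theta> (cosh y / cosh (q (sqrt \<omega>) \<bar>x\<bar> + y)) powr (1 / q)\<close>.\<close>
lemma profile_exists:
  assumes th: "\<theta> > 0"
  shows "\<exists>w w' :: real \<Rightarrow> real. continuous_on UNIV w \<and> (\<forall>x. x \<noteq> 0 \<longrightarrow> (w has_real_derivative w' x) (at x)) \<and>
     w' \<in> borel_measurable borel \<and> (\<forall>x. w x > 0) \<and> (w 0)\<^sup>2 = \<theta> \<and>
     has_bochner_integral lborel (\<lambda>x. (w x)\<^sup>2) (gmass g k q \<theta>) \<and>
     has_bochner_integral lborel (\<lambda>x. (w' x)\<^sup>2) (act g k q \<theta> + g * \<theta>) \<and>
     has_bochner_integral lborel (\<lambda>x. w x powr (2 * q + 2))
       ((freq g k q \<theta> * gmass g k q \<theta> - (act g k q \<theta> + g * \<theta>)) / k)"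
proof -
  define \<omega> where "\<omega> = freq g k q \<theta>"
  have \<omega>: "\<omega> > g\<^sup>2" using k th by (simp add: \<omega>_def freq_def)
  then have \<omega>0: "\<omega> > 0" using zero_le_power2[of g] by linarith
  define r where "r = sqrt \<omega>"
  have r: "r > g" "r\<^sup>2 = \<omega>" "r > 0"
    using \<omega> \<omega>0 g real_less_rsqrt by (auto simp: r_def)
  \<comment> \<open>This shift makes the logarithmic derivative at 0 from the right equal to
    \<open>- g\<close>, as the delta demands.\<close>
  have "\<exists>y>0. tanh y = g / r"
  proof -
    have "\<forall>\<^sub>F y in at_top. tanh y > g / r"
      using tanh_real_at_top by (rule order_tendstoD(1)) (use r in simp)
    then obtain z where z: "z > 0" "tanh z > g / r"
      unfolding eventually_at_top_linorder by (metis gt_ex le_max_iff_disj max.strict_coboundedI2 order_refl)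
    have "\<exists>y\<ge>0. y \<le> z \<and> tanh y = g / r"
      by (rule IVT') (use z g r in \<open>auto intro!: continuous_intros\<close>)
    then obtain y where y: "0 \<le> y" "tanh y = g / r" by blast
    then have "y \<noteq> 0" using g r by auto
    then show ?thesis using y by (intro exI[of _ y]) auto
  qed
  then obtain y0 where y0: "y0 > 0" "tanh y0 = g / r" by blast
  \<comment> \<open>The profile for \<open>x \<ge> 0\<close>, written as an exponential so that
    positivity is evident and the derivative is \<open>f\<close> times that of the exponent.\<close>
  define f where "f x = exp (ln \<theta> / 2 + (ln (cosh y0) - ln (cosh (q * r * x + y0))) / q)" for x
  define T where "T x = tanh (q * r * x + y0)" for x
  have fpos: "f x > 0" for x by (simp add: f_def)
  have fd: "(f has_real_derivative - (r * T x * f x)) (at x)" for x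
  proof -
    have "((\<lambda>x. ln (cosh (q * r * x + y0))) has_real_derivative (1 / cosh (q * r * x + y0)) * (sinh (q * r * x + y0) * (q * r))) (at x)"
      by (rule DERIV_chain2[where f = ln]) (auto intro!: derivative_eq_intros)
    then have "((\<lambda>x. ln (cosh (q * r * x + y0))) has_real_derivative T x * (q * r)) (at x)"
      by (simp add: T_def tanh_def)
    then show ?thesis
      unfolding f_def by (auto intro!: derivative_eq_intros simp: T_def tanh_def q less_imp_neq[symmetric])
  qed
  have f0: "(f 0)\<^sup>2 = \<theta>" using th by (simp add: f_def exp_double[symmetric])
  \<comment> \<open>The first integral of the equation: the logarithmic derivative of
    \<open>f\<close> is \<open>- r * T x\<close>, so its square is a function of
    \<open>(f x)\<^sup>2\<close> alone.\<close>
  have fq: "\<omega> - k * ((f x)\<^sup>2) powr q = (r * T x)\<^sup>2" for x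
  proof -
    let ?u = "q * r * x + y0"
    have "(f x)\<^sup>2 = exp (ln \<theta> + 2 * (ln (cosh y0) - ln (cosh ?u)) / q)"
      by (simp add: f_def exp_double[symmetric] algebra_simps)
    then have "((f x)\<^sup>2) powr q = exp (q * (ln \<theta> + 2 * (ln (cosh y0) - ln (cosh ?u)) / q))"
      by (simp add: powr_def)
    also have "q * (ln \<theta> + 2 * (ln (cosh y0) - ln (cosh ?u)) / q) = q * ln \<theta> + 2 * (ln (cosh y0) - ln (cosh ?u))"
      using q by (simp add: distrib_left)
    also have "exp (q * ln \<theta> + 2 * (ln (cosh y0) - ln (cosh ?u))) = \<theta> powr q * (exp (ln (cosh y0) - ln (cosh ?u)))\<^sup>2"
      unfolding exp_add exp_double using th by (simp add: powr_def)
    also have "\<dots> = \<theta> powr q * (cosh y0)\<^sup>2 / (cosh ?u)\<^sup>2" by (simp add: exp_diff power_divide)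
    finally have p: "((f x)\<^sup>2) powr q = \<theta> powr q * (cosh y0)\<^sup>2 / (cosh ?u)\<^sup>2" .
    have ch: "1 - (tanh u)\<^sup>2 = 1 / (cosh u)\<^sup>2" for u :: real
    proof -
      have "1 - (tanh u)\<^sup>2 = ((cosh u)\<^sup>2 - (sinh u)\<^sup>2) / (cosh u)\<^sup>2"
        by (simp add: tanh_def power_divide diff_divide_distrib)
      then show ?thesis by (simp only: hyperbolic_pythagoras)
    qed
    have "g\<^sup>2 = r\<^sup>2 * (tanh y0)\<^sup>2" using y0 r \<omega>0 by (simp add: power_divide)
    then have "k * \<theta> powr q = r\<^sup>2 * (1 - (tanh y0)\<^sup>2)"
      using r by (simp add: \<omega>_def freq_def right_diff_distrib)
    then have "k * \<theta> powr q * (cosh y0)\<^sup>2 = r\<^sup>2" unfolding ch by simp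
    then have "k * ((f x)\<^sup>2) powr q = r\<^sup>2 * (1 / (cosh ?u)\<^sup>2)" unfolding p by (simp add: mult.assoc)
    then show ?thesis unfolding ch[symmetric] using r by (simp add: T_def power_mult_distrib right_diff_distrib)
  qed
  have T: "T x > 0" if "x \<ge> 0" for x using that y0 q r by (simp add: T_def add_nonneg_pos)
  have f_le: "(f x)\<^sup>2 \<le> \<theta>" if "x \<ge> 0" for x
  proof -
    have "f x \<le> f 0"
    proof (rule DERIV_nonpos_imp_nonincreasing[OF that])
      fix z assume "0 \<le> z" "z \<le> x"
      then show "\<exists>y. (f has_real_derivative y) (at z) \<and> y \<le> 0"
        using fd[of z] T[of z] r fpos[of z] by (intro exI conjI) (assumption, simp)
    qed
    then show ?thesis using fpos[of x] power_mono[of "f x" "f 0" 2] f0 by simp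
  qed
  have f_lim: "((\<lambda>x. (f x)\<^sup>2) \<longlongrightarrow> 0) at_top"
  proof -
    \<comment> \<open>From cosh u being at least exp u / 2; the profile decays like
      \<open>exp (- (r * x))\<close>.\<close>
    define c where "c = ln \<theta> / 2 + (ln (cosh y0) + ln 2 - y0) / q"
    have le: "f x \<le> exp (c + - (r * x))" for x
    proof -
      have "exp (q * r * x + y0) / 2 \<le> cosh (q * r * x + y0)" by (simp add: cosh_def)
      then have "ln (exp (q * r * x + y0) / 2) \<le> ln (cosh (q * r * x + y0))" by (subst ln_le_cancel_iff) auto
      then have "q * r * x + y0 - ln 2 \<le> ln (cosh (q * r * x + y0))" by (simp add: ln_div)
      then have "(ln (cosh y0) - ln (cosh (q * r * x + y0))) / q \<le> (ln (cosh y0) - (q * r * x + y0 - ln 2)) / q"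
        using q by (intro divide_right_mono) auto
      also have "\<dots> = (ln (cosh y0) + ln 2 - y0) / q - r * x" using q by (simp add: field_simps)
      finally show ?thesis by (simp add: f_def c_def)
    qed
    have "filterlim (\<lambda>x. r * x) at_top at_top"
      by (rule filterlim_tendsto_pos_mult_at_top[OF tendsto_const r(3) filterlim_ident])
    then have "filterlim (\<lambda>x. - (r * x)) at_bot at_top" by (simp add: filterlim_uminus_at_top)
    then have "((\<lambda>x. exp (- (r * x))) \<longlongrightarrow> 0) at_top" by (rule filterlim_compose[OF exp_at_bot])
    then have "((\<lambda>x. exp c * exp (- (r * x))) \<longlongrightarrow> exp c * 0) at_top" by (rule tendsto_mult_left)
    then have "((\<lambda>x. exp (c + - (r * x))) \<longlongrightarrow> 0) at_top" unfolding exp_add by simp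
    then have "(f \<longlongrightarrow> 0) at_top"
      by (intro tendsto_sandwich[OF _ _ tendsto_const, of 0 f at_top "\<lambda>x. exp (c + - (r * x))"])
         (use fpos le in \<open>auto simp: less_imp_le\<close>)
    then have "((\<lambda>x. (f x)\<^sup>2) \<longlongrightarrow> 0\<^sup>2) at_top" by (rule tendsto_power)
    then show ?thesis by simp
  qed
  \<comment> \<open>Slightly more than \<theta>, such that \<open>\<omega> - k * s powr q\<close> is
    still at least half of \<open>g\<^sup>2\<close> on \<open>{0..\<theta>1}\<close>. Then \<theta>,
    the value of \<open>(f x)\<^sup>2\<close> at 0, is an interior point and the primitive
    \<open>H\<close> is differentiable there.\<close>
  define \<theta>1 where "\<theta>1 = ((\<omega> - g\<^sup>2 / 2) / k) powr (1 / q)"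
  have "\<omega> - g\<^sup>2 / 2 > 0" using \<omega> zero_le_power2[of g] by linarith
  then have t1q: "\<theta>1 powr q = (\<omega> - g\<^sup>2 / 2) / k"
    using k q by (simp add: \<theta>1_def powr_powr)
  have t1: "\<theta> < \<theta>1"
  proof (rule ccontr)
    assume "\<not> ?thesis"
    then have "\<theta>1 powr q \<le> \<theta> powr q" using q by (intro powr_mono2) (auto simp: \<theta>1_def)
    then have "k * ((\<omega> - g\<^sup>2 / 2) / k) \<le> k * \<theta> powr q" unfolding t1q using k by (intro mult_left_mono) auto
    then have "\<omega> - g\<^sup>2 / 2 \<le> \<omega> - g\<^sup>2" using k by (simp add: \<omega>_def freq_def)
    then show False using g by simp
  qed
  have pos1: "\<omega> - k * s powr q > 0" if "s \<in> {0..\<theta>1}" for s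
  proof -
    have "k * s powr q \<le> k * \<theta>1 powr q" using that k q by (intro mult_left_mono powr_mono2) auto
    also have "\<dots> = \<omega> - g\<^sup>2 / 2" using k by (simp add: t1q)
    finally show ?thesis using zero_less_power[OF g, of 2] by linarith
  qed
  have cp: "continuous_on {0..\<theta>1} (\<lambda>s::real. s powr q)"
    using q by (intro continuous_on_powr' continuous_on_id continuous_on_const) auto
  have fm [measurable]: "f \<in> borel_measurable borel" "T \<in> borel_measurable borel"
    unfolding f_def[abs_def] T_def[abs_def]
    by (intro borel_measurable_continuous_onI continuous_intros; use q in simp)+
  \<comment> \<open>Substitution \<open>s = (f x)\<^sup>2\<close>, which runs from \<theta> down to
    0 on the half-line; its derivative is \<open>- (2 * r * T x * (f x)\<^sup>2)\<close>.\<close>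
  have half: "(\<integral>\<^sup>+x. ennreal (h ((f x)\<^sup>2) * (2 * r * T x * (f x)\<^sup>2)) * indicator {0..} x \<partial>lborel) = ennreal (integral {0..\<theta>} h)"
    if h: "continuous_on {0..\<theta>1} h" "\<And>s. s \<in> {0..\<theta>1} \<Longrightarrow> h s \<ge> 0"
      and hm: "(\<lambda>x. h ((f x)\<^sup>2) * (2 * r * T x * (f x)\<^sup>2)) \<in> borel_measurable borel" for h
  proof -
    define H where "H t = integral {0..t} h" for t
    have Hd: "(H has_real_derivative h t) (at t)" if "0 < t" "t < \<theta>1" for t
    proof -
      have "(H has_vector_derivative h t) (at t within {0..\<theta>1})"
        unfolding H_def[abs_def] by (rule integral_has_vector_derivative[OF h(1)]) (use that in auto)
      then have "(H has_vector_derivative h t) (at t)"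
        using that at_within_Icc_at[of 0 t \<theta>1] by simp
      then show ?thesis by (simp add: has_real_derivative_iff_has_vector_derivative)
    qed
    have "(\<integral>\<^sup>+x. ennreal (h ((f x)\<^sup>2) * (2 * r * T x * (f x)\<^sup>2)) * indicator {0..} x \<partial>lborel) = ennreal (0 - - H ((f 0)\<^sup>2))"
    proof (rule nn_integral_FTC_atLeast[OF hm])
      fix x :: real assume x: "0 \<le> x"
      have fx: "0 < (f x)\<^sup>2" "(f x)\<^sup>2 < \<theta>1" using fpos[of x] f_le[OF x] t1 by auto
      have "((\<lambda>x. (f x)\<^sup>2) has_real_derivative 2 * f x * (- (r * T x * f x))) (at x)"
        using DERIV_power[OF fd[of x], of 2] by (simp add: algebra_simps)
      from DERIV_minus[OF DERIV_chain2[where f = H and g = "\<lambda>x. (f x)\<^sup>2" and x = x, OF Hd[OF fx] this]]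
      show "((\<lambda>x. - H ((f x)\<^sup>2)) has_real_derivative h ((f x)\<^sup>2) * (2 * r * T x * (f x)\<^sup>2)) (at x)"
        by (simp add: power2_eq_square algebra_simps)
      show "0 \<le> h ((f x)\<^sup>2) * (2 * r * T x * (f x)\<^sup>2)"
        using h(2)[of "(f x)\<^sup>2"] fx T[OF x] r by simp
    next
      have hc: "continuous_on {0..\<theta>1} H"
        unfolding H_def[abs_def] by (intro indefinite_integral_continuous_1 integrable_continuous_real h(1))
      have ev: "\<forall>\<^sub>F x in at_top. (f x)\<^sup>2 \<in> {0..\<theta>1}"
        using eventually_ge_at_top[of 0] by eventually_elim (use f_le t1 in \<open>auto intro: order_trans[OF f_le]\<close>)
      have "((\<lambda>x. H ((f x)\<^sup>2)) \<longlongrightarrow> H 0) at_top"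
        by (rule continuous_on_tendsto_compose[OF hc f_lim _ ev]) (use th t1 in auto)
      then have "((\<lambda>x. - H ((f x)\<^sup>2)) \<longlongrightarrow> - H 0) at_top" by (rule tendsto_minus)
      then show "((\<lambda>x. - H ((f x)\<^sup>2)) \<longlongrightarrow> 0) at_top" by (simp add: H_def)
    qed
    then show ?thesis by (simp add: f0 H_def)
  qed
  define P where "P = act g k q \<theta> + g * \<theta>"
  have P: "P = integral {0..\<theta>} (\<lambda>s. sqrt (\<omega> - k * s powr q))"
    using act_eq[OF g k q th] by (simp add: P_def \<omega>_def)
  define M where "M = gmass g k q \<theta>"
  have M: "M = integral {0..\<theta>} (\<lambda>s. 1 / sqrt (\<omega> - k * s powr q))"
    using gmass_eq[OF th] by (simp add: M_def \<omega>_def)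
  have sq: "sqrt (\<omega> - k * ((f x)\<^sup>2) powr q) = r * T x" if "x \<ge> 0" for x
    unfolding fq using T[OF that] r by simp
  define w where "w x = f \<bar>x\<bar>" for x
  define w' where "w' x = (if x > 0 then - (r * T \<bar>x\<bar> * f \<bar>x\<bar>) else r * T \<bar>x\<bar> * f \<bar>x\<bar>)" for x
  have wm [measurable]: "w \<in> borel_measurable borel" "w' \<in> borel_measurable borel"
    unfolding w_def[abs_def] w'_def[abs_def] by measurable
  have w2: "(\<integral>\<^sup>+x. ennreal ((w x)\<^sup>2) \<partial>lborel) = ennreal M"
  proof -
    have "(\<integral>\<^sup>+x. ennreal ((w x)\<^sup>2) \<partial>lborel) = 2 * (\<integral>\<^sup>+x. ennreal ((f x)\<^sup>2) * indicator {0..} x \<partial>lborel)"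
      unfolding w_def by (rule nn_integral_even) measurable
    also have "\<dots> = (\<integral>\<^sup>+x. 2 * (ennreal ((f x)\<^sup>2) * indicator {0..} x) \<partial>lborel)"
      by (rule nn_integral_cmult[symmetric]) measurable
    also have "\<dots> = (\<integral>\<^sup>+x. ennreal (1 / sqrt (\<omega> - k * ((f x)\<^sup>2) powr q) * (2 * r * T x * (f x)\<^sup>2)) * indicator {0..} x \<partial>lborel)"
    proof (rule nn_integral_cong)
      fix x :: real
      show "2 * (ennreal ((f x)\<^sup>2) * indicator {0..} x)
          = ennreal (1 / sqrt (\<omega> - k * ((f x)\<^sup>2) powr q) * (2 * r * T x * (f x)\<^sup>2)) * indicator {0..} x"
      proof (cases "x \<ge> 0")
        case True
        have "1 / (r * T x) * (2 * r * T x * (f x)\<^sup>2) = 2 * (f x)\<^sup>2" using T[OF True] r by simp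
        then show ?thesis using True by (simp add: sq ennreal_mult)
      qed simp
    qed
    also have "\<dots> = ennreal (integral {0..\<theta>} (\<lambda>s. 1 / sqrt (\<omega> - k * s powr q)))"
    proof (rule half)
      show "continuous_on {0..\<theta>1} (\<lambda>s. 1 / sqrt (\<omega> - k * s powr q))"
        by (intro continuous_on_divide continuous_on_real_sqrt continuous_on_diff continuous_on_mult continuous_on_const cp)
           (use pos1 in force)
      show "0 \<le> 1 / sqrt (\<omega> - k * s powr q)" if "s \<in> {0..\<theta>1}" for s using pos1[OF that] by simp
    qed measurable
    finally show ?thesis by (simp add: M)
  qed
  have w'2: "(\<integral>\<^sup>+x. ennreal ((w' x)\<^sup>2) \<partial>lborel) = ennreal P"
  proof -
    have "(\<integral>\<^sup>+x. ennreal ((w' x)\<^sup>2) \<partial>lborel) = (\<integral>\<^sup>+x. ennreal ((r * T \<bar>x\<bar> * f \<bar>x\<bar>)\<^sup>2) \<partial>lborel)"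
      by (rule nn_integral_cong) (simp add: w'_def)
    also have "\<dots> = 2 * (\<integral>\<^sup>+x. ennreal ((r * T x * f x)\<^sup>2) * indicator {0..} x \<partial>lborel)"
      by (rule nn_integral_even) measurable
    also have "\<dots> = (\<integral>\<^sup>+x. 2 * (ennreal ((r * T x * f x)\<^sup>2) * indicator {0..} x) \<partial>lborel)"
      by (rule nn_integral_cmult[symmetric]) measurable
    also have "\<dots> = (\<integral>\<^sup>+x. ennreal (sqrt (\<omega> - k * ((f x)\<^sup>2) powr q) * (2 * r * T x * (f x)\<^sup>2)) * indicator {0..} x \<partial>lborel)"
    proof (rule nn_integral_cong)
      fix x :: real
      show "2 * (ennreal ((r * T x * f x)\<^sup>2) * indicator {0..} x)
          = ennreal (sqrt (\<omega> - k * ((f x)\<^sup>2) powr q) * (2 * r * T x * (f x)\<^sup>2)) * indicator {0..} x"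
      proof (cases "x \<ge> 0")
        case True
        have e: "r * T x * (2 * r * T x * (f x)\<^sup>2) = 2 * (r * T x * f x)\<^sup>2" by (simp add: power2_eq_square)
        have "ennreal (2 * (r * T x * f x)\<^sup>2) = 2 * ennreal ((r * T x * f x)\<^sup>2)" by (subst ennreal_mult) auto
        then show ?thesis using True unfolding sq[OF True] e by simp
      qed simp
    qed
    also have "\<dots> = ennreal (integral {0..\<theta>} (\<lambda>s. sqrt (\<omega> - k * s powr q)))"
    proof (rule half)
      show "continuous_on {0..\<theta>1} (\<lambda>s. sqrt (\<omega> - k * s powr q))"
        by (intro continuous_on_real_sqrt continuous_on_diff continuous_on_mult continuous_on_const cp)
      show "0 \<le> sqrt (\<omega> - k * s powr q)" if "s \<in> {0..\<theta>1}" for s using pos1[OF that] by simp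
    qed measurable
    finally show ?thesis by (simp add: P)
  qed
  have M0: "M \<ge> 0" unfolding M_def using gmass_nonneg[OF g k q, of \<theta>] th by simp
  have "continuous_on {0..\<theta>} (\<lambda>s. sqrt (\<omega> - k * s powr q))"
    by (intro continuous_on_real_sqrt continuous_on_diff continuous_on_mult continuous_on_const
        continuous_on_subset[OF cp]) (use t1 in auto)
  then have P0: "P \<ge> 0" unfolding P
  proof (intro integral_nonneg integrable_continuous_real)
    show "0 \<le> sqrt (\<omega> - k * s powr q)" if "s \<in> {0..\<theta>}" for s
      using pos1[of s] that t1 by simp
  qed
  have b1: "has_bochner_integral lborel (\<lambda>x. (w x)\<^sup>2) M"
    by (rule has_bochner_integral_nn_integral[OF _ _ M0 w2]) auto
  have b2: "has_bochner_integral lborel (\<lambda>x. (w' x)\<^sup>2) P"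
    by (rule has_bochner_integral_nn_integral[OF _ _ P0 w'2]) auto
  \<comment> \<open>The first integral times \<open>(w x)\<^sup>2\<close> expresses the power
    through the two squares, so the third integral follows from the other two.\<close>
  have pw: "w x powr (2 * q + 2) = (\<omega> * (w x)\<^sup>2 - (w' x)\<^sup>2) / k" for x
  proof -
    have wp: "w x > 0" by (simp add: w_def fpos)
    have w2x: "(w x)\<^sup>2 = w x powr 2" using wp by simp
    have "w x powr (2 * q + 2) = ((w x)\<^sup>2) powr q * (w x)\<^sup>2"
      unfolding w2x powr_powr powr_add[symmetric] ..
    moreover have "(w' x)\<^sup>2 = (r * T \<bar>x\<bar>)\<^sup>2 * (w x)\<^sup>2" by (simp add: w'_def w_def power_mult_distrib)
    then have "(w' x)\<^sup>2 = (\<omega> - k * ((w x)\<^sup>2) powr q) * (w x)\<^sup>2"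
      unfolding fq[symmetric] by (simp add: w_def)
    ultimately show ?thesis using k by (simp add: field_simps)
  qed
  have b3: "has_bochner_integral lborel (\<lambda>x. w x powr (2 * q + 2)) ((\<omega> * M - P) / k)"
    unfolding pw by (intro has_bochner_integral_divide_zero has_bochner_integral_diff has_bochner_integral_mult_right b1 b2)
  have wc: "continuous_on UNIV w"
    unfolding w_def
    by (rule continuous_on_compose2[of UNIV f])
       (use fd in \<open>auto intro!: continuous_at_imp_continuous_on continuous_intros DERIV_isCont\<close>)
  have wd: "(w has_real_derivative w' x) (at x)" if x: "x \<noteq> 0" for x
  proof (cases "x > 0")
    case True
    have "(f has_real_derivative w' x) (at x)" using fd[of x] True by (simp add: w'_def)
    then show ?thesis
      by (rule has_field_derivative_transform_within_open[where S = "{0<..}"]) (use True in \<open>auto simp: w_def\<close>)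
  next
    case False
    then have x: "x < 0" using x by simp
    have "((\<lambda>x. f (- x)) has_real_derivative - (r * T (- x) * f (- x)) * - 1) (at x)"
      by (rule DERIV_chain2[OF fd]) (auto intro!: derivative_eq_intros)
    then have "((\<lambda>x. f (- x)) has_real_derivative w' x) (at x)" using x by (simp add: w'_def)
    then show ?thesis
      by (rule has_field_derivative_transform_within_open[where S = "{..<0}"]) (use x in \<open>auto simp: w_def\<close>)
  qed
  show ?thesis
    by (rule exI[of _ w], rule exI[of _ w'])
       (use wc wd wm b1 b2 b3 f0 fpos in \<open>auto simp: w_def M_def P_def \<omega>_def\<close>)
qed

end

section \<open>Lower bounds for the energy\<close>

text \<open>Chebyshev's inequality on a window. An integrable function need not tend to 0 at
  infinity, but one small value on either side of \<open>x0\<close> suffices to let the variation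
  start and end near 0.\<close>

lemma integrable_small_value:
  fixes s :: "real \<Rightarrow> real"
  assumes s: "integrable lborel s" "\<And>x. s x \<ge> 0" and \<delta>: "\<delta> > 0"
  shows "\<exists>N>0. \<forall>p. \<exists>x\<in>{p..p + N}. s x < \<delta>"
proof -
  define N where "N = ((LINT x|lborel. s x) + 1) / \<delta>"
  have I: "(LINT x|lborel. s x) \<ge> 0" by (rule Bochner_Integration.integral_nonneg) (rule s(2))
  have N: "N > 0" "N * \<delta> > (LINT x|lborel. s x)" using I \<delta> by (simp_all add: N_def)
  have "\<exists>x\<in>{p..p + N}. s x < \<delta>" for p
  proof (rule ccontr)
    assume "\<not> ?thesis"
    then have le: "indicator {p..p + N} x * \<delta> \<le> s x" for x
      using s(2)[of x] by (auto simp: indicator_def not_less)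
    have "(LINT x|lborel. indicator {p..p + N} x * \<delta>) \<le> (LINT x|lborel. s x)"
      by (rule integral_mono[OF integrable_mult_left[OF integrable_real_indicator] s(1) le]) (use N(1) in auto)
    then show False using N by simp
  qed
  then show ?thesis using N(1) by blast
qed

text \<open>The Modica-Mortola (Bogomolny) estimate: the energy density \<open>e\<close> controls the variation of
  \<open>P (s x)\<close>, which starts at \<open>0\<close>, reaches \<open>P (s x0)\<close> and returns to \<open>0\<close>.\<close>
lemma two_sided_variation_le:
  fixes s e :: "real \<Rightarrow> real"
  assumes s: "\<And>x. (s has_real_derivative s' x) (at x)" "\<And>x. s x \<in> I" "\<And>x. s x \<ge> 0" "integrable lborel s"
    and P: "\<And>t. t \<in> I \<Longrightarrow> (P has_real_derivative P' t) (at t within I)" "P 0 = 0" "0 \<in> I"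
    and e: "integrable lborel e" "\<And>x. \<bar>P' (s x) * s' x\<bar> \<le> e x"
  shows "2 * P (s x0) \<le> (LINT x|lborel. e x)"
proof -
  have D: "((\<lambda>x. P (s x)) has_vector_derivative P' (s x) * s' x) (at x)" for x
  proof -
    \<comment> \<open>\<open>P\<close> need only be differentiable relative to \<open>I\<close>,
      because \<open>s\<close> may touch an endpoint of \<open>I\<close>; the chain rule takes place
      within the range of \<open>s\<close>.\<close>
    have "(P has_field_derivative P' (s x)) (at (s x) within range s)"
      using P(1)[OF s(2)] by (rule has_field_derivative_subset) (use s(2) in auto)
    from DERIV_image_chain[OF this s(1)[of x]] show ?thesis
      by (simp add: comp_def has_real_derivative_iff_has_vector_derivative)
  qed
  have eint: "e integrable_on S" if "S \<in> sets borel" for S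
  proof -
    have "e absolutely_integrable_on UNIV" using e(1) by (simp add: set_integrable_def integrable_completion)
    then have "e absolutely_integrable_on S" by (rule set_integrable_subset) (use that in auto)
    then show ?thesis by (rule set_lebesgue_integral_eq_integral(1))
  qed
  have e0: "e x \<ge> 0" for x using e(2)[of x] by linarith
  have eI: "integral UNIV e = (LINT x|lborel. e x)" using has_integral_integral_lborel[OF e(1)] by (rule integral_unique)
  have var: "\<bar>P (s b) - P (s a)\<bar> \<le> integral {a..b} e" if "a \<le> b" for a b
  proof -
    have hi: "((\<lambda>x. P' (s x) * s' x) has_integral P (s b) - P (s a)) {a..b}"
      by (rule fundamental_theorem_of_calculus[OF that]) (use D has_vector_derivative_at_within in blast)
    then have "norm (integral {a..b} (\<lambda>x. P' (s x) * s' x)) \<le> integral {a..b} e"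
      by (intro integral_norm_bound_integral) (use e(2) eint in auto)
    then show ?thesis using integral_unique[OF hi] by simp
  qed
  have main: "2 * P (s x0) \<le> (LINT x|lborel. e x) + 2 * r" if r: "r > 0" for r
  proof -
    have "continuous (at 0 within I) P" using DERIV_continuous[OF P(1)[OF P(3)]] .
    then obtain \<delta> where \<delta>: "\<delta> > 0" "\<And>t. t \<in> I \<Longrightarrow> \<bar>t - 0\<bar> < \<delta> \<Longrightarrow> \<bar>P t - P 0\<bar> < r"
      using r unfolding continuous_within_eps_delta dist_real_def by blast
    obtain N where N: "N > 0" "\<And>p. \<exists>x\<in>{p..p + N}. s x < \<delta>"
      using integrable_small_value[OF s(4,3) \<delta>(1)] by blast
    obtain a where a: "a \<le> x0" "s a < \<delta>" using N(2)[of "x0 - N"] by auto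
    obtain b where b: "x0 \<le> b" "s b < \<delta>" using N(2)[of x0] by auto
    have "\<bar>P (s a)\<bar> < r" "\<bar>P (s b)\<bar> < r" using \<delta>(2)[OF s(2)] a b s(3) P(2) by auto
    moreover have "integral {a..x0} e + integral {x0..b} e = integral {a..b} e"
      by (rule Henstock_Kurzweil_Integration.integral_combine[OF a(1) b(1) eint]) simp
    moreover have "integral {a..b} e \<le> integral UNIV e"
      by (rule integral_subset_le) (use eint e0 in auto)
    ultimately show ?thesis using var[OF a(1)] var[OF b(1)] eI by linarith
  qed
  show ?thesis
  proof (rule field_le_epsilon)
    fix r :: real assume "r > 0"
    then show "2 * P (s x0) \<le> (LINT x|lborel. e x) + r" using main[of "r / 2"] by simp
  qed
qed

text \<open>The bound of \<open>act_mass_lower\<close>, from which the maximum of the slice has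
  disappeared: linear in \<mu> at the ground state mass, up to the cubic correction.\<close>

definition psi :: "real \<Rightarrow> real \<Rightarrow> real \<Rightarrow> real \<Rightarrow> real \<Rightarrow> real" where
  "psi g k q \<theta>0 \<mu> = (let m = gmass g k q \<theta>0 in act g k q \<theta>0 - freq g k q \<theta>0 * m / 2
     - freq g k q \<theta>0 / 2 * (\<mu> - m) - k * \<theta>0 powr q / (6 * m\<^sup>2) * ((\<mu> - m)\<^sup>2 * (2 * m + \<mu>)))"

text \<open>A lower bound for the energy of one slice, stated as an upper bound for the power term.
  In this form it can be integrated over the slices and passed to the limit by Fatou's
  lemma.\<close>

lemma slice_estimate:
  fixes w w' :: "real \<Rightarrow> complex"
  assumes gkq: "g > 0" "k > 0" "0 < q" "q < 1" and t0: "\<theta>0 > 0" "gmass g k q \<theta>0 > 0"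
    and d: "\<And>x. (w has_vector_derivative w' x) (at x)" and w'm: "w' \<in> borel_measurable borel"
    and int: "integrable lborel (\<lambda>x. (cmod (w x))\<^sup>2)" "integrable lborel (\<lambda>x. (cmod (w' x))\<^sup>2)"
  shows "integrable lborel (\<lambda>x. cmod (w x) powr (2 * q + 2))"
    "k * (LINT x|lborel. cmod (w x) powr (2 * q + 2)) \<le> (LINT x|lborel. (cmod (w' x))\<^sup>2)
        - 2 * g * (cmod (w 0))\<^sup>2 - 2 * psi g k q \<theta>0 (LINT x|lborel. (cmod (w x))\<^sup>2)"
proof -
  define s where "s x = (cmod (w x))\<^sup>2" for x
  define s' where "s' x = 2 * (w x \<bullet> w' x)" for x
  define \<mu> where "\<mu> = (LINT x|lborel. s x)"
  have wc: "continuous_on UNIV w"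
    using d by (intro continuous_at_imp_continuous_on) (auto intro: has_vector_derivative_continuous)
  have wm [measurable]: "w \<in> borel_measurable borel" using wc by (rule borel_measurable_continuous_onI)
  have sm [measurable]: "s \<in> borel_measurable borel" unfolding s_def[abs_def] by measurable
  have s_deriv: "(s has_real_derivative s' x) (at x)" for x
  proof -
    have "((\<lambda>x. w x \<bullet> w x) has_vector_derivative w x \<bullet> w' x + w' x \<bullet> w x) (at x)"
      by (rule bounded_bilinear.has_vector_derivative[OF bounded_bilinear_inner d d])
    then show ?thesis
      unfolding s_def[abs_def] s'_def has_real_derivative_iff_has_vector_derivative power2_norm_eq_inner
      by (simp add: inner_commute)
  qed
  have s0: "s x \<ge> 0" for x by (simp add: s_def)
  have s'_le: "\<bar>s' x\<bar> \<le> 2 * (cmod (w x) * cmod (w' x))" for x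
    using Cauchy_Schwarz_ineq2[of "w x" "w' x"] by (simp add: s'_def abs_mult)
  have sint: "integrable lborel s" using int(1) by (simp add: s_def[abs_def])
  have ab: "2 * (a * b) \<le> a\<^sup>2 + b\<^sup>2" for a b :: real
    using zero_le_power2[of "a - b"] by (simp add: power2_eq_square algebra_simps)
  define C where "C = (LINT x|lborel. (cmod (w x))\<^sup>2 + (cmod (w' x))\<^sup>2)"
  \<comment> \<open>A first use of the variation estimate, with \<open>P\<close> the identity,
    bounds the slice; only then is its supremum \<theta> available to define the frequency.\<close>
  have "2 * s x \<le> C" for x
    unfolding C_def
  proof (rule two_sided_variation_le[where s = s and s' = s' and I = "{0..}" and P = "\<lambda>t. t" and P' = "\<lambda>_. 1"])
    show "\<bar>1 * s' x\<bar> \<le> (cmod (w x))\<^sup>2 + (cmod (w' x))\<^sup>2" for x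
      using s'_le[of x] ab[of "cmod (w x)" "cmod (w' x)"] by simp
  qed (use s_deriv s0 sint int in auto)
  then have bdd: "bdd_above (range s)" by (intro bdd_aboveI[of _ "C / 2"]) (auto simp: field_simps)
  define \<theta> where "\<theta> = (SUP x. s x)"
  have s_le: "s x \<le> \<theta>" for x unfolding \<theta>_def by (rule cSUP_upper[OF _ bdd]) simp
  have \<theta>: "\<theta> \<ge> 0" using s0[of 0] s_le[of 0] by linarith
  have pw: "cmod (w x) powr (2 * q + 2) = s x powr q * s x" for x
  proof (cases "w x = 0")
    case False
    then have c: "cmod (w x) > 0" by simp
    have s2: "s x = cmod (w x) powr 2" using c by (simp add: s_def)
    show ?thesis unfolding s2 powr_powr powr_add[symmetric] ..
  qed (use gkq in \<open>simp add: s_def\<close>)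
  show pint: "integrable lborel (\<lambda>x. cmod (w x) powr (2 * q + 2))"
    unfolding pw
  proof (rule Bochner_Integration.integrable_bound)
    show "integrable lborel (\<lambda>x. \<theta> powr q * s x)" by (intro integrable_mult_right sint)
    show "AE x in lborel. norm (s x powr q * s x) \<le> norm (\<theta> powr q * s x)"
      using s0 s_le gkq by (intro AE_I2) (auto simp: abs_mult intro!: mult_right_mono powr_mono2)
  qed measurable
  define fr where "fr = freq g k q \<theta>"
  define h where "h t = sqrt (fr - k * t powr q)" for t
  have hc: "continuous_on {0..\<theta>} h"
    unfolding h_def using gkq
    by (intro continuous_on_real_sqrt continuous_on_diff continuous_on_mult continuous_on_const continuous_on_powr' continuous_on_id) auto
  have h2: "fr - k * t powr q \<ge> 0" if "t \<in> {0..\<theta>}" for t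
  proof -
    have "k * t powr q \<le> k * \<theta> powr q" using that gkq by (intro mult_left_mono powr_mono2) auto
    then show ?thesis using zero_le_power2[of g] unfolding fr_def freq_def by linarith
  qed
  define P where "P t = integral {0..t} h" for t
  \<comment> \<open>This density exceeds the variation of \<open>P (s x)\<close> by a complete
    square, namely the one that vanishes for a ground state.\<close>
  define e where "e x = (cmod (w' x))\<^sup>2 + (fr * s x - k * (s x powr q * s x))" for x
  have eint: "integrable lborel e"
    unfolding e_def[abs_def] using int(2) sint pint[unfolded pw] by auto
  have PD: "(P has_real_derivative h t) (at t within {0..\<theta>})" if "t \<in> {0..\<theta>}" for t
    unfolding P_def[abs_def] has_real_derivative_iff_has_vector_derivative
    by (rule integral_has_vector_derivative[OF hc that])
  have P0: "P 0 = 0" by (simp add: P_def)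
  have Px: "2 * P (s x) \<le> (LINT x|lborel. e x)" for x
  proof (rule two_sided_variation_le[where s = s and s' = s' and I = "{0..\<theta>}" and P' = h])
    show "\<bar>h (s x) * s' x\<bar> \<le> e x" for x
    proof -
      have hs: "fr - k * s x powr q \<ge> 0" using s0 s_le by (intro h2) auto
      have "\<bar>h (s x) * s' x\<bar> \<le> h (s x) * (2 * (cmod (w x) * cmod (w' x)))"
        unfolding abs_mult using s'_le hs by (intro mult_mono) (auto simp: h_def)
      also have "\<dots> = 2 * ((h (s x) * cmod (w x)) * cmod (w' x))" by simp
      also have "\<dots> \<le> (h (s x) * cmod (w x))\<^sup>2 + (cmod (w' x))\<^sup>2" by (rule ab)
      also have "(h (s x) * cmod (w x))\<^sup>2 = (fr - k * s x powr q) * s x"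
        using hs by (simp add: h_def power_mult_distrib s_def)
      finally show ?thesis by (simp add: e_def algebra_simps)
    qed
  qed (use s_deriv s0 s_le sint eint PD \<theta> P0 in auto)
  have "2 * P \<theta> \<le> (LINT x|lborel. e x)"
  proof (cases "\<theta> = 0")
    case True then show ?thesis using Px[of 0] s0[of 0] s_le[of 0] by (simp add: P_def)
  next
    case False
    then have t: "\<theta> > 0" using \<theta> by simp
    have mono: "P a \<le> P b" if "0 \<le> a" "a \<le> b" "b \<le> \<theta>" for a b
      unfolding P_def
      by (rule integral_subset_le)
         (use that h2 in \<open>auto intro!: integrable_continuous_real continuous_on_subset[OF hc] simp: h_def\<close>)
    \<comment> \<open>The supremum is approached by values of \<open>s\<close>; since
      \<open>P\<close> is increasing and continuous from the left at \<theta>, the bound passes to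
      it.\<close>
    have "continuous (at \<theta> within {0..\<theta>}) P" using DERIV_continuous[OF PD] t by auto
    then have "(P \<longlongrightarrow> P \<theta>) (at_left \<theta>)"
      using t by (simp add: continuous_within at_within_Icc_at_left)
    moreover have "\<forall>\<^sub>F t in at_left \<theta>. P t \<le> (LINT x|lborel. e x) / 2"
      unfolding eventually_at_left_field
    proof (intro exI[of _ 0] conjI allI impI t)
      fix a assume a: "0 < a" "a < \<theta>"
      then obtain x where "a < s x" unfolding \<theta>_def less_cSUP_iff[OF UNIV_not_empty bdd] by blast
      then have "P a \<le> P (s x)" using a s_le by (intro mono) auto
      then show "P a \<le> (LINT x|lborel. e x) / 2" using Px[of x] by simp
    qed
    ultimately have "P \<theta> \<le> (LINT x|lborel. e x) / 2"
      by (intro tendsto_upperbound) (use t in \<open>auto simp: trivial_limit_at_left_real\<close>)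
    then show ?thesis by simp
  qed
  moreover have "P \<theta> = act g k q \<theta> + g * \<theta>"
  proof (cases "\<theta> = 0")
    case True then show ?thesis by (simp add: P_def act_def)
  next
    case False
    then show ?thesis using act_eq[OF gkq, of \<theta>] \<theta> by (simp add: P_def h_def[abs_def] fr_def)
  qed
  moreover have "(LINT x|lborel. e x) = (LINT x|lborel. (cmod (w' x))\<^sup>2) + (fr * \<mu> - k * (LINT x|lborel. cmod (w x) powr (2 * q + 2)))"
    unfolding e_def[abs_def] pw \<mu>_def using int(2) sint pint[unfolded pw] by simp
  moreover have "psi g k q \<theta>0 \<mu> \<le> act g k q \<theta> - fr * \<mu> / 2"
  proof -
    have "\<mu> \<ge> 0" unfolding \<mu>_def by (rule Bochner_Integration.integral_nonneg) (rule s0)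
    then show ?thesis
      using act_mass_lower[OF gkq t0(1) \<theta> _ refl t0(2)] by (simp add: psi_def Let_def fr_def)
  qed
  \<comment> \<open>The delta acts at 0, whereas \<theta> is the supremum over the line; as
    \<open>g\<close> is positive, replacing \<open>s 0\<close> by \<theta> errs in the right
    direction.\<close>
  moreover have "g * s 0 \<le> g * \<theta>" using gkq s_le by (intro mult_left_mono) auto
  ultimately show "k * (LINT x|lborel. cmod (w x) powr (2 * q + 2)) \<le> (LINT x|lborel. (cmod (w' x))\<^sup>2)
        - 2 * g * (cmod (w 0))\<^sup>2 - 2 * psi g k q \<theta>0 (LINT x|lborel. (cmod (w x))\<^sup>2)"
    unfolding \<mu>_def s_def by linarith
qed

section \<open>From the slices to the strip\<close>

lemma slice_mass_diff_le:
  assumes L: "L > 0" and L2: "L2_fun lborel v" "L2_fun lborel b" and c: "continuous_on UNIV v" "continuous_on UNIV b"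
    and d: "\<And>x y. y \<in> {0..L} \<Longrightarrow> ((\<lambda>y. v (x, y)) has_vector_derivative b (x, y)) (at y)"
    and y: "y1 \<in> {0..L}" "y2 \<in> {0..L}" "y1 \<le> y2"
    and int: "integrable lborel (\<lambda>x. (cmod (v (x, y1)))\<^sup>2)" "integrable lborel (\<lambda>x. (cmod (v (x, y2)))\<^sup>2)"
    and t: "t > 0"
  shows "\<bar>(LINT x|lborel. (cmod (v (x, y2)))\<^sup>2) - (LINT x|lborel. (cmod (v (x, y1)))\<^sup>2)\<bar> \<le> t * mass L v + mass L b / t"
proof -
  \<comment> \<open>Majorant of the vertical derivative of the squared modulus, by the inequality of
    arithmetic and geometric means with a free weight \<open>t\<close>. Unlike the product, it is
    linear in the two squares and integrates by Fubini's theorem.\<close>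
  define f where "f x y = t * (cmod (restr L v (x, y)))\<^sup>2 + (cmod (restr L b (x, y)))\<^sup>2 / t" for x y
  have fint: "integrable (lborel \<Otimes>\<^sub>M lborel) (case_prod f)"
    unfolding lborel_prod f_def case_prod_beta'
    using L2_fun_integrable[OF restr_L2[OF L2(1)], of L] L2_fun_integrable[OF restr_L2[OF L2(2)], of L] by simp
  have m0: "(LINT z|lborel. (cmod (restr L w z))\<^sup>2) = mass L w" if "L2_fun lborel w" for w
    using mass_restr[of w "\<lambda>_. 0" L] L2_fun_measurable[OF that] by simp
  have "(LINT x|lborel. LINT y|lborel. f x y) = (LINT z|lborel. f (fst z) (snd z))"
    unfolding lborel_pair.integral_fst[OF fint] lborel_prod by (simp add: case_prod_beta')
  also have "\<dots> = t * mass L v + mass L b / t"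
    using L2_fun_integrable[OF restr_L2[OF L2(1)], of L] L2_fun_integrable[OF restr_L2[OF L2(2)], of L]
    by (simp add: f_def m0[OF L2(1)] m0[OF L2(2)])
  finally have fI: "(LINT x|lborel. LINT y|lborel. f x y) = t * mass L v + mass L b / t" .
  have slice: "\<bar>(cmod (v (x, y2)))\<^sup>2 - (cmod (v (x, y1)))\<^sup>2\<bar> \<le> (LINT y|lborel. f x y)" for x
  proof -
    define s' where "s' y = 2 * (v (x, y) \<bullet> b (x, y))" for y
    have cx: "continuous_on S (\<lambda>y. v (x, y))" "continuous_on S (\<lambda>y. b (x, y))" for S
      by (intro continuous_on_compose2[OF c(1)] continuous_on_compose2[OF c(2)] continuous_on_Pair continuous_on_id continuous_on_const; simp)+
    have cs': "continuous_on {y1..y2} s'"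
      unfolding s'_def by (intro continuous_on_mult continuous_on_const continuous_on_inner cx)
    have der: "((\<lambda>y. (cmod (v (x, y)))\<^sup>2) has_vector_derivative s' y) (at y within {y1..y2})" if "y1 \<le> y" "y \<le> y2" for y
    proof -
      have "((\<lambda>y. v (x, y) \<bullet> v (x, y)) has_vector_derivative v (x, y) \<bullet> b (x, y) + b (x, y) \<bullet> v (x, y)) (at y)"
        by (rule bounded_bilinear.has_vector_derivative[OF bounded_bilinear_inner d d]) (use that y in auto)
      then have "((\<lambda>y. (cmod (v (x, y)))\<^sup>2) has_vector_derivative s' y) (at y)"
        unfolding s'_def power2_norm_eq_inner by (simp add: inner_commute)
      then show ?thesis by (rule has_vector_derivative_at_within)
    qed
    have "(cmod (v (x, y2)))\<^sup>2 - (cmod (v (x, y1)))\<^sup>2 = (LINT y|lborel. indicator {y1..y2} y *\<^sub>R s' y)"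
      by (rule integral_FTC_Icc[OF y(3) der cs', symmetric])
    also have "\<bar>\<dots>\<bar> \<le> (LINT y|lborel. \<bar>indicator {y1..y2} y *\<^sub>R s' y\<bar>)" by (rule integral_abs_bound)
    also have "\<dots> \<le> (LINT y|lborel. f x y)"
    proof (rule integral_mono)
      show "integrable lborel (\<lambda>y. \<bar>indicator {y1..y2} y *\<^sub>R s' y\<bar>)"
        by (intro integrable_abs) (use borel_integrable_compact[OF _ cs'] in simp)
      have "continuous_on {0..L} (\<lambda>y. t * (cmod (v (x, y)))\<^sup>2 + (cmod (b (x, y)))\<^sup>2 / t)"
        using t by (intro continuous_intros cx) auto
      then have "integrable lborel (\<lambda>y. indicator {0..L} y *\<^sub>R (t * (cmod (v (x, y)))\<^sup>2 + (cmod (b (x, y)))\<^sup>2 / t))"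
        by (rule borel_integrable_compact[OF compact_Icc])
      also have "(\<lambda>y. indicator {0..L} y *\<^sub>R (t * (cmod (v (x, y)))\<^sup>2 + (cmod (b (x, y)))\<^sup>2 / t)) = f x"
        by (auto simp: fun_eq_iff f_def restr_def strip_def indicator_def)
      finally show "integrable lborel (f x)" .
      fix y'
      show "\<bar>indicator {y1..y2} y' *\<^sub>R s' y'\<bar> \<le> f x y'"
      proof (cases "y' \<in> {y1..y2}")
        case False then show ?thesis using t by (simp add: f_def)
      next
        case True
        then have in_s: "(x, y') \<in> strip L" using y by (simp add: strip_def)
        have "\<bar>s' y'\<bar> \<le> 2 * (cmod (v (x, y')) * cmod (b (x, y')))"
          using Cauchy_Schwarz_ineq2[of "v (x, y')" "b (x, y')"] by (simp add: s'_def abs_mult)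
        also have "\<dots> \<le> t * (cmod (v (x, y')))\<^sup>2 + (cmod (b (x, y')))\<^sup>2 / t"
        proof -
          have "0 \<le> (t * cmod (v (x, y')) - cmod (b (x, y')))\<^sup>2 / t" using t by simp
          also have "\<dots> = t * (cmod (v (x, y')))\<^sup>2 + (cmod (b (x, y')))\<^sup>2 / t - 2 * (cmod (v (x, y')) * cmod (b (x, y')))"
            using t by (simp add: power2_eq_square field_simps)
          finally show ?thesis by simp
        qed
        finally show ?thesis using True in_s by (simp add: f_def)
      qed
    qed
    finally show ?thesis .
  qed
  have "\<bar>(LINT x|lborel. (cmod (v (x, y2)))\<^sup>2) - (LINT x|lborel. (cmod (v (x, y1)))\<^sup>2)\<bar>
      = \<bar>LINT x|lborel. (cmod (v (x, y2)))\<^sup>2 - (cmod (v (x, y1)))\<^sup>2\<bar>" using int by simp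
  also have "\<dots> \<le> (LINT x|lborel. \<bar>(cmod (v (x, y2)))\<^sup>2 - (cmod (v (x, y1)))\<^sup>2\<bar>)" by (rule integral_abs_bound)
  also have "\<dots> \<le> (LINT x|lborel. LINT y|lborel. f x y)"
    by (rule integral_mono) (use int slice lborel_pair.integrable_fst[OF fint] in auto)
  finally show ?thesis unfolding fI .
qed

text \<open>With \<open>slice_mass_diff_le\<close>, this amounts to the Cauchy-Schwarz inequality.\<close>
lemma sq_le_of_weighted:
  assumes "\<And>t::real. t > 0 \<Longrightarrow> d \<le> t * X + D / t" "d \<ge> 0" "X \<ge> 0" "D \<ge> 0"
  shows "d\<^sup>2 \<le> 4 * X * D"
proof (cases "d = 0")
  case False
  then have d: "d > 0" using assms by simp
  have "X > 0"
  proof (rule ccontr)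
    assume "\<not> X > 0"
    then have "X = 0" using assms by simp
    \<comment> \<open>For \<open>X = 0\<close> any sufficiently large \<open>t\<close> is
      contradictory; this one makes \<open>D / t\<close> less than \<open>d\<close>.\<close>
    then have "d \<le> D / (2 * (D + 1) / d)" using assms(1)[of "2 * (D + 1) / d"] d assms(4) by simp
    also have "\<dots> = d * (D / (2 * (D + 1)))" using d by simp
    also have "\<dots> < d * 1" using d assms(4) by (intro mult_strict_left_mono) auto
    finally show False by simp
  qed
  \<comment> \<open>With this \<open>t\<close> the first term is \<open>d / 2\<close>, which is
    absorbed on the left.\<close>
  then have "d \<le> d / (2 * X) * X + D / (d / (2 * X))" using d by (intro assms(1)) simp
  then show ?thesis using d \<open>X > 0\<close> by (simp add: field_simps power2_eq_square)
qed (use assms in simp)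

text \<open>\<open>R\<close> bounds the squared deviation of every slice mass from \<open>m\<close>:
  one part for the deviation from the mean \<open>mass L v / L\<close>, one for that of the mean
  from \<open>m\<close>. The second part is there because mollification changes the mass; it
  vanishes in the limit. \<open>B\<close> is the integral of the slice bounds, divided by
  \<open>k\<close>.\<close>

lemma strip_estimate:
  fixes v a b :: "real \<times> real \<Rightarrow> complex"
  assumes gkq: "g > 0" "k > 0" "0 < q" "q < 1" and t0: "\<theta>0 > 0" "gmass g k q \<theta>0 > 0" and L: "L > 0"
    and L2: "L2_fun lborel v" "L2_fun lborel a" "L2_fun lborel b"
    and c: "continuous_on UNIV v" "continuous_on UNIV a" "continuous_on UNIV b"
    and dx: "\<And>x y. y \<in> {0..L} \<Longrightarrow> ((\<lambda>x. v (x, y)) has_vector_derivative a (x, y)) (at x)"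
    and dy: "\<And>x y. y \<in> {0..L} \<Longrightarrow> ((\<lambda>y. v (x, y)) has_vector_derivative b (x, y)) (at y)"
  defines "m \<equiv> gmass g k q \<theta>0"
  defines "C0 \<equiv> act g k q \<theta>0 - freq g k q \<theta>0 * m / 2" and "K \<equiv> k * \<theta>0 powr q / (6 * m\<^sup>2)"
  defines "R \<equiv> 8 * mass L v * mass L b + 2 * (mass L v / L - m)\<^sup>2"
  defines "B \<equiv> (mass L a - 2 * g * (LINT y|lebesgue_on {0..L}. (cmod (v (0, y)))\<^sup>2)
        - 2 * (L * C0 - freq g k q \<theta>0 / 2 * (mass L v - L * m) - K * (R * (2 * m * L + mass L v)))) / k"
  shows "0 \<le> B" "(\<integral>\<^sup>+z. ennreal (indicator (strip L) z * cmod (v z) powr (2 * q + 2)) \<partial>lborel) \<le> ennreal B"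
proof -
  define I where "I y = (indicator {0..L} y :: real)" for y
  have m: "m > 0" using t0 by (simp add: m_def)
  have K: "K \<ge> 0" using gkq by (simp add: K_def)
  define X where "X = mass L v"
  define D where "D = mass L b"
  have X: "X \<ge> 0" "D \<ge> 0" by (auto simp: X_def D_def mass_nonneg)
  have vi: "integrable (lborel \<Otimes>\<^sub>M lborel) (\<lambda>(x, y). (cmod (restr L w (x, y)))\<^sup>2)" if "L2_fun lborel w" for w
    unfolding lborel_prod case_prod_beta' using L2_fun_integrable[OF restr_L2[OF that], of L] by simp
  have m0: "(LINT z|lborel. (cmod (restr L w z))\<^sup>2) = mass L w" if "L2_fun lborel w" for w
    using mass_restr[of w "\<lambda>_. 0" L] L2_fun_measurable[OF that] by simp
  define sl where "sl w y = (LINT x|lborel. (cmod (restr L w (x, y)))\<^sup>2)" for w y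
  have slint: "integrable lborel (sl w)" "(LINT y|lborel. sl w y) = mass L w" if "L2_fun lborel w" for w
    using lborel_pair.integrable_snd[OF vi[OF that]] lborel_pair.integral_snd[OF vi[OF that]] m0[OF that]
    by (simp_all add: sl_def[abs_def] lborel_prod case_prod_beta')
  have sl0: "sl w y = 0" if "y \<notin> {0..L}" for w y using that by (simp add: sl_def strip_def)
  have sle: "sl w y = (LINT x|lborel. (cmod (w (x, y)))\<^sup>2)" if "y \<in> {0..L}" for w y
    using that by (simp add: sl_def strip_def)
  have slnn: "sl w y \<ge> 0" for w y unfolding sl_def by (rule Bochner_Integration.integral_nonneg) auto
  have Iint: "integrable lborel I" "(LINT y|lborel. I y) = L"
    unfolding I_def[abs_def] using L by (auto intro!: integrable_real_indicator)
  \<comment> \<open>Fubini's theorem provides square integrable slices for almost every height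
    only.\<close>
  define good where "good y \<longleftrightarrow> integrable lborel (\<lambda>x. (cmod (restr L v (x, y)))\<^sup>2) \<and> integrable lborel (\<lambda>x. (cmod (restr L a (x, y)))\<^sup>2)" for y
  have good: "AE y in lborel. good y"
    unfolding good_def using lborel_pair.AE_integrable_snd[OF vi[OF L2(1)]] lborel_pair.AE_integrable_snd[OF vi[OF L2(2)]]
    by eventually_elim simp
  have goodI: "integrable lborel (\<lambda>x. (cmod (v (x, y)))\<^sup>2)" "integrable lborel (\<lambda>x. (cmod (a (x, y)))\<^sup>2)" if "good y" "y \<in> {0..L}" for y
    using that by (simp_all add: good_def strip_def)
  have diff: "(sl v y1 - sl v y2)\<^sup>2 \<le> 4 * X * D" if y: "good y1" "good y2" "y1 \<in> {0..L}" "y2 \<in> {0..L}" for y1 y2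
  proof -
    have *: "\<bar>sl v y1 - sl v y2\<bar> \<le> t * X + D / t" if t: "t > 0" for t
    proof (cases "y1 \<le> y2")
      case True
      from slice_mass_diff_le[OF L L2(1,3) c(1,3) dy y(3,4) True goodI(1)[OF y(1,3)] goodI(1)[OF y(2,4)] t]
      show ?thesis using y by (simp add: sle X_def D_def abs_minus_commute)
    next
      case False
      then have "y2 \<le> y1" by simp
      from slice_mass_diff_le[OF L L2(1,3) c(1,3) dy y(4,3) this goodI(1)[OF y(2,4)] goodI(1)[OF y(1,3)] t]
      show ?thesis using y by (simp add: sle X_def D_def)
    qed
    have "(\<bar>sl v y1 - sl v y2\<bar>)\<^sup>2 \<le> 4 * X * D" by (rule sq_le_of_weighted[OF *]) (use X in auto)
    then show ?thesis by simp
  qed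
  \<comment> \<open>The mean of the slice masses is \<open>X / L\<close>; averaging the bound
    \<open>diff\<close> over the second height compares each slice with it.\<close>
  have mean: "(sl v y - X / L)\<^sup>2 \<le> 4 * X * D" if y: "good y" "y \<in> {0..L}" for y
  proof -
    define e where "e = sqrt (4 * X * D)"
    have e: "e \<ge> 0" "e\<^sup>2 = 4 * X * D" using X by (simp_all add: e_def)
    have "L * sl v y - X = (LINT y'|lborel. I y' * sl v y - sl v y')"
      using Iint slint[OF L2(1)] by (simp add: X_def)
    also have "\<bar>\<dots>\<bar> \<le> (LINT y'|lborel. \<bar>I y' * sl v y - sl v y'\<bar>)" by (rule integral_abs_bound)
    also have "\<dots> \<le> (LINT y'|lborel. I y' * e)"
    proof (rule integral_mono_AE)
      show "AE y' in lborel. \<bar>I y' * sl v y - sl v y'\<bar> \<le> I y' * e"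
        using good
      proof eventually_elim
        case (elim y')
        show ?case
        proof (cases "y' \<in> {0..L}")
          case True
          have "\<bar>sl v y - sl v y'\<bar> \<le> e" unfolding e_def using diff[OF y(1) elim y(2) True] real_le_rsqrt by fastforce
          then show ?thesis using True by (simp add: I_def)
        qed (simp add: I_def sl0)
      qed
    qed (use Iint slint[OF L2(1)] in auto)
    also have "\<dots> = L * e" using Iint by simp
    finally have le: "\<bar>L * sl v y - X\<bar> \<le> L * e" .
    have "L * sl v y - X = L * (sl v y - X / L)" using L by (simp add: right_diff_distrib)
    then have "\<bar>L * sl v y - X\<bar> = L * \<bar>sl v y - X / L\<bar>" using L by (simp only: abs_mult abs_of_pos)
    with le have "\<bar>sl v y - X / L\<bar> \<le> e" using L by simp
    then have "(\<bar>sl v y - X / L\<bar>)\<^sup>2 \<le> e\<^sup>2" by (intro power_mono) auto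
    then show ?thesis by (simp add: e)
  qed
  define H where "H y = sl a y - 2 * g * (I y * (cmod (v (0, y)))\<^sup>2)
      - 2 * (I y * C0 - freq g k q \<theta>0 / 2 * (sl v y - I y * m) - K * (R * (2 * m * I y + sl v y)))" for y
  have vc: "continuous_on UNIV (\<lambda>y. v (0, y))"
    by (intro continuous_on_compose2[OF c(1)] continuous_on_Pair continuous_on_id continuous_on_const) simp
  have Tint: "integrable lborel (\<lambda>y. I y * (cmod (v (0, y)))\<^sup>2)"
    "(LINT y|lborel. I y * (cmod (v (0, y)))\<^sup>2) = (LINT y|lebesgue_on {0..L}. (cmod (v (0, y)))\<^sup>2)"
  proof -
    have mb: "(\<lambda>y. (cmod (v (0, y)))\<^sup>2) \<in> borel_measurable borel"
      using borel_measurable_continuous_onI[OF vc] by measurable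
    have "integrable (lebesgue_on {0..L}) (\<lambda>y. (cmod (v (0, y)))\<^sup>2)"
      by (rule continuous_imp_integrable_real) (intro continuous_intros continuous_on_subset[OF vc]; simp)
    then show "integrable lborel (\<lambda>y. I y * (cmod (v (0, y)))\<^sup>2)"
      using integral_lebesgue_on(2)[OF mb, of "{0..L}"] by (simp add: I_def)
    show "(LINT y|lborel. I y * (cmod (v (0, y)))\<^sup>2) = (LINT y|lebesgue_on {0..L}. (cmod (v (0, y)))\<^sup>2)"
      using integral_lebesgue_on(1)[OF mb, of "{0..L}"] by (simp add: I_def)
  qed
  have Hint: "integrable lborel H" unfolding H_def[abs_def] using Tint(1) Iint(1) slint(1)[OF L2(1)] slint(1)[OF L2(2)] by simp
  have HI: "(LINT y|lborel. H y) = mass L a - 2 * g * (LINT y|lebesgue_on {0..L}. (cmod (v (0, y)))\<^sup>2)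
        - 2 * (L * C0 - freq g k q \<theta>0 / 2 * (mass L v - L * m) - K * (R * (2 * m * L + mass L v)))"
    unfolding H_def[abs_def] using Tint Iint slint[OF L2(1)] slint[OF L2(2)] by simp
  let ?N = "\<lambda>x y. indicator (strip L) (x, y) * cmod (v (x, y)) powr (2 * q + 2)"
  \<comment> \<open>Nonnegativity of \<open>H\<close> is recorded as well because
    \<open>ennreal\<close> sends negative numbers to 0; it allows \<open>ennreal (H y / k)\<close>
    to be integrated as a real function.\<close>
  have key: "AE y in lborel. (\<integral>\<^sup>+x. ennreal (?N x y) \<partial>lborel) \<le> ennreal (H y / k) \<and> 0 \<le> H y"
    using good
  proof eventually_elim
    case (elim y)
    show ?case
    proof (cases "y \<in> {0..L}")
      case False
      then show ?thesis by (simp add: strip_def H_def sl0 I_def)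
    next
      case True
      have am: "(\<lambda>x. a (x, y)) \<in> borel_measurable borel"
        using L2_fun_measurable[OF L2(2)] by (intro slice_measurable(1)) simp
      note se = slice_estimate[OF gkq t0 dx[OF True] am goodI[OF elim True], folded sle[OF True]]
      define \<mu> where "\<mu> = sl v y"
      have \<mu>: "\<mu> \<ge> 0" by (simp add: \<mu>_def slnn)
      have "(r + t)\<^sup>2 \<le> 2 * r\<^sup>2 + 2 * t\<^sup>2" for r t :: real
        using zero_le_power2[of "r - t"] by (simp add: power2_eq_square algebra_simps)
      from this[of "\<mu> - X / L" "X / L - m"]
      have "(\<mu> - m)\<^sup>2 \<le> 2 * (\<mu> - X / L)\<^sup>2 + 2 * (X / L - m)\<^sup>2" by simp
      also have "\<dots> \<le> R" using mean[OF elim True] by (simp add: R_def \<mu>_def X_def D_def mult.commute mult.left_commute)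
      finally have "(\<mu> - m)\<^sup>2 * (2 * m + \<mu>) \<le> R * (2 * m + \<mu>)" using \<mu> m by (intro mult_right_mono) auto
      \<comment> \<open>Only the square is estimated uniformly in \<open>y\<close>. The factor
        \<open>2 * m + \<mu>\<close> is kept, since its integral over the heights is
        explicit.\<close>
      then have "K * ((\<mu> - m)\<^sup>2 * (2 * m + \<mu>)) \<le> K * (R * (2 * m + \<mu>))" using K by (intro mult_left_mono)
      then have "C0 - freq g k q \<theta>0 / 2 * (\<mu> - m) - K * (R * (2 * m + \<mu>)) \<le> psi g k q \<theta>0 \<mu>"
        unfolding psi_def Let_def m_def[symmetric] C0_def[symmetric] K_def[symmetric] by simp
      then have le: "k * (LINT x|lborel. cmod (v (x, y)) powr (2 * q + 2)) \<le> H y"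
        using se(2) True by (simp add: H_def I_def \<mu>_def)
      have Inn: "(LINT x|lborel. cmod (v (x, y)) powr (2 * q + 2)) \<ge> 0" by (rule Bochner_Integration.integral_nonneg) simp
      have "(\<integral>\<^sup>+x. ennreal (?N x y) \<partial>lborel) = (\<integral>\<^sup>+x. ennreal (cmod (v (x, y)) powr (2 * q + 2)) \<partial>lborel)"
        using True by (intro nn_integral_cong) (simp add: strip_def)
      also have "\<dots> = ennreal (LINT x|lborel. cmod (v (x, y)) powr (2 * q + 2))"
        using se(1) by (intro nn_integral_eq_integral) auto
      also have "\<dots> \<le> ennreal (H y / k)" using le gkq(2) by (intro ennreal_leI) (simp add: field_simps)
      finally show ?thesis using order_trans[OF mult_nonneg_nonneg[OF less_imp_le[OF gkq(2)] Inn] le] by blast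
    qed
  qed
  have Nm: "(\<lambda>z. ennreal (indicator (strip L) z * cmod (v z) powr (2 * q + 2))) \<in> borel_measurable (lborel \<Otimes>\<^sub>M lborel)"
    unfolding lborel_prod using L2_fun_measurable[OF L2(1)] by measurable
  have "(\<integral>\<^sup>+z. ennreal (indicator (strip L) z * cmod (v z) powr (2 * q + 2)) \<partial>lborel) = (\<integral>\<^sup>+y. \<integral>\<^sup>+x. ennreal (?N x y) \<partial>lborel \<partial>lborel)"
    unfolding lborel_pair.nn_integral_snd[OF Nm] lborel_prod ..
  also have "\<dots> \<le> (\<integral>\<^sup>+y. ennreal (H y / k) \<partial>lborel)"
    using key by (intro nn_integral_mono_AE) (auto elim: AE_mp)
  also have "\<dots> = ennreal (LINT y|lborel. H y / k)"
    using Hint key gkq(2) by (intro nn_integral_eq_integral) (auto elim!: AE_mp)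
  finally show "(\<integral>\<^sup>+z. ennreal (indicator (strip L) z * cmod (v z) powr (2 * q + 2)) \<partial>lborel) \<le> ennreal B"
    using HI by (simp add: B_def)
  have "0 \<le> (LINT y|lborel. H y)" by (rule integral_nonneg_AE) (use key in \<open>auto elim: AE_mp\<close>)
  then show "0 \<le> B" using HI gkq(2) by (simp add: B_def)
qed

section \<open>Minimizers\<close>

lemma has_bochner_integral_strip:
  fixes \<phi> :: "real \<Rightarrow> real"
  assumes L: "L > 0" and \<phi>: "has_bochner_integral lborel \<phi> c" "\<And>x. \<phi> x \<ge> 0"
  shows "has_bochner_integral lborel (\<lambda>z. indicator (strip L) z * \<phi> (fst z)) (L * c)"
proof -
  have [measurable]: "\<phi> \<in> borel_measurable borel"
    using \<phi>(1) by (auto simp: has_bochner_integral_iff dest: borel_measurable_integrable)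
  have c: "c \<ge> 0" using \<phi> by (auto simp: has_bochner_integral_iff intro: Bochner_Integration.integral_nonneg)
  have m: "(\<lambda>z::real\<times>real. indicator (strip L) z * \<phi> (fst z)) \<in> borel_measurable (lborel \<Otimes>\<^sub>M lborel)"
  proof -
    have "strip L \<in> sets (lborel \<Otimes>\<^sub>M lborel)" unfolding lborel_prod using strip_borel by simp
    then show ?thesis by measurable
  qed
  have "(\<integral>\<^sup>+z. ennreal (indicator (strip L) z * \<phi> (fst z)) \<partial>lborel)
      = (\<integral>\<^sup>+z. ennreal (\<phi> (fst z)) * indicator {0..L} (snd z) \<partial>lborel)"
    by (rule nn_integral_cong) (auto simp: strip_def indicator_def)
  also have "\<dots> = (\<integral>\<^sup>+x. ennreal (\<phi> x) \<partial>lborel) * (\<integral>\<^sup>+y. indicator {0..L} y \<partial>lborel)"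
    by (rule nn_integral_lborel_times) measurable
  also have "(\<integral>\<^sup>+x. ennreal (\<phi> x) \<partial>lborel) = ennreal c"
    using \<phi> by (subst nn_integral_eq_integral) (auto simp: has_bochner_integral_iff)
  also have "ennreal c * (\<integral>\<^sup>+y. indicator {0..L} y \<partial>lborel) = ennreal (L * c)"
    using L c by (simp add: ennreal_mult[symmetric] mult.commute)
  finally have "(\<integral>\<^sup>+z. ennreal (indicator (strip L) z * \<phi> (fst z)) \<partial>lborel) = ennreal (L * c)" .
  then show ?thesis
    using m \<phi>(2) L c by (intro has_bochner_integral_nn_integral) (auto simp: lborel_prod)
qed

text \<open>Since the extended ground state is constant in \<open>y\<close>, its energy is exactly
  the lower bound of \<open>energy_lower_bound\<close> without the term in the vertical
  derivative.\<close>

lemma competitor: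
  assumes gkq: "g > 0" "k > 0" "0 < q" "q < 1" and t0: "\<theta>0 > 0" and L: "L > 0"
    and p: "p = 2 * q + 1" "k = 2 / (p + 1)"
  shows "\<exists>u. u \<in> H1 L \<and> mass L u = L * gmass g k q \<theta>0 \<and>
    energy (- 2 * g) p L u = L * (act g k q \<theta>0 - freq g k q \<theta>0 * gmass g k q \<theta>0 / 2)"
proof -
  obtain w w' where wc: "continuous_on UNIV w" and wd: "\<And>x. x \<noteq> 0 \<Longrightarrow> (w has_real_derivative w' x) (at x)"
    and w'm: "w' \<in> borel_measurable borel" and wpos: "\<And>x. w x > 0" and w0: "(w 0)\<^sup>2 = \<theta>0"
    and I1: "has_bochner_integral lborel (\<lambda>x. (w x)\<^sup>2) (gmass g k q \<theta>0)"
    and I2: "has_bochner_integral lborel (\<lambda>x. (w' x)\<^sup>2) (act g k q \<theta>0 + g * \<theta>0)"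
    and I3: "has_bochner_integral lborel (\<lambda>x. w x powr (2 * q + 2))
       ((freq g k q \<theta>0 * gmass g k q \<theta>0 - (act g k q \<theta>0 + g * \<theta>0)) / k)"
    using profile_exists[OF gkq t0] by blast
  have p1: "p + 1 = 2 * q + 2" using p(1) by simp
  have "k = 2 * (1 / (p + 1))" using p(2) by simp
  then have k2: "1 / (p + 1) = k / 2" by linarith
  define M where "M = gmass g k q \<theta>0"
  define P where "P = act g k q \<theta>0 + g * \<theta>0"
  define u where "u z = complex_of_real (w (fst z))" for z :: "real \<times> real"
  define a where "a = restr L (\<lambda>z. complex_of_real (w' (fst z)))"
  have wm: "w \<in> borel_measurable borel" using wc by (rule borel_measurable_continuous_onI)
  have fstm: "(\<lambda>z::real\<times>real. \<phi> (fst z)) \<in> borel_measurable borel" if "\<phi> \<in> borel_measurable borel" for \<phi> :: "real \<Rightarrow> real"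
  proof -
    have "(\<lambda>z::real\<times>real. \<phi> (fst z)) \<in> borel_measurable (lborel \<Otimes>\<^sub>M lborel)" using that by measurable
    then show ?thesis unfolding lborel_prod by simp
  qed
  have um: "u \<in> borel_measurable borel" unfolding u_def[abs_def] using fstm[OF wm] by measurable
  have am: "a \<in> borel_measurable borel"
    unfolding a_def by (rule restr_measurable) (use fstm[OF w'm] in measurable)
  have uc: "continuous_on S u" for S
    unfolding u_def by (intro continuous_on_of_real continuous_on_compose2[OF wc] continuous_on_fst continuous_on_id) auto
  have ui: "has_bochner_integral lborel (\<lambda>z. (cmod (restr L u z))\<^sup>2) (L * M)"
  proof -
    have e: "(cmod (restr L u z))\<^sup>2 = indicator (strip L) z * (w (fst z))\<^sup>2" for z
      by (simp add: restr_def u_def indicator_def)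
    show ?thesis unfolding e M_def by (rule has_bochner_integral_strip[OF L I1]) simp
  qed
  have ai: "has_bochner_integral lborel (\<lambda>z. (cmod (a z))\<^sup>2) (L * P)"
  proof -
    have e: "(cmod (a z))\<^sup>2 = indicator (strip L) z * (w' (fst z))\<^sup>2" for z
      by (simp add: a_def restr_def indicator_def)
    show ?thesis unfolding e P_def by (rule has_bochner_integral_strip[OF L I2]) simp
  qed
  have uL2: "L2_fun lborel (restr L u)"
    unfolding L2_fun_def using restr_measurable[OF um] ui by (auto simp: has_bochner_integral_iff)
  have aL2: "L2_fun lborel a" unfolding L2_fun_def using am ai by (auto simp: has_bochner_integral_iff)
  have zL2: "L2_fun lborel (\<lambda>_::real\<times>real. 0)" by (simp add: L2_fun_def)
  have mem: "(x, y) \<in> strip L \<longleftrightarrow> y \<in> {0..L}" for x y by (auto simp: strip_def)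
  have "wder L (1, 0) (restr L u) a"
  proof (rule wder_fst_of_derivative[where S = "{0}"])
    fix y assume y: "y \<in> {0..L}"
    then have e: "restr L h (x, y) = h (x, y)" for h x using mem by simp
    show "continuous_on UNIV (\<lambda>x. restr L u (x, y))"
      unfolding e u_def by (simp add: continuous_on_of_real wc)
    show "((\<lambda>x. restr L u (x, y)) has_vector_derivative a (x, y)) (at x)" if "x \<notin> {0}" for x
      using has_vector_derivative_of_real[OF wd[of x]] that
      unfolding a_def e u_def by simp
  qed (use uL2 aL2 in \<open>auto simp: a_def\<close>)
  moreover have "wder L (0, 1) (restr L u) (\<lambda>_. 0)"
  proof (rule wder_snd_of_derivative)
    fix x
    show "continuous_on {0..L} (\<lambda>y. restr L u (x, y))"
      by (rule continuous_on_eq[of _ "\<lambda>_. u (x, 0)"]) (use mem in \<open>auto simp: u_def\<close>)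
    show "((\<lambda>y. restr L u (x, y)) has_vector_derivative 0) (at y)" if y: "y \<in> {0<..<L}" for y
      by (rule has_vector_derivative_transform_within_open[of "\<lambda>_. u (x, 0)" _ _ "{0<..<L}"])
         (use y mem in \<open>auto simp: u_def\<close>)
  qed (use uL2 zL2 L in auto)
  ultimately have h: "H1b L (restr L u) a (\<lambda>_. 0)"
    unfolding H1b_def using uL2 aL2 zL2 by (auto simp: a_def)
  have r: "rep L u (restr L u)"
    unfolding rep_def AE_lebesgue_on[OF strip_borel] using uL2 by auto
  have uS: "L2_fun (lebesgue_on (strip L)) u"
  proof -
    have m2: "(\<lambda>z. (cmod (u z))\<^sup>2) \<in> borel_measurable borel" using um by measurable
    have "(\<lambda>z. indicator (strip L) z *\<^sub>R (cmod (u z))\<^sup>2) = (\<lambda>z. (cmod (restr L u z))\<^sup>2)"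
      by (auto simp: restr_def indicator_def fun_eq_iff)
    then show ?thesis
      unfolding L2_fun_def using measurable_lebesgue_on[OF um] integral_lebesgue_on(2)[OF m2 strip_borel] ui
      by (auto simp: has_bochner_integral_iff)
  qed
  note E = H1b_imp_H1[OF L h r uS]
  have T: "(LINT y|lebesgue_on {0..L}. (cmod (trace0 L u y))\<^sup>2) = L * \<theta>0"
  proof -
    have "continuous_on (strip L) (restr L u)" by (rule continuous_on_eq[OF uc]) auto
    then have "AE y in lborel. y \<in> {0..L} \<longrightarrow> restr L u (0, y) = trc (restr L u) a y"
      by (rule trc_of_continuous[OF L h])
    then have "AE y in lborel. y \<in> {0..L} \<longrightarrow> trc (restr L u) a y = complex_of_real (w 0)"
      by eventually_elim (auto simp: mem u_def)
    then have "AE y in lebesgue_on {0..L}. trc (restr L u) a y = complex_of_real (w 0)"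
      by (subst AE_lebesgue_on) auto
    then have ae: "AE y in lebesgue_on {0..L}. (cmod (trc (restr L u) a y))\<^sup>2 = \<theta>0"
      by eventually_elim (simp add: w0)
    have "(LINT y|lebesgue_on {0..L}. (cmod (trace0 L u y))\<^sup>2) = (LINT y|lebesgue_on {0..L}. (cmod (trc (restr L u) a y))\<^sup>2)"
      by (rule trace0_integral[OF L h r E(1)])
    also have "\<dots> = (LINT y|lebesgue_on {0..L}. \<theta>0)"
    proof (rule integral_cong_AE[OF _ _ ae])
      have "trc (restr L u) a \<in> borel_measurable (lebesgue_on {0..L})"
        by (rule L2_fun_measurable[OF L2_fun_lebesgue_on[OF trc_L2(1)[OF uL2 aL2]]]) simp
      then show "(\<lambda>y. (cmod (trc (restr L u) a y))\<^sup>2) \<in> borel_measurable (lebesgue_on {0..L})" by measurable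
    qed simp
    also have "\<dots> = (LINT y|lborel. indicator {0..L} y *\<^sub>R \<theta>0)" by (rule integral_lebesgue_on(1)) auto
    also have "\<dots> = L * \<theta>0" using L by simp
    finally show ?thesis .
  qed
  have N: "(LINT z|lebesgue_on (strip L). cmod (u z) powr (p + 1)) = L * ((freq g k q \<theta>0 * M - P) / k)"
  proof -
    have pm: "(\<lambda>z. cmod (u z) powr (p + 1)) \<in> borel_measurable borel" using um by measurable
    have "(LINT z|lebesgue_on (strip L). cmod (u z) powr (p + 1)) = (LINT z|lborel. indicator (strip L) z *\<^sub>R cmod (u z) powr (p + 1))"
      by (rule integral_lebesgue_on(1)[OF pm strip_borel])
    also have "\<dots> = (LINT z|lborel. indicator (strip L) z * w (fst z) powr (p + 1))"
      by (rule Bochner_Integration.integral_cong) (use wpos in \<open>auto simp: u_def less_imp_le\<close>)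
    also have "\<dots> = L * ((freq g k q \<theta>0 * M - P) / k)"
      unfolding p1 using has_bochner_integral_strip[OF L I3] by (auto simp: M_def P_def has_bochner_integral_iff)
    finally show ?thesis .
  qed
  \<comment> \<open>The power term is half of \<open>freq\<close> times the mass minus half of
    \<open>P\<close>; the latter completes the gradient term to \<open>P\<close>, and
    \<open>P - g * \<theta>0\<close> is \<open>act\<close>.\<close>
  have "energy (- 2 * g) p L u = 1 / 2 * (L * P) - g * (L * \<theta>0) - k / 2 * (L * ((freq g k q \<theta>0 * M - P) / k))"
    unfolding energy_def E(3) T N k2 using ai by (simp add: has_bochner_integral_iff)
  also have "\<dots> = L * (act g k q \<theta>0 - freq g k q \<theta>0 * M / 2)"
    using gkq(2) by (simp add: P_def field_simps)
  finally have "energy (- 2 * g) p L u = L * (act g k q \<theta>0 - freq g k q \<theta>0 * M / 2)" .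
  then show ?thesis
    using E(1,2) ui by (intro exI[of _ u]) (auto simp: M_def has_bochner_integral_iff)
qed

text \<open>Gradient, mass and trace terms of the mollifications converge. The power term enters the
  energy with a negative sign, so the one-sided information from Fatou's lemma has the right
  direction.\<close>

lemma energy_lower_bound:
  assumes gkq: "g > 0" "k > 0" "0 < q" "q < 1" and t0: "\<theta>0 > 0" "gmass g k q \<theta>0 > 0" and L: "L > 0"
    and p: "p = 2 * q + 1" "k = 2 / (p + 1)"
    and h: "H1b L u' a b" and r: "rep L u u'" and u: "u \<in> H1 L" and m: "mass L u = L * gmass g k q \<theta>0"
  shows "L * (act g k q \<theta>0 - freq g k q \<theta>0 * gmass g k q \<theta>0 / 2)
      + (1 / 2 - 4 * (k * \<theta>0 powr q) * L\<^sup>2) * (LINT z|lborel. (cmod (b z))\<^sup>2) \<le> energy (- 2 * g) p L u"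
proof -
  define M where "M = gmass g k q \<theta>0"
  define C0 where "C0 = act g k q \<theta>0 - freq g k q \<theta>0 * M / 2"
  define K where "K = k * \<theta>0 powr q / (6 * M\<^sup>2)"
  have p1: "p + 1 = 2 * q + 2" using p(1) by simp
  have "k = 2 * (1 / (p + 1))" using p(2) by simp
  then have k2: "1 / (p + 1) = k / 2" by linarith
  have uS: "L2_fun (lebesgue_on (strip L)) u" using u by (simp add: H1_def)
  note E = H1b_imp_H1[OF L h r uS]
  define A where "A = (LINT z|lborel. (cmod (a z))\<^sup>2)"
  define D where "D = (LINT z|lborel. (cmod (b z))\<^sup>2)"
  define T where "T = (LINT y|lebesgue_on {0..L}. (cmod (trc u' a y))\<^sup>2)"
  have hb: "L2_fun lborel u'" "L2_fun lborel a" "L2_fun lborel b"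
    "\<And>z. z \<notin> strip L \<Longrightarrow> u' z = 0" "\<And>z. z \<notin> strip L \<Longrightarrow> a z = 0" "\<And>z. z \<notin> strip L \<Longrightarrow> b z = 0"
    using h by (auto simp: H1b_def)
  have meas: "u' \<in> borel_measurable borel" "a \<in> borel_measurable borel" "b \<in> borel_measurable borel"
    using hb(1-3) by (auto simp: L2_fun_def)
  have ms: "mass L u' = L * M" "mass L a = A" "mass L b = D"
    using mass_lborel'[OF meas(1) hb(4)] mass_lborel'[OF meas(2) hb(5)] mass_lborel'[OF meas(3) hb(6)] E(2) m
    by (simp_all add: A_def D_def M_def)
  obtain v a' b' where ap: "approx L u' a b v a' b'" using approx_exists[OF L h] by blast
  have L2: "L2_fun lborel (v n)" "L2_fun lborel (a' n)" "L2_fun lborel (b' n)" for n using ap unfolding approx_def by blast+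
  have c: "continuous_on UNIV (v n)" "continuous_on UNIV (a' n)" "continuous_on UNIV (b' n)" for n
    using ap unfolding approx_def by blast+
  have dx: "((\<lambda>x. v n (x, y)) has_vector_derivative a' n (x, y)) (at x)"
    and dy: "((\<lambda>y. v n (x, y)) has_vector_derivative b' n (x, y)) (at y)" if "y \<in> {0..L}" for n x y
    using ap that unfolding approx_def by blast+
  have lims: "(\<lambda>n. mass L (\<lambda>z. v n z - u' z)) \<longlonglongrightarrow> 0" "(\<lambda>n. mass L (\<lambda>z. a' n z - a z)) \<longlonglongrightarrow> 0"
    "(\<lambda>n. mass L (\<lambda>z. b' n z - b z)) \<longlonglongrightarrow> 0" using ap unfolding approx_def by blast+
  have mlim: "(\<lambda>n. mass L (f n)) \<longlonglongrightarrow> mass L f0"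
    if "\<And>n. L2_fun lborel (f n)" "L2_fun lborel f0" "(\<lambda>n. mass L (\<lambda>z. f n z - f0 z)) \<longlonglongrightarrow> 0" for f f0
    using that unfolding mass_def by (intro L2_norm_tendsto L2_fun_lebesgue_on) auto
  have Xl: "(\<lambda>n. mass L (v n)) \<longlonglongrightarrow> L * M" using mlim[OF L2(1) hb(1) lims(1)] by (simp add: ms)
  have Al: "(\<lambda>n. mass L (a' n)) \<longlonglongrightarrow> A" using mlim[OF L2(2) hb(2) lims(2)] by (simp add: ms)
  have Dl: "(\<lambda>n. mass L (b' n)) \<longlonglongrightarrow> D" using mlim[OF L2(3) hb(3) lims(3)] by (simp add: ms)
  have Tl: "(\<lambda>n. LINT y|lebesgue_on {0..L}. (cmod (v n (0, y)))\<^sup>2) \<longlonglongrightarrow> T"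
    unfolding T_def by (rule approx_trace_tendsto[OF L h ap])
  define B where "B n = (mass L (a' n) - 2 * g * (LINT y|lebesgue_on {0..L}. (cmod (v n (0, y)))\<^sup>2)
        - 2 * (L * C0 - freq g k q \<theta>0 / 2 * (mass L (v n) - L * M)
          - K * ((8 * mass L (v n) * mass L (b' n) + 2 * (mass L (v n) / L - M)\<^sup>2) * (2 * M * L + mass L (v n))))) / k" for n
  note est = strip_estimate[OF gkq t0 L L2 c dx dy, folded M_def, folded C0_def K_def, folded B_def]
  \<comment> \<open>The limit of \<open>B\<close>. The linear term drops out because the mass is
    exactly \<open>L * M\<close>; the correction becomes \<open>K\<close> times 8 L M D times 3 M L,
    and inserting \<open>K\<close> gives the constant 4.\<close>
  define B0 where "B0 = (A - 2 * g * T - 2 * (L * C0 - 4 * (k * \<theta>0 powr q) * L\<^sup>2 * D)) / k"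
  have Bl: "B \<longlonglongrightarrow> B0"
  proof -
    have "B \<longlonglongrightarrow> (A - 2 * g * T - 2 * (L * C0 - freq g k q \<theta>0 / 2 * (L * M - L * M)
          - K * ((8 * (L * M) * D + 2 * (L * M / L - M)\<^sup>2) * (2 * M * L + L * M)))) / k"
      unfolding B_def[abs_def] by (intro tendsto_intros Xl Al Dl Tl) (use L gkq in auto)
    also have "freq g k q \<theta>0 / 2 * (L * M - L * M) = 0" by simp
    also have "K * ((8 * (L * M) * D + 2 * (L * M / L - M)\<^sup>2) * (2 * M * L + L * M)) = 4 * (k * \<theta>0 powr q) * L\<^sup>2 * D"
      using t0 L by (simp add: K_def M_def power2_eq_square field_simps)
    finally show ?thesis by (simp add: B0_def)
  qed
  have B0: "B0 \<ge> 0" by (rule LIMSEQ_le_const[OF Bl]) (use est(1) in auto)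
  have "L2_fun (lebesgue_on (strip L)) (\<lambda>z. v n z - u' z)" for n
    by (intro L2_fun_lebesgue_on L2_fun_diff L2 hb) simp
  from L2_tendsto_AE_subseq[OF this lims(1)[unfolded mass_def]] obtain s where
    s: "strict_mono s" "AE z in lebesgue_on (strip L). (\<lambda>n. v (s n) z - u' z) \<longlonglongrightarrow> 0" by blast
  have ae: "AE z in lborel. z \<in> strip L \<longrightarrow> (\<lambda>n. v (s n) z) \<longlonglongrightarrow> u' z"
    using s(2) unfolding AE_lebesgue_on[OF strip_borel] by (simp add: LIM_zero_iff)
  let ?N = "\<lambda>f z. ennreal (indicator (strip L) z * cmod (f z) powr (2 * q + 2))"
  have vm [measurable]: "v n \<in> borel_measurable borel" for n using L2_fun_measurable[OF L2(1)] by simp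
  \<comment> \<open>Mean convergence gives pointwise convergence along a subsequence, to which
    Fatou's lemma applies.\<close>
  have "(\<integral>\<^sup>+z. ?N u' z \<partial>lborel) = (\<integral>\<^sup>+z. liminf (\<lambda>n. ?N (v (s n)) z) \<partial>lborel)"
  proof (rule nn_integral_cong_AE)
    show "AE z in lborel. ?N u' z = liminf (\<lambda>n. ?N (v (s n)) z)"
      using ae
    proof eventually_elim
      case (elim z)
      have "(\<lambda>n. ?N (v (s n)) z) \<longlonglongrightarrow> ?N u' z"
      proof (cases "z \<in> strip L")
        case True
        then have "(\<lambda>n. v (s n) z) \<longlonglongrightarrow> u' z" using elim by simp
        then have "(\<lambda>n. cmod (v (s n) z) powr (2 * q + 2)) \<longlonglongrightarrow> cmod (u' z) powr (2 * q + 2)"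
          by (intro tendsto_powr' tendsto_norm tendsto_const) (use gkq in auto)
        then show ?thesis using True by (intro tendsto_ennrealI) simp
      qed simp
      then show ?case by (rule lim_imp_Liminf[OF trivial_limit_sequentially, symmetric])
    qed
  qed
  also have "\<dots> \<le> liminf (\<lambda>n. \<integral>\<^sup>+z. ?N (v (s n)) z \<partial>lborel)"
    by (rule nn_integral_liminf) measurable
  also have "\<dots> \<le> liminf (\<lambda>n. ennreal (B (s n)))"
    by (rule Liminf_mono) (use est(2) in auto)
  also have "\<dots> = ennreal B0"
    using LIMSEQ_subseq_LIMSEQ[OF Bl s(1)] by (intro lim_imp_Liminf tendsto_ennrealI) (auto simp: comp_def)
  finally have le: "(\<integral>\<^sup>+z. ?N u' z \<partial>lborel) \<le> ennreal B0" .
  have Nu: "(LINT z|lebesgue_on (strip L). cmod (u z) powr (p + 1)) \<le> B0"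
  proof -
    have pm: "(\<lambda>z. cmod (u' z) powr (p + 1)) \<in> borel_measurable borel" using meas(1) by measurable
    have "(LINT z|lebesgue_on (strip L). cmod (u z) powr (p + 1)) = (LINT z|lebesgue_on (strip L). cmod (u' z) powr (p + 1))"
    proof (rule integral_cong_AE)
      show "(\<lambda>z. cmod (u z) powr (p + 1)) \<in> borel_measurable (lebesgue_on (strip L))"
        using L2_fun_measurable[OF uS] by measurable
      show "(\<lambda>z. cmod (u' z) powr (p + 1)) \<in> borel_measurable (lebesgue_on (strip L))"
        by (rule measurable_lebesgue_on[OF pm])
      have "AE z in lebesgue_on (strip L). u z = u' z" using r by (simp add: rep_def)
      then show "AE z in lebesgue_on (strip L). cmod (u z) powr (p + 1) = cmod (u' z) powr (p + 1)"
        by eventually_elim simp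
    qed
    also have "\<dots> = (LINT z|lborel. indicator (strip L) z * cmod (u' z) powr (2 * q + 2))"
      using integral_lebesgue_on(1)[OF pm strip_borel, of L] unfolding p1 by simp
    also have "\<dots> = enn2real (\<integral>\<^sup>+z. ?N u' z \<partial>lborel)"
      using meas(1) by (intro integral_eq_nn_integral) auto
    also have "\<dots> \<le> enn2real (ennreal B0)" using le by (intro enn2real_mono) auto
    finally show ?thesis using B0 by simp
  qed
  have "k * (LINT z|lebesgue_on (strip L). cmod (u z) powr (p + 1)) \<le> k * B0"
    using Nu gkq(2) by (intro mult_left_mono) auto
  also have "\<dots> = A - 2 * g * T - 2 * (L * C0 - 4 * (k * \<theta>0 powr q) * L\<^sup>2 * D)"
    using gkq(2) by (simp add: B0_def)
  finally have kN: "k * (LINT z|lebesgue_on (strip L). cmod (u z) powr (p + 1))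
      \<le> A - 2 * g * T - 2 * (L * C0 - 4 * (k * \<theta>0 powr q) * L\<^sup>2 * D)" .
  have "energy (- 2 * g) p L u = (A + D) / 2 - g * T - k * (LINT z|lebesgue_on (strip L). cmod (u z) powr (p + 1)) / 2"
    unfolding energy_def E(3) trace0_integral[OF L h r u] T_def[symmetric] A_def[symmetric] D_def[symmetric] k2 by simp
  moreover have "(1 / 2 - 4 * (k * \<theta>0 powr q) * L\<^sup>2) * D = D / 2 - 4 * (k * \<theta>0 powr q) * L\<^sup>2 * D"
    by (simp add: left_diff_distrib)
  moreover have "k * (LINT z|lebesgue_on (strip L). cmod (u z) powr (p + 1))
      \<le> A - 2 * (g * T) - 2 * (L * C0 - 4 * (k * \<theta>0 powr q) * L\<^sup>2 * D)" using kN by (simp only: mult.assoc)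
  moreover have "c + x \<le> e" if "e = (A + D) / 2 - t - n / 2" "x = D / 2 - W" "n \<le> A - 2 * t - 2 * (c - W)"
    for c x e t n W :: real using that by (simp add: field_simps)
  ultimately show ?thesis unfolding C0_def[symmetric] M_def[symmetric] D_def[symmetric] by blast
qed

text \<open>The mollifications are differentiable up to the boundary with vertical derivative
  exactly 0, hence constant in \<open>y\<close>. Their limit almost everywhere along a subsequence
  inherits this.\<close>

lemma indep_of_y_of_weak_deriv:
  assumes L: "L > 0" and h: "H1b L u' a b" and r: "rep L u u'" and b: "AE z in lborel. b z = 0"
  shows "indep_of_y L u"
proof -
  obtain v a' b' where ap: "approx L u' a b v a' b'" using approx_exists[OF L h] by blast
  have L2: "L2_fun lborel (v n)" for n using ap unfolding approx_def by blast
  have u'L2: "L2_fun lborel u'" using h by (auto simp: H1b_def)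
  have lim: "(\<lambda>n. mass L (\<lambda>z. v n z - u' z)) \<longlonglongrightarrow> 0" using ap unfolding approx_def by blast
  have "L2_fun (lebesgue_on (strip L)) (\<lambda>z. v n z - u' z)" for n
    by (intro L2_fun_lebesgue_on L2_fun_diff L2 u'L2) simp
  from L2_tendsto_AE_subseq[OF this lim[unfolded mass_def]] obtain s where
    s: "strict_mono s" "AE z in lebesgue_on (strip L). (\<lambda>n. v (s n) z - u' z) \<longlonglongrightarrow> 0" by blast
  have b'0: "b' n z = 0" for n z using ap b unfolding approx_def by blast
  have dy: "((\<lambda>y. v n (x, y)) has_vector_derivative b' n (x, y)) (at y)" if "y \<in> {0..L}" for n x y
    using ap that unfolding approx_def by blast
  have const: "v n z = v n (fst z, 0)" if z: "z \<in> strip L" for n z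
  proof -
    have z': "snd z \<in> {0..L}" using z by (auto simp: strip_def)
    have "((\<lambda>y. v n (fst z, y)) has_vector_derivative 0) (at y within {0..L})" if "y \<in> {0..L}" for y
      using dy[OF that, of n "fst z"] b'0 by (auto intro: has_vector_derivative_at_within)
    then obtain c where "\<And>y. y \<in> {0..L} \<Longrightarrow> v n (fst z, y) = c"
      using has_vector_derivative_zero_constant[of "{0..L}" "\<lambda>y. v n (fst z, y)"] by auto
    from this[OF z'] this[of 0] show ?thesis using L by simp
  qed
  \<comment> \<open>Where the sequence diverges, \<open>lim\<close> is some unspecified value; the
    heights of a line share the same sequence, so this happens only over a null set of the
    strip.\<close>
  define f where "f x = lim (\<lambda>n. v (s n) (x, 0))" for x
  have "AE z in lebesgue_on (strip L). u z = u' z" using r by (simp add: rep_def)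
  moreover have "AE z in lebesgue_on (strip L). z \<in> strip L" using AE_space[of "lebesgue_on (strip L)"] by simp
  ultimately have "AE z in lebesgue_on (strip L). u z = f (fst z)"
    using s(2)
  proof eventually_elim
    case (elim z)
    have "(\<lambda>n. v (s n) z) \<longlonglongrightarrow> u' z" using elim(3) by (simp add: LIM_zero_iff)
    then have "(\<lambda>n. v (s n) (fst z, 0)) \<longlonglongrightarrow> u' z" by (simp add: const[OF elim(2), symmetric])
    then show ?case using elim(1) by (simp add: f_def limI)
  qed
  then show ?thesis unfolding indep_of_y_def by blast
qed

theorem theorem1p4:
  fixes \<gamma> p mt :: real
  assumes "\<gamma> < 0" and "1 < p" and "p < 3" and "mt > 0"
  shows "\<exists>Lstar > 0. \<forall>L. 0 < L \<and> L < Lstar \<longrightarrow>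
           (\<forall>u. is_minimizer \<gamma> p L (mt * L) u \<and> real_positive L u \<longrightarrow> indep_of_y L u)"
proof -
  define g where "g = - \<gamma> / 2"
  define q where "q = (p - 1) / 2"
  define k where "k = 2 / (p + 1)"
  have gkq: "g > 0" "k > 0" "0 < q" "q < 1" using assms by (auto simp: g_def q_def k_def)
  have p: "p = 2 * q + 1" "k = 2 / (p + 1)" by (auto simp: q_def k_def field_simps)
  have \<gamma>: "\<gamma> = - 2 * g" by (simp add: g_def)
  \<comment> \<open>Mass \<open>mt * L\<close> means \<open>mt\<close> per unit height, so the
    comparison ground state, and with it the threshold for \<open>L\<close>, does not depend on
    \<open>L\<close>.\<close>
  obtain \<theta>0 where t0: "\<theta>0 > 0" "gmass g k q \<theta>0 = mt" using gmass_surj[OF gkq assms(4)] by blast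
  define z0 where "z0 = k * \<theta>0 powr q"
  have z0: "z0 > 0" using gkq t0 by (simp add: z0_def)
  show ?thesis
  \<comment> \<open>The width at which the coefficient \<open>1 / 2 - 4 * z0 * L\<^sup>2\<close> of
    the vertical energy in \<open>energy_lower_bound\<close> changes sign.\<close>
  proof (intro exI[of _ "1 / sqrt (8 * z0)"] conjI allI impI; (elim conjE)?)
    show "0 < 1 / sqrt (8 * z0)" using z0 by simp
  next
    fix L u assume L: "0 < L" "L < 1 / sqrt (8 * z0)" and min: "is_minimizer \<gamma> p L (mt * L) u"
    have small: "8 * z0 * L\<^sup>2 < 1"
    proof -
      have "L * sqrt (8 * z0) < 1" using L z0 by (simp add: field_simps)
      then have "(L * sqrt (8 * z0))\<^sup>2 < 1\<^sup>2" using L z0 by (intro power_strict_mono) auto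
      then show ?thesis using z0 by (simp add: power_mult_distrib mult.commute)
    qed
    have u: "u \<in> H1 L" "mass L u = L * mt" "ereal (energy \<gamma> p L u) = ground_energy \<gamma> p L (mt * L)"
      using min by (auto simp: is_minimizer_def mult.commute)
    obtain u' a b where h: "H1b L u' a b" "rep L u u'" using H1_imp_H1b[OF u(1)] by blast
    obtain w where w: "w \<in> H1 L" "mass L w = L * mt"
      "energy \<gamma> p L w = L * (act g k q \<theta>0 - freq g k q \<theta>0 * mt / 2)"
      using competitor[OF gkq t0(1) L(1) p] unfolding t0(2) \<gamma> by blast
    define D where "D = (LINT z|lborel. (cmod (b z))\<^sup>2)"
    have "ground_energy \<gamma> p L (mt * L) \<le> ereal (energy \<gamma> p L w)"
      unfolding ground_energy_def
      by (intro Inf_lower CollectI exI[of _ w]) (use w in \<open>simp add: mult.commute\<close>)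
    then have "energy \<gamma> p L u \<le> energy \<gamma> p L w" unfolding u(3)[symmetric] by simp
    moreover have "L * (act g k q \<theta>0 - freq g k q \<theta>0 * mt / 2) + (1 / 2 - 4 * z0 * L\<^sup>2) * D \<le> energy \<gamma> p L u"
      using energy_lower_bound[OF gkq t0(1) _ L(1) p h u(1)] u(2) assms(4) by (simp add: t0(2) \<gamma> D_def z0_def)
    ultimately have "(1 / 2 - 4 * z0 * L\<^sup>2) * D \<le> 0" using w(3) by simp
    moreover have "1 / 2 - 4 * z0 * L\<^sup>2 > 0" using small by simp
    ultimately have "D \<le> 0" by (simp add: mult_le_0_iff)
    moreover have "D \<ge> 0" unfolding D_def by (rule Bochner_Integration.integral_nonneg) simp
    ultimately have "D = 0" by simp
    moreover have "L2_fun lborel b" using h by (auto simp: H1b_def)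
    ultimately have "AE z in lborel. (cmod (b z))\<^sup>2 = 0"
      unfolding D_def using integral_nonneg_eq_0_iff_AE[OF L2_fun_integrable] by auto
    then have "AE z in lborel. b z = 0" by eventually_elim simp
    then show "indep_of_y L u" by (rule indep_of_y_of_weak_deriv[OF L(1) h])
  qed
qed

end
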